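(* Let $f:[-\pi,\pi]\to\mathbb R$ be a real even function such that - $f$ is Riemann integrable with connected range, - $f$ has a finite number of local maxima, local minima and discontinuity points. Then there exist an asymptotically uniform grid $\{\xi_{1,n},\xi_{2,n},\dots,\xi_{n,n}\}_n$ in $[0,\pi]$ and, for every $n$, orderings (with multiplicity) $\lambda_1(T_n(f)),\dots,\lambda_n(T_n(f))$ of the eigenvalues of $T_n(f)$ and $\lambda_1(H_n(f)),\dots,\lambda_n(H_n(f))$ of the eigenvalues of $H_n(f)$ such that $$\lambda_i(T_n(f))=f(\xi_{i,n}),\qquad \lambda_i(H_n(f))=(-1)^{i+1}\lambda_i(T_n(f)),$$ for all $i=1,\dots,n$.
   Context: For $f\in L^1(-\pi,\pi)$, with Fourier coefficients $\hat f_k=\frac1{2\pi}\int_{-\pi}^{\pi}f(\theta)e^{-\mathbf{i}k\theta}\,d\theta$, $k\in\mathbb Z$, $T_n(f)$ is the $n\times n$ Toeplitz matrix $(T_n(f))_{s,t}=\hat f_{s-t}$, $s,t=1,\dots,n$. $Y_n$ is the $n\times n$ flip matrix ($(Y_n)_{i,j}=1$ if $i+j=n+1$, $0$ otherwise), and $H_n(f)=Y_nT_n(f)$. A sequence of grids $\{\xi_{i,n}\}_{i=1,\dots,n}$ of points of $[a,b]$ is asymptotically uniform in $[a,b]$ if $\max_{i=1,\dots,n}\left|\xi_{i,n}-\left(a+i\,\frac{b-a}{n}\right)\right|\to0$ as $n\to\infty$. *)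

theory Defs
  imports "HOL-Analysis.Analysis" "Jordan_Normal_Form.Char_Poly"
begin

(* Riemann sums over tagged partitions. The library integral is the Henstock-Kurzweil one;
   restricting to gauges of constant radius d (each cell lies within distance d of its tag)
   yields the classical Riemann integral. *)
definition riemann_integrable_on :: "(real \<Rightarrow> real) \<Rightarrow> real \<Rightarrow> real \<Rightarrow> bool" where
  "riemann_integrable_on f a b \<longleftrightarrow>
     (\<exists>I. \<forall>e>0. \<exists>d>0. \<forall>D.
        D tagged_division_of {a..b} \<and> (\<lambda>x. ball x d) fine D \<longrightarrow>
        \<bar>(\<Sum>(x, K)\<in>D. Henstock_Kurzweil_Integration.content K * f x) - I\<bar> < e)"

(* Extrema are non-strict and relative to S: neighbourhoods are taken in S, so endpoints of an
   interval count, and every point of a plateau is both a local maximum and a local minimum. *)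
definition local_max_points :: "(real \<Rightarrow> real) \<Rightarrow> real set \<Rightarrow> real set" where
  "local_max_points f S = {x \<in> S. \<forall>\<^sub>F y in at x within S. f y \<le> f x}"

definition local_min_points :: "(real \<Rightarrow> real) \<Rightarrow> real set \<Rightarrow> real set" where
  "local_min_points f S = {x \<in> S. \<forall>\<^sub>F y in at x within S. f x \<le> f y}"

definition discontinuity_points :: "(real \<Rightarrow> real) \<Rightarrow> real set \<Rightarrow> real set" where
  "discontinuity_points f S = {x \<in> S. \<not> continuous (at x within S) f}"

definition fourier_coeff :: "(real \<Rightarrow> complex) \<Rightarrow> int \<Rightarrow> complex" where
  "fourier_coeff f k =
     1 / (2 * of_real pi) *
     (LINT \<theta>:{-pi..pi}|lebesgue. f \<theta> * exp (- (\<i> * of_int k * of_real \<theta>)))"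

(* Matrix indices start at 0; the Toeplitz entry only depends on the difference of indices. *)
definition toeplitz_mat :: "nat \<Rightarrow> (real \<Rightarrow> complex) \<Rightarrow> complex Matrix.mat" where
  "toeplitz_mat n f = Matrix.mat n n (\<lambda>(s, t). fourier_coeff f (int s - int t))"

(* i + j = n + 1 for indices starting at 1 *)
definition flip_mat :: "nat \<Rightarrow> complex Matrix.mat" where
  "flip_mat n = Matrix.mat n n (\<lambda>(i, j). if i + j + 1 = n then 1 else 0)"

definition hankel_mat :: "nat \<Rightarrow> (real \<Rightarrow> complex) \<Rightarrow> complex Matrix.mat" where
  "hankel_mat n f = flip_mat n * toeplitz_mat n f"

(* l 1, ..., l n lists the eigenvalues of the n x n matrix A, each as often as its algebraic
   multiplicity. Order of a root is qualified since group theory also has an order. *)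
definition eigenvalue_ordering :: "complex Matrix.mat \<Rightarrow> (nat \<Rightarrow> complex) \<Rightarrow> bool" where
  "eigenvalue_ordering A l \<longleftrightarrow>
     (\<forall>z. card {i \<in> {1..dim_row A}. l i = z} = Polynomial.order z (char_poly A))"

(* The point with index i of the n-th grid is xi n i, for 1 \<le> i \<le> n. *)
definition asymptotically_uniform_grid :: "real \<Rightarrow> real \<Rightarrow> (nat \<Rightarrow> nat \<Rightarrow> real) \<Rightarrow> bool" where
  "asymptotically_uniform_grid a b \<xi> \<longleftrightarrow>
     (\<forall>n\<ge>1. \<forall>i\<in>{1..n}. \<xi> n i \<in> {a..b}) \<and>
     (\<lambda>n. MAX i\<in>{1..n}. \<bar>\<xi> n i - (a + real i * ((b - a) / real n))\<bar>) \<longlonglongrightarrow> 0"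

end

theory Submission
  imports Defs "HOL-Real_Asymp.Real_Asymp" "Jordan_Normal_Form.Spectral_Radius"
begin

text \<open>The real symmetric Toeplitz matrix \<open>T\<close> commutes with the flip \<open>Y\<close>, so it has an orthonormal
  basis of eigenvectors \<open>v\<close> with \<open>Y v = \<plusminus> v\<close>, of which \<open>(n + 1) div 2\<close> are symmetric; the matrix
  \<open>Y T\<close> has the same eigenvectors, with eigenvalues \<open>\<plusminus> \<lambda>\<close>. It therefore suffices to show that
  the symmetric and the antisymmetric eigenvalues are separately values of \<open>f\<close> on asymptotically
  uniform grids, and to interleave these grids.

  An eigenvector \<open>v\<close> gives a trigonometric sum \<open>V\<close> for which \<open>(f - \<lambda>) V\<close> is orthogonal to all
  trigonometric sums of length \<open>n\<close>. In particular \<open>\<lambda>\<close> is the mean of \<open>f\<close> with respect to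
  \<open>|V|\<^sup>2\<close>, hence a value of \<open>f\<close>, and \<open>\<parallel>(f - \<lambda>) V\<parallel>\<close> is the distance from \<open>f V\<close> to these sums.
  Approximating \<open>f\<close> by a polynomial in the cosine shows that the sum over all eigenvectors of
  \<open>\<parallel>(f - \<lambda>) V\<parallel>\<^sup>2\<close> is \<open>o(n)\<close>, so for Lipschitz \<open>G\<close> the sums of \<open>G(\<lambda>)\<close> and of the
  means of \<open>G \<circ> f\<close> agree up to \<open>o(n)\<close>.
  The sum of \<open>|V|\<^sup>2\<close> over one symmetry class is \<open>n / 2\<close> up to a Dirichlet kernel,
  whose contribution is \<open>O(\<surd>n)\<close>. Hence each class is distributed like \<open>f\<close>.

  Finally the eigenvalues are lifted: the values of \<open>f\<close> are classified by the set of cells of a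
  partition of the interval in which they are attained; the eigenvalues in each class are
  distributed over these cells in proportion to the measure of the preimage. The sorted lifts
  form a uniform grid.\<close>

section \<open>Simultaneous diagonalisation\<close>

text \<open>The signs \<open>(-1)^(i+1)\<close> are tied to positions, so a grid for the whole
  spectrum would not do: position \<open>i\<close> must hold a symmetric eigenvector for odd
  \<open>i\<close> and an antisymmetric one for even \<open>i\<close>, whatever the size of the
  eigenvalue. Hence each symmetry class needs a uniform grid of its own. A multiple eigenvalue of
  the Toeplitz matrix may mix the symmetries inside its eigenspace; diagonalising it together with
  the flip settles which eigenvectors are meant. A value of \<open>f\<close> can have several
  preimages, and an unbalanced choice among them would crowd the grid. The proportional choice
  repairs this once the number of eigenvalues in each class of values converges. That needs class
  boundaries whose preimages are null: finitely many extrema and discontinuities make every level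
  set finite, and images of intervals have finite frontiers. Boundedness comes from Riemann
  integrability; connectedness of the range keeps the eigenvalues among the values of
  \<open>f\<close>. No rate of convergence is available: partition and approximating polynomial are
  fixed before \<open>n\<close> grows, and a near-minimal choice turns the estimates for fixed
  \<epsilon> into one sequence.\<close>

lemma sum_rotate:
  "(\<Sum>l\<in>A. \<Sum>j\<in>B. \<Sum>k\<in>C. h l j k) = (\<Sum>j\<in>B. \<Sum>k\<in>C. \<Sum>l\<in>A. h l j k)"
  by (rule trans[OF sum.swap], intro sum.cong refl, rule sum.swap)

text \<open>Nonemptiness of the complex spectrum gives the eigenvector; its norm and first
  coordinate are then adjusted by a scalar. The condition on \<open>v 0\<close> prepares the
  reflection in \<open>orthonormal_completion\<close>.\<close>

lemma unit_eigenvector_exists: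
  fixes N :: "nat \<Rightarrow> nat \<Rightarrow> complex"
  assumes "n > 0"
  obtains \<mu> v where "(\<Sum>k<n. v k * cnj (v k)) = 1" "v 0 \<in> \<real>" "Re (v 0) \<le> 0"
    "\<And>j. j < n \<Longrightarrow> (\<Sum>k<n. N j k * v k) = \<mu> * v j"
proof -
  define A where "A = Matrix.mat n n (\<lambda>(j, k). N j k)"
  have A: "A \<in> carrier_mat n n" by (simp add: A_def)
  from spectrum_non_empty[OF A assms] obtain \<mu> x where ev: "eigenvector A x \<mu>"
    unfolding spectrum_def eigenvalue_def by auto
  have x: "x \<in> carrier_vec n" "x \<noteq> 0\<^sub>v n" "A *\<^sub>v x = \<mu> \<cdot>\<^sub>v x"
    using ev A unfolding eigenvector_def by auto
  define w where "w k = vec_index x k" for k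
  have eq: "(\<Sum>k<n. N j k * w k) = \<mu> * w j" if "j < n" for j
  proof -
    have "vec_index (A *\<^sub>v x) j = vec_index (\<mu> \<cdot>\<^sub>v x) j" by (simp add: x)
    thus ?thesis using that x(1)
      by (simp add: A_def scalar_prod_def w_def row_def lessThan_atLeast0)
  qed
  define r where "r = (\<Sum>k<n. (cmod (w k))\<^sup>2)"
  have "\<exists>k<n. w k \<noteq> 0"
  proof (rule ccontr)
    assume "\<not> ?thesis"
    hence "x = 0\<^sub>v n" using x(1) by (intro eq_vecI) (auto simp: w_def)
    thus False using x by simp
  qed
  hence r: "r > 0" unfolding r_def by (force intro: sum_pos2)
  \<comment> \<open>A phase turning \<open>w 0\<close> onto the nonpositive real axis; if
    \<open>w 0 = 0\<close>, every phase does.\<close>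
  define c where "c = (if w 0 = 0 then 1 else - cnj (w 0) / of_real (cmod (w 0)))"
  have cn: "cmod (w 0) \<noteq> 0 \<Longrightarrow> cnj (w 0) * w 0 = complex_of_real (cmod (w 0)) * of_real (cmod (w 0))"
    using complex_norm_square[of "w 0"] by (simp add: power2_eq_square mult.commute)
  have c: "c * cnj c = 1"
    using cn by (auto simp: c_def)
  have c0: "c * w 0 = - of_real (cmod (w 0))"
    using cn by (auto simp: c_def)
  define v where "v k = c * w k / of_real (sqrt r)" for k
  show thesis
  proof
    have "(\<Sum>k<n. v k * cnj (v k)) = (\<Sum>k<n. (c * cnj c) * of_real ((cmod (w k))\<^sup>2) / of_real r)"
      using r by (intro sum.cong refl)
        (simp add: v_def complex_norm_square field_simps del: of_real_power flip: of_real_mult)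
    also have "\<dots> = of_real (r / r)"
      unfolding c of_real_divide by (subst (2) r_def) (simp flip: sum_divide_distrib)
    finally show "(\<Sum>k<n. v k * cnj (v k)) = 1" using r by simp
    show "v 0 \<in> \<real>" unfolding v_def c0 by simp
    show "Re (v 0) \<le> 0" using r unfolding v_def c0 by (simp flip: of_real_divide of_real_minus)
    show "(\<Sum>k<n. N j k * v k) = \<mu> * v j" if "j < n" for j
      using eq[OF that] unfolding v_def
      by (simp add: sum_divide_distrib[symmetric] sum_distrib_left[symmetric] mult.left_commute
          mult.assoc)
  qed
qed

text \<open>Vectors and kernels are plain functions of indices, so that the induction below can
  shift them by \<open>Suc\<close>; \<open>U i k\<close> is coordinate \<open>k\<close> of vector
  \<open>i\<close>.\<close>

definition orthonormal_family :: "nat \<Rightarrow> (nat \<Rightarrow> nat \<Rightarrow> complex) \<Rightarrow> bool" where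
  "orthonormal_family n U \<longleftrightarrow>
     (\<forall>i<n. \<forall>j<n. (\<Sum>k<n. U i k * cnj (U j k)) = (if i = j then 1 else 0))"

text \<open>Orthonormality says that the square matrix \<open>U\<close> times its adjoint is the
  identity. A one-sided inverse is two-sided, which gives this completeness relation.\<close>

lemma orthonormal_family_rows:
  assumes "orthonormal_family n U" "k < n" "l < n"
  shows "(\<Sum>i<n. U i k * cnj (U i l)) = (if k = l then 1 else 0)"
proof -
  define A where "A = Matrix.mat n n (\<lambda>(i, k). U i k)"
  define B where "B = Matrix.mat n n (\<lambda>(k, i). cnj (U i k))"
  have "A * B = 1\<^sub>m n"
    using assms(1) by (intro eq_matI)
      (auto simp: A_def B_def orthonormal_family_def scalar_prod_def lessThan_atLeast0)
  hence "B * A = 1\<^sub>m n"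
    by (intro mat_mult_left_right_inverse[of A n B]) (auto simp: A_def B_def)
  hence "(B * A) $$ (l, k) = 1\<^sub>m n $$ (l, k)" by simp
  thus ?thesis using assms(2,3)
    by (auto simp: A_def B_def scalar_prod_def lessThan_atLeast0 mult.commute)
qed

text \<open>The reflection exchanging \<^term>\<open>v\<close> with the first basis vector; the sign condition on
  \<^term>\<open>v 0\<close> keeps the two apart.\<close>

lemma orthonormal_completion:
  assumes n: "n > 0" and v: "(\<Sum>k<n. v k * cnj (v k)) = 1" "v 0 \<in> \<real>" "Re (v 0) \<le> 0"
  obtains W where "orthonormal_family n W" "\<And>k. k < n \<Longrightarrow> W 0 k = v k"
proof -
  define u where "u k = (if k = 0 then 1 else 0) - v k" for k :: nat
  \<comment> \<open>The squared norm of \<open>u\<close>, the difference of the first basis vector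
    and \<open>v\<close>; it takes this form because \<open>v 0\<close> is real.\<close>
  define s where "s = 2 - 2 * v 0"
  have v0: "cnj (v 0) = v 0" using v(2) by (simp add: Reals_cnj_iff)
  have s0: "s \<noteq> 0"
  proof
    assume "s = 0"
    hence "v 0 = 1" by (simp add: s_def)
    thus False using v(3) by simp
  qed
  have cs: "cnj s = s" by (simp add: s_def v0)
  have us: "(\<Sum>k<n. u k * cnj (u k)) = s"
  proof -
    have "(\<Sum>k<n. u k * cnj (u k)) = (\<Sum>k<n. (if k = 0 then 1 - v 0 - cnj (v 0) else 0) + v k * cnj (v k))"
      by (intro sum.cong) (auto simp: u_def algebra_simps)
    also have "\<dots> = s" using n by (simp add: sum.distrib v sum.delta s_def v0)
    finally show ?thesis .
  qed
  \<comment> \<open>Householder reflection along \<open>u\<close>. Since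
    \<open>2 * cnj (u 0) = s\<close>, its row 0 is the first basis vector minus \<open>u\<close>,
    that is \<open>v\<close>.\<close>
  define W where "W j k = (if j = k then 1 else 0) - 2 * cnj (u j) * u k / s" for j k :: nat
  show thesis
  proof
    show "orthonormal_family n W"
      unfolding orthonormal_family_def
    proof (intro allI impI)
      fix i j assume ij: "i < n" "j < n"
      have "(\<Sum>k<n. W i k * cnj (W j k)) =
        (\<Sum>k<n. (if k = i then (if i = j then 1 else 0) - 2 * u j * cnj (u i) / s else 0)
          - (if k = j then 2 * cnj (u i) * u j / s else 0)
          + 4 * cnj (u i) * u j / s^2 * (u k * cnj (u k)))"
        using s0 by (intro sum.cong refl) (auto simp: W_def cs field_simps power2_eq_square)
      also have "\<dots> = (if i = j then 1 else 0)"
        unfolding sum.distrib sum_subtractf sum_distrib_left[symmetric] us using ij s0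
        by (simp add: sum.delta field_simps power2_eq_square)
      finally show "(\<Sum>k<n. W i k * cnj (W j k)) = (if i = j then 1 else 0)" .
    qed
    have "2 * cnj (u 0) / s = 1"
      using s0 by (simp add: u_def v0 s_def field_simps)
    hence "W 0 k = (if 0 = k then 1 else 0) - u k" for k
      unfolding W_def by (metis mult_1 times_divide_eq_left)
    thus "W 0 k = v k" if "k < n" for k by (simp add: u_def)
  qed
qed

text \<open>Entrywise form of normality: \<open>N\<close> commutes with its adjoint.\<close>

definition normal_kernel :: "nat \<Rightarrow> (nat \<Rightarrow> nat \<Rightarrow> complex) \<Rightarrow> bool" where
  "normal_kernel n N \<longleftrightarrow>
     (\<forall>i<n. \<forall>j<n. (\<Sum>k<n. N i k * cnj (N j k)) = (\<Sum>k<n. cnj (N k i) * N k j))"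

text \<open>Parseval: the inner sums are the coordinates of \<open>x\<close> and \<open>y\<close> in
  the basis \<open>W\<close>, and the completeness relation removes the basis.\<close>

lemma orthonormal_family_contract:
  assumes "orthonormal_family n W"
  shows "(\<Sum>l<n. (\<Sum>j<n. cnj (W l j) * x j) * cnj (\<Sum>j<n. cnj (W l j) * y j)) = (\<Sum>j<n. x j * cnj (y j))"
proof -
  have "(\<Sum>l<n. (\<Sum>j<n. cnj (W l j) * x j) * cnj (\<Sum>j<n. cnj (W l j) * y j))
      = (\<Sum>l<n. \<Sum>j<n. \<Sum>k<n. x j * cnj (y k) * (W l k * cnj (W l j)))"
    by (simp add: sum_product algebra_simps)
  also have "\<dots> = (\<Sum>j<n. \<Sum>k<n. x j * cnj (y k) * (\<Sum>l<n. W l k * cnj (W l j)))"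
    unfolding sum_distrib_left by (rule sum_rotate)
  also have "\<dots> = (\<Sum>j<n. \<Sum>k<n. if k = j then x j * cnj (y j) else 0)"
    by (intro sum.cong refl) (simp add: orthonormal_family_rows[OF assms])
  also have "\<dots> = (\<Sum>j<n. x j * cnj (y j))" by (simp add: sum.delta)
  finally show ?thesis .
qed

text \<open>Deflation. In an orthonormal basis starting with a unit eigenvector, column 0 of the
  kernel vanishes off the diagonal. Normality equates the norms of row 0 and column 0, so row 0 does
  the same, and a normal block of size \<open>n\<close> remains.\<close>

theorem normal_kernel_diagonalizable:
  assumes "normal_kernel n N"
  shows "\<exists>U d. orthonormal_family n U \<and> (\<forall>i<n. \<forall>j<n. (\<Sum>k<n. N j k * U i k) = d i * U i j)"
  using assms
proof (induction n arbitrary: N)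
  case 0
  show ?case by (simp add: orthonormal_family_def)
next
  case (Suc n)
  let ?n = "Suc n"
  obtain \<mu> v where v: "(\<Sum>k<?n. v k * cnj (v k)) = 1" "v 0 \<in> \<real>" "Re (v 0) \<le> 0"
    "\<And>j. j < ?n \<Longrightarrow> (\<Sum>k<?n. N j k * v k) = \<mu> * v j"
    by (rule unit_eigenvector_exists[OF zero_less_Suc, of n N]) (rule that)
  obtain W where W: "orthonormal_family ?n W" "\<And>k. k < ?n \<Longrightarrow> W 0 k = v k"
    using orthonormal_completion[OF zero_less_Suc v(1-3)] by blast
  define R where "R k i = (\<Sum>l<?n. N k l * W i l)" for k i
  \<comment> \<open>The kernel \<open>N\<close> in the basis \<open>W\<close>; \<open>normM\<close>
    verifies that normality survives the change of basis.\<close>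
  define M where "M i j = (\<Sum>k<?n. cnj (W i k) * R k j)" for i j
  have orth: "(\<Sum>k<?n. W i k * cnj (W j k)) = (if i = j then 1 else 0)" if "i < ?n" "j < ?n" for i j
    using W(1) that unfolding orthonormal_family_def by blast
  have WM: "(\<Sum>i<?n. W i k * M i j) = R k j" if "k < ?n" for k j
  proof -
    have "(\<Sum>i<?n. W i k * M i j) = (\<Sum>i<?n. \<Sum>l<?n. R l j * (W i k * cnj (W i l)))"
      by (simp add: M_def sum_distrib_left algebra_simps del: sum.lessThan_Suc)
    also have "\<dots> = (\<Sum>l<?n. R l j * (\<Sum>i<?n. W i k * cnj (W i l)))"
      unfolding sum_distrib_left by (rule sum.swap)
    also have "\<dots> = (\<Sum>l<?n. if l = k then R k j else 0)"
      using that by (intro sum.cong refl) (simp add: orthonormal_family_rows[OF W(1)] del: sum.lessThan_Suc)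
    also have "\<dots> = R k j" using that by (simp add: sum.delta del: sum.lessThan_Suc)
    finally show ?thesis .
  qed
  have col0: "M i 0 = (if i = 0 then \<mu> else 0)" if "i < ?n" for i
  proof -
    have "R k 0 = \<mu> * W 0 k" if "k < ?n" for k
      unfolding R_def using v(4)[OF that] W(2) that by (simp del: sum.lessThan_Suc)
    hence "M i 0 = \<mu> * (\<Sum>k<?n. W 0 k * cnj (W i k))"
      unfolding M_def sum_distrib_left by (intro sum.cong refl) (auto simp: algebra_simps)
    thus ?thesis using orth[of 0 i] that by auto
  qed
  have normM: "(\<Sum>k<?n. M i k * cnj (M j k)) = (\<Sum>k<?n. cnj (M k i) * M k j)" (is "?l = ?r")
    if ij: "i < ?n" "j < ?n" for i j
  proof -
    define S where "S k l = (\<Sum>m<?n. N k m * cnj (N l m))" for k l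
    have S': "S k l = (\<Sum>m<?n. cnj (N m k) * N m l)" if "k < ?n" "l < ?n" for k l
      using Suc.prems that unfolding normal_kernel_def S_def by blast
    \<comment> \<open>Row \<open>i\<close> of \<open>M\<close> is, up to conjugation, the coordinate
      vector of the adjoint applied to \<open>W i\<close>, so Parseval evaluates products of rows as
      it does products of columns.\<close>
    have Mrow: "M i k = cnj (\<Sum>l<?n. cnj (W k l) * (\<Sum>m<?n. cnj (N m l) * W i m))" for i k
    proof -
      have "M i k = (\<Sum>m<?n. \<Sum>l<?n. cnj (W i m) * N m l * W k l)"
        unfolding M_def R_def sum_distrib_left by (simp add: mult.assoc del: sum.lessThan_Suc)
      also have "\<dots> = (\<Sum>l<?n. \<Sum>m<?n. cnj (W i m) * N m l * W k l)" by (rule sum.swap)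
      also have "\<dots> = cnj (\<Sum>l<?n. cnj (W k l) * (\<Sum>m<?n. cnj (N m l) * W i m))"
        unfolding sum_distrib_left cnj_sum by (intro sum.cong refl) (simp add: algebra_simps)
      finally show ?thesis .
    qed
    have "?l = cnj (\<Sum>l<?n. (\<Sum>m<?n. cnj (N m l) * W i m) * cnj (\<Sum>m<?n. cnj (N m l) * W j m))"
      unfolding Mrow
      by (subst orthonormal_family_contract[OF W(1), symmetric])
        (simp only: cnj_sum complex_cnj_mult complex_cnj_cnj)
    also have "\<dots> = (\<Sum>l<?n. \<Sum>m<?n. \<Sum>p<?n. cnj (W i m) * W j p * (N m l * cnj (N p l)))"
      by (simp add: sum_product algebra_simps del: sum.lessThan_Suc)
        (rule sum.cong[OF refl], rule sum.swap)
    also have "\<dots> = (\<Sum>m<?n. \<Sum>p<?n. cnj (W i m) * W j p * S m p)"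
      unfolding S_def sum_distrib_left by (rule sum_rotate)
    also have "\<dots> = (\<Sum>m<?n. \<Sum>p<?n. \<Sum>l<?n. cnj (W i m) * W j p * (cnj (N l m) * N l p))"
      unfolding sum_distrib_left[symmetric] by (intro sum.cong refl) (simp add: S' del: sum.lessThan_Suc)
    also have "\<dots> = (\<Sum>l<?n. \<Sum>m<?n. \<Sum>p<?n. cnj (W i m) * W j p * (cnj (N l m) * N l p))"
      by (rule sum_rotate[symmetric])
    also have "\<dots> = (\<Sum>l<?n. R l j * cnj (R l i))"
      unfolding R_def by (simp add: sum_product algebra_simps del: sum.lessThan_Suc)
        (subst sum.swap, simp add: algebra_simps del: sum.lessThan_Suc)
    also have "\<dots> = (\<Sum>l<?n. M l j * cnj (M l i))"
      unfolding M_def by (rule orthonormal_family_contract[OF W(1), symmetric])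
    also have "\<dots> = ?r" by (simp add: mult.commute del: sum.lessThan_Suc)
    finally show ?thesis .
  qed
  \<comment> \<open>Normality at index (0, 0): the diagonal entry alone accounts for the norm of
    column 0, so the other entries of row 0 have square sum 0.\<close>
  have row0: "M 0 (Suc k) = 0" if "k < n" for k
  proof -
    have "(\<Sum>k<?n. M 0 k * cnj (M 0 k)) = (\<Sum>k<?n. cnj (M k 0) * M k 0)" by (rule normM) auto
    also have "\<dots> = (\<Sum>k<?n. if k = 0 then \<mu> * cnj \<mu> else 0)"
      by (intro sum.cong refl) (auto simp: col0)
    also have "\<dots> = \<mu> * cnj \<mu>" by (simp add: sum.delta del: sum.lessThan_Suc)
    finally have "(\<Sum>k<n. M 0 (Suc k) * cnj (M 0 (Suc k))) = 0"
      unfolding sum.lessThan_Suc_shift by (simp add: col0)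
    hence "of_real (\<Sum>k<n. (cmod (M 0 (Suc k)))\<^sup>2) = (0::complex)"
      by (simp add: complex_norm_square del: of_real_power)
    hence "(\<Sum>k<n. (cmod (M 0 (Suc k)))\<^sup>2) = 0" unfolding of_real_eq_0_iff .
    thus ?thesis using that by (simp add: sum_nonneg_eq_0_iff)
  qed
  have "normal_kernel n (\<lambda>i j. M (Suc i) (Suc j))"
    unfolding normal_kernel_def
  proof (intro allI impI)
    fix i j assume ij: "i < n" "j < n"
    have "(\<Sum>k<?n. M (Suc i) k * cnj (M (Suc j) k)) = (\<Sum>k<?n. cnj (M k (Suc i)) * M k (Suc j))"
      using ij by (intro normM) auto
    thus "(\<Sum>k<n. M (Suc i) (Suc k) * cnj (M (Suc j) (Suc k))) =
          (\<Sum>k<n. cnj (M (Suc k) (Suc i)) * M (Suc k) (Suc j))"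
      unfolding sum.lessThan_Suc_shift using ij by (simp add: col0 row0)
  qed
  from Suc.IH[OF this] obtain U d where U: "orthonormal_family n U"
    "\<And>i j. i < n \<Longrightarrow> j < n \<Longrightarrow> (\<Sum>k<n. M (Suc j) (Suc k) * U i k) = d i * U i j" by blast
  define U' where "U' i k = (case i of 0 \<Rightarrow> (case k of 0 \<Rightarrow> 1 | Suc _ \<Rightarrow> 0)
     | Suc i' \<Rightarrow> (case k of 0 \<Rightarrow> 0 | Suc k' \<Rightarrow> U i' k'))" for i k :: nat
  define d' where "d' i = (case i of 0 \<Rightarrow> \<mu> | Suc i' \<Rightarrow> d i')" for i
  have U'o: "(\<Sum>k<?n. U' i k * cnj (U' j k)) = (if i = j then 1 else 0)" if "i < ?n" "j < ?n" for i j
    using U(1) that unfolding sum.lessThan_Suc_shift orthonormal_family_def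
    by (auto simp: U'_def split: nat.splits)
  have U'e: "(\<Sum>k<?n. M j k * U' i k) = d' i * U' i j" if "i < ?n" "j < ?n" for i j
    using that unfolding sum.lessThan_Suc_shift
    by (auto simp: U'_def d'_def col0 row0 U split: nat.splits)
  \<comment> \<open>Back to the standard basis: the eigenvectors of the block, preceded by the first
    basis vector, expressed through \<open>W\<close>.\<close>
  define X where "X i k = (\<Sum>l<?n. U' i l * W l k)" for i k
  show ?case
  proof (intro exI conjI allI impI)
    show "orthonormal_family ?n X" unfolding orthonormal_family_def
    proof (intro allI impI)
      fix i j assume ij: "i < ?n" "j < ?n"
      have "(\<Sum>k<?n. X i k * cnj (X j k)) =
         (\<Sum>k<?n. \<Sum>l<?n. \<Sum>m<?n. U' i l * cnj (U' j m) * (W l k * cnj (W m k)))"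
        by (simp add: X_def sum_product algebra_simps del: sum.lessThan_Suc)
      also have "\<dots> = (\<Sum>l<?n. \<Sum>m<?n. U' i l * cnj (U' j m) * (\<Sum>k<?n. W l k * cnj (W m k)))"
        unfolding sum_distrib_left by (rule sum_rotate)
      also have "\<dots> = (\<Sum>l<?n. \<Sum>m<?n. if m = l then U' i l * cnj (U' j l) else 0)"
        by (intro sum.cong refl) (simp add: orth del: sum.lessThan_Suc)
      also have "\<dots> = (if i = j then 1 else 0)"
        using U'o[OF ij] by (simp add: sum.delta del: sum.lessThan_Suc)
      finally show "(\<Sum>k<?n. X i k * cnj (X j k)) = (if i = j then 1 else 0)" .
    qed
    fix i j assume ij: "i < ?n" "j < ?n"
    have "(\<Sum>k<?n. N j k * X i k) = (\<Sum>k<?n. \<Sum>l<?n. U' i l * (N j k * W l k))"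
      by (simp add: X_def sum_distrib_left algebra_simps del: sum.lessThan_Suc)
    also have "\<dots> = (\<Sum>l<?n. U' i l * R j l)"
      unfolding R_def sum_distrib_left by (rule sum.swap)
    also have "\<dots> = (\<Sum>l<?n. \<Sum>k<?n. W k j * (M k l * U' i l))"
      by (intro sum.cong refl) (simp add: WM[OF ij(2), symmetric] sum_distrib_left algebra_simps
          del: sum.lessThan_Suc)
    also have "\<dots> = (\<Sum>k<?n. W k j * (\<Sum>l<?n. M k l * U' i l))"
      unfolding sum_distrib_left by (rule sum.swap)
    also have "\<dots> = (\<Sum>k<?n. W k j * (d' i * U' i k))"
      using ij by (intro sum.cong refl) (simp add: U'e del: sum.lessThan_Suc)
    also have "\<dots> = d' i * X i j"
      unfolding X_def sum_distrib_left by (intro sum.cong refl) simp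
    finally show "(\<Sum>k<?n. N j k * X i k) = d' i * X i j" .
  qed
qed

text \<open>Insert the completeness relation behind \<open>N\<close>. The resulting spectral form is
  linear in \<open>d\<close>, so real and imaginary parts of \<open>d\<close> later give the
  spectral forms of two matrices at once.\<close>

lemma normal_kernel_reconstruct:
  assumes U: "orthonormal_family n U"
    and ev: "\<And>i j. i < n \<Longrightarrow> j < n \<Longrightarrow> (\<Sum>k<n. N j k * U i k) = d i * U i j"
    and jk: "j < n" "k < n"
  shows "N j k = (\<Sum>i<n. d i * (U i j * cnj (U i k)))"
proof -
  have "(\<Sum>i<n. d i * (U i j * cnj (U i k))) = (\<Sum>i<n. (\<Sum>l<n. N j l * U i l) * cnj (U i k))"
    using jk by (intro sum.cong refl) (simp add: ev algebra_simps)
  also have "\<dots> = (\<Sum>l<n. N j l * (\<Sum>i<n. U i l * cnj (U i k)))"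
    unfolding sum_distrib_left sum_distrib_right by (subst sum.swap) (simp add: algebra_simps)
  also have "\<dots> = (\<Sum>l<n. if l = k then N j k else 0)"
    using jk by (intro sum.cong refl) (simp add: orthonormal_family_rows[OF U])
  also have "\<dots> = N j k" using jk by (simp add: sum.delta)
  finally show ?thesis by simp
qed

lemma spectral_form_eigen:
  assumes U: "orthonormal_family n U" and i: "i < n"
  shows "(\<Sum>k<n. (\<Sum>l<n. d l * (U l j * cnj (U l k))) * U i k) = d i * U i j"
proof -
  have "(\<Sum>k<n. (\<Sum>l<n. d l * (U l j * cnj (U l k))) * U i k)
      = (\<Sum>l<n. d l * U l j * (\<Sum>k<n. U i k * cnj (U l k)))"
    unfolding sum_distrib_left sum_distrib_right by (subst sum.swap) (simp add: algebra_simps)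
  also have "\<dots> = (\<Sum>l<n. if l = i then d i * U i j else 0)"
    using U i by (intro sum.cong refl) (auto simp: orthonormal_family_def)
  also have "\<dots> = d i * U i j" using i by (simp add: sum.delta)
  finally show ?thesis .
qed

lemma orthonormal_family_nonzero:
  assumes "orthonormal_family n U" "i < n"
  shows "\<exists>k<n. U i k \<noteq> 0"
proof (rule ccontr)
  assume "\<not> ?thesis"
  hence "(\<Sum>k<n. U i k * cnj (U i k)) = 0" by simp
  thus False using assms by (auto simp: orthonormal_family_def)
qed

text \<open>The flip \<^term>\<open>Y\<close> and a centrosymmetric Hermitian \<^term>\<open>T\<close> commute, so
  \<open>T + \<i> Y\<close> is normal; the real and imaginary parts of its spectrum diagonalise both at once.\<close>

lemma centrosymmetric_diagonalizable:
  fixes T :: "nat \<Rightarrow> nat \<Rightarrow> complex"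
  assumes herm: "\<And>j k. j < n \<Longrightarrow> k < n \<Longrightarrow> cnj (T k j) = T j k"
    and cs: "\<And>j k. j < n \<Longrightarrow> k < n \<Longrightarrow> T (n - 1 - j) (n - 1 - k) = T j k"
  obtains U :: "nat \<Rightarrow> nat \<Rightarrow> complex" and a s :: "nat \<Rightarrow> real" where
    "orthonormal_family n U"
    "\<And>j k. j < n \<Longrightarrow> k < n \<Longrightarrow> T j k = (\<Sum>i<n. of_real (a i) * (U i j * cnj (U i k)))"
    "\<And>j k. j < n \<Longrightarrow> k < n \<Longrightarrow>
       (\<Sum>i<n. of_real (s i) * (U i j * cnj (U i k))) = (if j + k + 1 = n then 1 else 0)"
    "\<And>i k. i < n \<Longrightarrow> k < n \<Longrightarrow> U i (n - 1 - k) = of_real (s i) * U i k"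
    "\<And>i. i < n \<Longrightarrow> s i = 1 \<or> s i = - 1"
proof -
  define Y where "Y j k = (if j + k + 1 = n then 1 else 0 :: complex)" for j k
  define N where "N j k = T j k + \<i> * Y j k" for j k
  have Ycnj: "cnj (Y j k) = Y j k" "Y k j = Y j k" for j k by (auto simp: Y_def)
  have Yeq: "Y j k = (if k = n - 1 - j then 1 else 0)" if "j < n" "k < n" for j k
    using that by (auto simp: Y_def)
  have sumY: "(\<Sum>k<n. Y j k * x k) = x (n - 1 - j)" if "j < n" for j x
  proof -
    have "(\<Sum>k<n. Y j k * x k) = (\<Sum>k<n. if k = n - 1 - j then x (n - 1 - j) else 0)"
      using that by (intro sum.cong refl) (auto simp: Yeq)
    also have "\<dots> = x (n - 1 - j)" using that by (simp add: sum.delta)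
    finally show ?thesis .
  qed
  have "normal_kernel n N" unfolding normal_kernel_def
  proof (intro allI impI)
    fix i j assume ij: "i < n" "j < n"
    \<comment> \<open>This is the commutation of \<open>T\<close> with the flip; it cancels the
      cross terms in both products.\<close>
    have cs': "T i (n - 1 - j) = T (n - 1 - i) j"
      using cs[of i "n - 1 - j"] ij by auto
    have "(\<Sum>k<n. N i k * cnj (N j k)) = (\<Sum>k<n. T i k * cnj (T j k) + Y i k * Y j k
        - \<i> * (Y j k * T i k) + \<i> * (Y i k * cnj (T j k)))"
      by (intro sum.cong refl) (simp add: N_def Ycnj algebra_simps)
    also have "\<dots> = (\<Sum>k<n. T i k * T k j) + (\<Sum>k<n. Y i k * Y j k)
        - \<i> * T i (n - 1 - j) + \<i> * T (n - 1 - i) j"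
      unfolding sum.distrib sum_subtractf sum_distrib_left[symmetric]
      using ij by (simp add: sumY herm)
    finally have 1: "(\<Sum>k<n. N i k * cnj (N j k)) = (\<Sum>k<n. T i k * T k j) + (\<Sum>k<n. Y i k * Y j k)"
      using cs' by simp
    have "(\<Sum>k<n. cnj (N k i) * N k j) = (\<Sum>k<n. cnj (T k i) * T k j + Y i k * Y j k
        - \<i> * (Y i k * T k j) + \<i> * (Y j k * cnj (T k i)))"
      by (intro sum.cong refl) (simp add: N_def Ycnj algebra_simps)
    also have "\<dots> = (\<Sum>k<n. T i k * T k j) + (\<Sum>k<n. Y i k * Y j k)
        - \<i> * T (n - 1 - i) j + \<i> * T i (n - 1 - j)"
      unfolding sum.distrib sum_subtractf sum_distrib_left[symmetric]
      using ij by (simp add: sumY herm)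
    finally show "(\<Sum>k<n. N i k * cnj (N j k)) = (\<Sum>k<n. cnj (N k i) * N k j)"
      using 1 cs' by simp
  qed
  from normal_kernel_diagonalizable[OF this] obtain U d where U: "orthonormal_family n U"
    and ev: "\<And>i j. i < n \<Longrightarrow> j < n \<Longrightarrow> (\<Sum>k<n. N j k * U i k) = d i * U i j" by blast
  have rec: "N j k = (\<Sum>i<n. d i * (U i j * cnj (U i k)))" if "j < n" "k < n" for j k
    using normal_kernel_reconstruct[OF U, of N d] ev that by blast
  \<comment> \<open>The adjoint has the same eigenvectors with conjugate eigenvalues, so sum and
    difference of \<open>N\<close> and its adjoint isolate \<open>T\<close> and
    \<open>Y\<close>.\<close>
  have crec: "cnj (N k j) = (\<Sum>i<n. cnj (d i) * (U i j * cnj (U i k)))" if "j < n" "k < n" for j k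
    using rec[OF that(2,1)] by (simp add: algebra_simps)
  have Trec: "T j k = (\<Sum>i<n. of_real (Re (d i)) * (U i j * cnj (U i k)))" if "j < n" "k < n" for j k
  proof -
    have "2 * T j k = N j k + cnj (N k j)"
      using herm[OF that] by (simp add: N_def Ycnj)
    also have "\<dots> = (\<Sum>i<n. 2 * (of_real (Re (d i)) * (U i j * cnj (U i k))))"
      unfolding rec[OF that] crec[OF that]
      by (simp add: sum.distrib[symmetric] distrib_right[symmetric] complex_add_cnj mult.assoc)
    finally show ?thesis unfolding sum_distrib_left[symmetric] by simp
  qed
  have Yrec: "Y j k = (\<Sum>i<n. of_real (Im (d i)) * (U i j * cnj (U i k)))" if "j < n" "k < n" for j k
  proof -
    have "2 * \<i> * Y j k = N j k - cnj (N k j)"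
      using herm[OF that] by (simp add: N_def Ycnj)
    also have "\<dots> = (\<Sum>i<n. 2 * \<i> * (of_real (Im (d i)) * (U i j * cnj (U i k))))"
      unfolding rec[OF that] crec[OF that]
      by (simp add: sum_subtractf[symmetric] left_diff_distrib[symmetric] complex_diff_cnj algebra_simps)
    finally show ?thesis unfolding sum_distrib_left[symmetric] by simp
  qed
  have flip: "U i (n - 1 - k) = of_real (Im (d i)) * U i k" if "i < n" "k < n" for i k
  proof -
    have "U i (n - 1 - k) = (\<Sum>l<n. Y k l * U i l)" using sumY that by simp
    also have "\<dots> = (\<Sum>l<n. (\<Sum>m<n. of_real (Im (d m)) * (U m k * cnj (U m l))) * U i l)"
      using that by (intro sum.cong refl) (simp add: Yrec)
    also have "\<dots> = of_real (Im (d i)) * U i k" by (rule spectral_form_eigen[OF U that(1)])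
    finally show ?thesis .
  qed
  show thesis
  proof (rule that[OF U Trec])
    show "(\<Sum>i<n. of_real (Im (d i)) * (U i j * cnj (U i k))) = (if j + k + 1 = n then 1 else 0)"
      if "j < n" "k < n" for j k using Yrec[OF that] by (simp add: Y_def)
    \<comment> \<open>The flip is an involution: applying \<open>flip\<close> twice at a nonzero
      coordinate shows that the sign has square 1.\<close>
    show "Im (d i) = 1 \<or> Im (d i) = - 1" if i: "i < n" for i
    proof -
      obtain k where k: "k < n" "U i k \<noteq> 0" using orthonormal_family_nonzero[OF U i] by blast
      have "U i (n - 1 - (n - 1 - k)) = of_real (Im (d i)) * (of_real (Im (d i)) * U i k)"
        using flip[of i "n - 1 - k"] flip[of i k] i k by simp
      hence "U i k * (of_real (Im (d i) * Im (d i)) - 1) = 0" using k by (simp add: algebra_simps)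
      hence "complex_of_real (Im (d i) * Im (d i)) = of_real 1" using k by simp
      hence "Im (d i) * Im (d i) = 1" unfolding of_real_eq_iff .
      thus ?thesis by (simp add: square_eq_1_iff)
    qed
  qed (use flip in auto)
qed

text \<open>The sum of the signs is the trace of the flip, that is the number of its fixed indices:
  one for odd \<open>n\<close>, none for even \<open>n\<close>. Together with the total
  \<open>n\<close> this determines both cardinalities.\<close>

lemma sign_counts:
  assumes U: "orthonormal_family n U"
    and Y: "\<And>j k. j < n \<Longrightarrow> k < n \<Longrightarrow>
       (\<Sum>i<n. of_real (s i) * (U i j * cnj (U i k))) = (if j + k + 1 = n then 1 else 0)"
    and s: "\<And>i. i < n \<Longrightarrow> s i = 1 \<or> s i = (- 1 :: real)"
  shows "card {i. i < n \<and> s i = 1} = (n + 1) div 2" "card {i. i < n \<and> s i = - 1} = n div 2"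
proof -
  let ?A = "{i. i < n \<and> s i = 1}" and ?B = "{i. i < n \<and> s i = - 1}"
  have "(\<Sum>i<n. of_real (s i)) = (\<Sum>i<n. of_real (s i) * (\<Sum>k<n. U i k * cnj (U i k)))"
    using U by (intro sum.cong refl) (simp add: orthonormal_family_def)
  also have "\<dots> = (\<Sum>k<n. \<Sum>i<n. of_real (s i) * (U i k * cnj (U i k)))"
    unfolding sum_distrib_left by (rule sum.swap)
  also have "\<dots> = (\<Sum>k<n. if k + k + 1 = n then 1 else 0)"
    by (intro sum.cong refl) (simp add: Y)
  also have "\<dots> = (\<Sum>k<n. if k = n div 2 then (if odd n then 1 else 0) else 0)"
    by (intro sum.cong refl) (auto elim!: oddE evenE, presburger)
  also have "\<dots> = of_real (if odd n then 1 else 0)"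
    by (cases "n = 0") (auto simp: sum.delta)
  finally have "complex_of_real (\<Sum>i<n. s i) = of_real (if odd n then 1 else 0)" by simp
  hence sum: "(\<Sum>i<n. s i) = (if odd n then 1 else 0)" unfolding of_real_eq_iff .
  have un: "{..<n} = ?A \<union> ?B" and disj: "?A \<inter> ?B = {}" using s by auto
  have "(\<Sum>i<n. s i) = (\<Sum>i\<in>?A. s i) + (\<Sum>i\<in>?B. s i)"
    unfolding un by (rule sum.union_disjoint) (use disj in auto)
  have diff: "real (card ?A) - real (card ?B) = (if odd n then 1 else 0)"
    using \<open>(\<Sum>i<n. s i) = (\<Sum>i\<in>?A. s i) + (\<Sum>i\<in>?B. s i)\<close> sum by simp
  have total: "card ?A + card ?B = n"
    using card_Un_disjoint[OF _ _ disj] un by (metis card_lessThan finite_Un finite_lessThan)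
  have split: "a = (n + 1) div 2 \<and> b = n div 2"
    if "a + b = n" "real a - real b = (if odd n then 1 else 0)" for a b :: nat
  proof -
    have "real a = real (b + (if odd n then 1 else 0))" using that(2) by (auto split: if_splits)
    hence "a = b + (if odd n then 1 else 0)" unfolding of_nat_eq_iff .
    thus ?thesis using that(1) by (cases "odd n") (auto elim!: oddE evenE)
  qed
  show "card ?A = (n + 1) div 2" by (rule conjunct1[OF split[OF total diff]])
  show "card ?B = n div 2" by (rule conjunct2[OF split[OF total diff]])
qed

section \<open>Algebraic multiplicities from a spectral form\<close>

lemma order_prod_list_linear:
  fixes as :: "'a::field list"
  shows "Polynomial.order z (\<Prod>a\<leftarrow>as. [:- a, 1:]) = count_list as z"
proof (induction as)
  case Nil
  show ?case by (simp add: order_0I)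
next
  case (Cons a as)
  have "(\<Prod>a\<leftarrow>(a # as). [:- a, 1:]) \<noteq> 0" unfolding prod_list_zero_iff by auto
  moreover have "Polynomial.order z [:- a, 1:] = (if a = z then 1 else 0)"
    using order_power_n_n[of z 1] by (auto intro!: order_0I)
  ultimately show ?case using Cons
    by (simp add: order_mult del: mult_pCons_left)
qed

text \<open>A spectral form makes \<open>A\<close> similar to a diagonal matrix, so algebraic
  multiplicities are multiplicities among the \<open>c i\<close>. The bijection \<sigma> is left
  free: the same one will order the Toeplitz and the Hankel matrix.\<close>

lemma eigenvalue_ordering_spectral_form:
  assumes U: "orthonormal_family n U" and A: "A \<in> carrier_mat n n"
    and ent: "\<And>j k. j < n \<Longrightarrow> k < n \<Longrightarrow> A $$ (j, k) = (\<Sum>i<n. c i * (U i j * cnj (U i k)))"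
    and bij: "bij_betw \<sigma> {1..n} {..<n}" and l: "\<And>i. i \<in> {1..n} \<Longrightarrow> l i = c (\<sigma> i)"
  shows "eigenvalue_ordering A l"
proof -
  define P where "P = Matrix.mat n n (\<lambda>(k, i). U i k)"
  define Q where "Q = Matrix.mat n n (\<lambda>(i, k). cnj (U i k))"
  define D where "D = Matrix.mat n n (\<lambda>(i, j). if i = j then c i else 0)"
  have carr: "P \<in> carrier_mat n n" "Q \<in> carrier_mat n n" "D \<in> carrier_mat n n"
    by (auto simp: P_def Q_def D_def)
  have PQ: "P * Q = 1\<^sub>m n"
    using orthonormal_family_rows[OF U]
    by (intro eq_matI) (auto simp: P_def Q_def scalar_prod_def lessThan_atLeast0)
  have PD: "(P * D) $$ (k, i) = c i * U i k" if "k < n" "i < n" for k i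
  proof -
    have "(\<Sum>j = 0..<n. U j k * (if j = i then c j else 0))
        = (\<Sum>j = 0..<n. if j = i then c i * U i k else 0)"
      by (rule sum.cong) auto
    thus ?thesis
      using that by (simp add: P_def D_def scalar_prod_def)
  qed
  have "(P * D * Q) $$ (j, k) = A $$ (j, k)" if "j < n" "k < n" for j k
  proof -
    have "(R * Q) $$ (j, k) = (\<Sum>i<n. R $$ (j, i) * Q $$ (i, k))"
      if "R \<in> carrier_mat n n" for R
      using that carr \<open>j < n\<close> \<open>k < n\<close> by (simp add: scalar_prod_def lessThan_atLeast0)
    from this[of "P * D"] carr
    have "(P * D * Q) $$ (j, k) = (\<Sum>i<n. (P * D) $$ (j, i) * Q $$ (i, k))" by simp
    also have "\<dots> = (\<Sum>i<n. c i * (U i j * cnj (U i k)))"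
      using that by (intro sum.cong refl) (simp add: PD Q_def)
    finally show ?thesis using ent that by simp
  qed
  hence APDQ: "A = P * D * Q" using carr A by (intro eq_matI) auto
  have "similar_mat A D"
    by (rule similar_matI[of _ _ P Q n])
      (use carr A PQ APDQ mat_mult_left_right_inverse[OF carr(1,2) PQ] in auto)
  hence "char_poly A = char_poly D" by (rule char_poly_similar)
  also have "\<dots> = (\<Prod>a\<leftarrow>diag_mat D. [:- a, 1:])"
    by (rule char_poly_upper_triangular[OF carr(3)]) (auto simp: D_def upper_triangular_def)
  also have "diag_mat D = map c [0..<n]"
    by (auto simp: diag_mat_def D_def)
  finally have cp: "char_poly A = (\<Prod>a\<leftarrow>map c [0..<n]. [:- a, 1:])" .
  have "count_list (map c [0..<n]) z = card {i. i < n \<and> c i = z}" for z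
  proof -
    have "count_list (map c [0..<n]) z = length (filter (\<lambda>i. z = c i) [0..<n])"
      by (simp add: count_list_eq_length_filter filter_map o_def)
    also have "\<dots> = card (set (filter (\<lambda>i. z = c i) [0..<n]))"
      by (simp only: distinct_card distinct_filter distinct_upt)
    also have "set (filter (\<lambda>i. z = c i) [0..<n]) = {i. i < n \<and> c i = z}" by auto
    finally show ?thesis .
  qed
  hence "Polynomial.order z (char_poly A) = card {i. i < n \<and> c i = z}" for z
    unfolding cp order_prod_list_linear .
  moreover have "card {i \<in> {1..n}. l i = z} = card {i. i < n \<and> c i = z}" for z
  proof (rule bij_betw_same_card)
    have "bij_betw \<sigma> {i \<in> {1..n}. l i = z} {i \<in> {..<n}. c i = z}"
      by (rule bij_betw_Collect[OF bij]) (simp add: l)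
    thus "bij_betw \<sigma> {i \<in> {1..n}. l i = z} {i. i < n \<and> c i = z}" by simp
  qed
  ultimately show ?thesis using A unfolding eigenvalue_ordering_def by auto
qed

section \<open>Piecewise monotone symbols\<close>

text \<open>Retagging: in a fine partition, moving the tag of one cell \<open>K\<close> from
  \<open>t\<close> to any \<open>x\<close> in \<open>K\<close> changes the Riemann sum by the
  content times \<open>f x - f t\<close>, while both sums stay within 1 of the integral. So
  \<open>f\<close> is bounded on each of finitely many cells.\<close>

lemma riemann_integrable_bounded:
  assumes "riemann_integrable_on f a b"
  shows "bounded (f ` {a..b})"
proof -
  define s where "s p = (\<Sum>(x, K)\<in>p. Henstock_Kurzweil_Integration.content K * f x)"
    for p :: "(real \<times> real set) set"
  have "\<exists>I. \<forall>e>0. \<exists>d>0. \<forall>p.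
      p tagged_division_of {a..b} \<and> (\<lambda>x. ball x d) fine p \<longrightarrow> \<bar>s p - I\<bar> < e"
    using assms by (simp only: riemann_integrable_on_def s_def)
  then obtain I where "\<forall>e>0. \<exists>d>0. \<forall>p.
      p tagged_division_of {a..b} \<and> (\<lambda>x. ball x d) fine p \<longrightarrow> \<bar>s p - I\<bar> < e" ..
  from this[rule_format, of 1] obtain d where d: "d > 0"
    and near: "\<And>p. p tagged_division_of {a..b} \<Longrightarrow> (\<lambda>x. ball x d) fine p \<Longrightarrow> \<bar>s p - I\<bar> < 1"
    by auto
  \<comment> \<open>Half the radius leaves room for retagging: any two points of a cell are then
    less than \<open>d\<close> apart.\<close>
  have "gauge (\<lambda>x::real. ball x (d/2))" using d by (intro gauge_ball) simp
  from fine_division_exists_real[OF this, of a b] obtain p where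
    p: "p tagged_division_of {a..b}" and fine: "(\<lambda>x. ball x (d/2)) fine p" by blast
  note pD = tagged_division_ofD[OF p]
  have cell: "K \<subseteq> ball t (d/2)" if "(t, K) \<in> p" for t K using fine that by (auto simp: fine_def)
  have "(\<lambda>x. ball x d) fine p" using fine d unfolding fine_def by force
  with p have sp: "\<bar>s p - I\<bar> < 1" by (rule near)
  have "bounded (f ` K)" if tK: "(t, K) \<in> p" for t K
  proof (cases "Henstock_Kurzweil_Integration.content K = 0")
    case True
    \<comment> \<open>A cell without content is at most a single point, where the retagging estimate
      says nothing.\<close>
    obtain u v where K: "K = cbox u v" using pD(4)[OF tK] by blast
    have "K \<subseteq> {u}" using True unfolding K by auto
    hence "finite (f ` K)" by (meson finite.emptyI finite.insertI finite_imageI finite_subset)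
    thus ?thesis by (rule finite_imp_bounded)
  next
    case False
    let ?c = "Henstock_Kurzweil_Integration.content K"
    have c: "?c > 0" using False by (simp add: less_le content_pos_le)
    have "\<bar>f x\<bar> \<le> \<bar>f t\<bar> + 2 / ?c" if x: "x \<in> K" for x
    proof -
      let ?r = "p - {(t, K)}"
      let ?q = "insert (x, K) ?r"
      have notin: "(x, K) \<notin> ?r"
      proof
        assume *: "(x, K) \<in> ?r"
        hence "interior K \<inter> interior K = {}" using tK by (intro pD(5)[of x K t K]) auto
        moreover obtain u v where "K = cbox u v" using pD(4)[OF tK] by blast
        ultimately show False using False by (metis Int_absorb content_eq_0_interior)
      qed
      have "?q tagged_division_of {a..b}"
      proof (rule tagged_division_ofI)
        show "finite ?q" using pD(1) by simp
        show "z \<in> L" if "(z, L) \<in> ?q" for z L using that pD(2) x by blast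
        show "L \<subseteq> {a..b}" if "(z, L) \<in> ?q" for z L using that pD(3) tK by blast
        show "\<exists>u v. L = cbox u v" if "(z, L) \<in> ?q" for z L using that pD(4) tK by blast
        show "interior L \<inter> interior L' = {}"
          if "(z, L) \<in> ?q" "(z', L') \<in> ?q" "(z, L) \<noteq> (z', L')" for z L z' L'
        proof -
          \<comment> \<open>\<open>w\<close> restores the old tag of the retagged cell, so that
            disjointness is inherited from \<open>p\<close>.\<close>
          define w where "w L z = (if (z, L) = (x, K) then t else z)" for L z
          have old: "(w L z, L) \<in> p" "(w L' z', L') \<in> p"
            using that(1,2) tK by (auto simp: w_def)
          have "(w L z, L) \<noteq> (w L' z', L')"
            using that by (auto simp: w_def split: if_splits)
          thus ?thesis by (rule pD(5)[OF old])
        qed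
        have "{L. \<exists>z. (z, L) \<in> ?q} = {L. \<exists>z. (z, L) \<in> p}" using tK by blast
        thus "\<Union>{L. \<exists>z. (z, L) \<in> ?q} = {a..b}" using pD(6) by simp
      qed
      moreover have "(\<lambda>x. ball x d) fine ?q"
      proof -
        have "K \<subseteq> ball x d"
        proof
          fix y assume "y \<in> K"
          hence "y \<in> ball t (d/2)" "x \<in> ball t (d/2)" using cell[OF tK] x by auto
          thus "y \<in> ball x d"
            using dist_triangle_half_r[of t x d y] by simp
        qed
        thus ?thesis using \<open>(\<lambda>x. ball x d) fine p\<close> unfolding fine_def by auto
      qed
      ultimately have sq: "\<bar>s ?q - I\<bar> < 1" by (rule near)
      have "s ?q = ?c * f x + s ?r" using notin pD(1) unfolding s_def by simp
      moreover have "s p = ?c * f t + s ?r"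
        using pD(1) tK unfolding s_def by (simp add: sum.remove)
      ultimately have "s ?q - s p = ?c * (f x - f t)" by (simp add: algebra_simps)
      hence "?c * \<bar>f x - f t\<bar> = \<bar>s ?q - s p\<bar>" using c by (simp add: abs_mult)
      also have "\<dots> \<le> 2" using sp sq by linarith
      finally have "\<bar>f x - f t\<bar> \<le> 2 / ?c" using c by (simp add: field_simps)
      thus ?thesis by linarith
    qed
    thus ?thesis by (intro boundedI) auto
  qed
  hence "bounded (\<Union>z\<in>p. f ` snd z)" using pD(1) by (intro bounded_UN) auto
  moreover have "f ` {a..b} \<subseteq> (\<Union>z\<in>p. f ` snd z)"
  proof
    fix y assume "y \<in> f ` {a..b}"
    then obtain x where "y = f x" "x \<in> \<Union>{L. \<exists>z. (z, L) \<in> p}" unfolding pD(6) by blast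
    thus "y \<in> (\<Union>z\<in>p. f ` snd z)" by force
  qed
  ultimately show ?thesis by (rule bounded_subset)
qed

text \<open>Between two level points that enclose no point of \<open>Z\<close>, \<open>f\<close> is
  continuous and attains its extrema; interior ones would belong to \<open>Z\<close>, so both lie at
  the ends and equal \<open>t\<close>. Then \<open>f\<close> is constant there, and every interior
  point is a local maximum, hence in \<open>Z\<close> after all.\<close>

lemma finite_level_set:
  fixes f :: "real \<Rightarrow> real"
  assumes "finite (local_max_points f {a..b})" "finite (local_min_points f {a..b})"
    "finite (discontinuity_points f {a..b})"
  shows "finite {x \<in> {a..b}. f x = t}"
proof (rule ccontr)
  define Z where "Z = local_max_points f {a..b} \<union> local_min_points f {a..b} \<union> discontinuity_points f {a..b}"
  have Z: "finite Z" using assms by (simp add: Z_def)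
  define L where "L = {x \<in> {a..b}. f x = t} - Z"
  assume "infinite {x \<in> {a..b}. f x = t}"
  hence L: "infinite L" unfolding L_def using Z by simp
  \<comment> \<open>Points with the same set of \<open>Z\<close>-points to their left have none
    between them, and there are finitely many such sets.\<close>
  have "finite ((\<lambda>x. {z \<in> Z. z \<le> x}) ` L)"
    by (rule finite_subset[of _ "Pow Z"]) (use Z in auto)
  from pigeonhole_infinite[OF L this] obtain x0 where
    inf: "infinite {x \<in> L. {z \<in> Z. z \<le> x} = {z \<in> Z. z \<le> x0}}" (is "infinite ?Q") by blast
  obtain u where u: "u \<in> ?Q" using infinite_imp_nonempty[OF inf] by blast
  have "infinite (?Q - {u})" using inf by simp
  then obtain v where v: "v \<in> ?Q - {u}" using infinite_imp_nonempty by blast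
  define x y where "x = min u v" and "y = max u v"
  have uv: "u \<in> L" "v \<in> L" "u \<noteq> v" using u v by blast+
  have "{z \<in> Z. z \<le> u} = {z \<in> Z. z \<le> x0}" "{z \<in> Z. z \<le> v} = {z \<in> Z. z \<le> x0}"
    using u v by blast+
  hence "{z \<in> Z. z \<le> u} = {z \<in> Z. z \<le> v}" by (rule trans[OF _ sym])
  hence same: "{z \<in> Z. z \<le> x} = {z \<in> Z. z \<le> y}"
    unfolding x_def y_def min_def max_def by (cases "u \<le> v") (simp_all only: if_True if_False)
  have xy: "x \<in> L" "y \<in> L" "x < y" using uv by (auto simp: x_def y_def min_def max_def)
  have noZ: "z \<notin> Z" if "x \<le> z" "z \<le> y" for z
  proof
    assume "z \<in> Z"
    hence "z \<in> {z \<in> Z. z \<le> x}" using that unfolding same by simp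
    hence "z = x" using that by simp
    thus False using \<open>z \<in> Z\<close> xy(1) by (simp add: L_def)
  qed
  have sub: "{x..y} \<subseteq> {a..b}" using xy by (auto simp: L_def)
  have cont: "continuous_on {x..y} f" unfolding continuous_on_eq_continuous_within
  proof
    fix z assume "z \<in> {x..y}"
    hence "continuous (at z within {a..b}) f" using noZ[of z] sub
      by (auto simp: Z_def discontinuity_points_def)
    thus "continuous (at z within {x..y}) f" using sub continuous_within_subset by blast
  qed
  \<comment> \<open>At interior points, extremality over \<open>{x..y}\<close> becomes local
    extremality relative to \<open>{a..b}\<close>.\<close>
  have ev: "eventually (\<lambda>w. w \<in> {x..y}) (at z within {a..b})" if "x < z" "z < y" for z
    using eventually_at_in_open'[of "{x<..<y}" z] that
    by (auto simp: eventually_at_filter elim!: eventually_mono intro: order_tendstoD)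
  obtain M where M: "M \<in> {x..y}" "\<And>w. w \<in> {x..y} \<Longrightarrow> f w \<le> f M"
    using continuous_attains_sup[OF _ _ cont] xy by auto
  obtain m where m: "m \<in> {x..y}" "\<And>w. w \<in> {x..y} \<Longrightarrow> f m \<le> f w"
    using continuous_attains_inf[OF _ _ cont] xy by auto
  have maxZ: "z \<in> Z" if "x < z" "z < y" "\<And>w. w \<in> {x..y} \<Longrightarrow> f w \<le> f z" for z
    using that sub eventually_mono[OF ev[OF that(1,2)], of "\<lambda>w. f w \<le> f z"]
    by (auto simp: Z_def local_max_points_def)
  have minZ: "z \<in> Z" if "x < z" "z < y" "\<And>w. w \<in> {x..y} \<Longrightarrow> f z \<le> f w" for z
    using that sub eventually_mono[OF ev[OF that(1,2)], of "\<lambda>w. f z \<le> f w"]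
    by (auto simp: Z_def local_min_points_def)
  have "M = x \<or> M = y" using maxZ[of M] noZ[of M] M by fastforce
  hence fM: "f M = t" using xy by (auto simp: L_def)
  have "m = x \<or> m = y" using minZ[of m] noZ[of m] m by fastforce
  hence fm: "f m = t" using xy by (auto simp: L_def)
  have "f w = t" if "w \<in> {x..y}" for w using M(2)[OF that] m(2)[OF that] fM fm by simp
  moreover obtain z where z: "x < z" "z < y" using xy(3) dense by blast
  ultimately have "z \<in> Z" by (intro maxZ) auto
  thus False using noZ[of z] z by simp
qed

text \<open>A proper interval lies between an open and a closed interval that differ in at most two
  endpoints.\<close>

lemma finite_frontier_connected:
  fixes S :: "real set"
  assumes "connected S"
  shows "finite (frontier S)"
proof -
  have sandwich: "finite (frontier S)" if "open U" "U \<subseteq> S" "S \<subseteq> C" "closed C" "C - U \<subseteq> {a, b}" for U C a b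
  proof (rule finite_subset)
    show "frontier S \<subseteq> {a, b}"
      using that closure_minimal[of S C] interior_maximal[of U S] unfolding frontier_def by blast
  qed simp
  have "is_interval S" using assms by (simp add: is_interval_connected_1)
  from is_real_interval[OF this] obtain a b where
    "S = {} \<or> S = UNIV \<or> S = {..<b} \<or> S = {..b} \<or> S = {a<..} \<or> S = {a..} \<or>
     S = {a<..<b} \<or> S = {a<..b} \<or> S = {a..<b} \<or> S = {a..b}" by blast
  thus ?thesis
    by (elim disjE)
      (simp, simp, (rule sandwich[of "{..<b}" "{..b}" b b]; force)+,
       (rule sandwich[of "{a<..}" "{a..}" a a]; force)+,
       (rule sandwich[of "{a<..<b}" "{a..b}" a b]; force)+)
qed

text \<open>Cutting \<open>A\<close> at one discontinuity leaves two intervals with fewer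
  discontinuities and at most one point, and the frontier of a union lies in the union of the
  frontiers. Finite frontiers later allow the eigenvalues in such sets to be counted
  asymptotically.\<close>

lemma finite_frontier_image:
  fixes f :: "real \<Rightarrow> real"
  assumes "finite D" "connected A" "continuous_on (A - D) f"
  shows "finite (frontier (f ` A))"
  using assms
proof (induction D arbitrary: A rule: finite_induct)
  case empty
  thus ?case by (intro finite_frontier_connected connected_continuous_image) auto
next
  case (insert d D)
  have int: "is_interval A" using insert.prems(1) by (simp add: is_interval_connected_1)
  have part: "finite (frontier (f ` (A \<inter> B)))" if "is_interval B" "d \<notin> B" for B
  proof (rule insert.IH)
    show "connected (A \<inter> B)" using int that by (simp add: is_interval_Int is_interval_connected_1[symmetric])
    show "continuous_on (A \<inter> B - D) f"
      using that by (intro continuous_on_subset[OF insert.prems(2)]) auto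
  qed
  have "A = (A \<inter> {..<d}) \<union> (A \<inter> {d<..}) \<union> (A \<inter> {d})" by force
  hence img: "f ` A = f ` (A \<inter> {..<d}) \<union> f ` (A \<inter> {d<..}) \<union> f ` (A \<inter> {d})" by (metis image_Un)
  have "finite (f ` (A \<inter> {d}))" by simp
  hence "finite (frontier (f ` (A \<inter> {d})))"
    by (meson finite_imp_closed frontier_subset_closed finite_subset)
  moreover have "finite (frontier (f ` (A \<inter> {..<d})))" "finite (frontier (f ` (A \<inter> {d<..})))"
    by (auto intro!: part simp: is_interval_connected_1)
  ultimately have "finite (frontier (f ` (A \<inter> {..<d})) \<union> frontier (f ` (A \<inter> {d<..})) \<union> frontier (f ` (A \<inter> {d})))"
    by simp
  moreover have "frontier (f ` A) \<subseteq> frontier (f ` (A \<inter> {..<d})) \<union> frontier (f ` (A \<inter> {d<..})) \<union> frontier (f ` (A \<inter> {d}))"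
    unfolding img by (meson frontier_Un_subset Un_mono order_refl order_trans)
  ultimately show ?case by (rule rev_finite_subset)
qed

section \<open>Trigonometric sums on the circle\<close>

text \<open>Total mass \<open>2 * pi\<close>, not normalised: the origin of the factors
  \<open>2 * pi\<close> below. The Borel sets suffice since the symbol is continuous off a finite
  set.\<close>

definition circle :: "real measure" where
  "circle = restrict_space lborel {-pi..pi}"

lemma space_circle [simp]: "space circle = {-pi..pi}"
  by (simp add: circle_def space_restrict_space)

lemma finite_measure_circle: "finite_measure circle"
  by (rule finite_measureI) (simp add: circle_def emeasure_restrict_space space_restrict_space)

interpretation circle: finite_measure circle
  by (rule finite_measure_circle)

lemma measure_circle:
  assumes "A \<in> sets borel" "A \<subseteq> {-pi..pi}"
  shows "measure circle A = measure lborel A"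
  unfolding circle_def using assms by (intro measure_restrict_space) auto

lemma sets_circle_borel: "A \<in> sets borel \<Longrightarrow> A \<inter> {-pi..pi} \<in> sets circle"
  by (auto simp: circle_def sets_restrict_space)

lemma measurable_circle_borel [measurable (raw)]:
  "h \<in> borel_measurable borel \<Longrightarrow> h \<in> borel_measurable circle"
  unfolding circle_def by (intro measurable_restrict_space1) simp

lemma null_sets_circle_finite:
  assumes "finite A" shows "A \<inter> {-pi..pi} \<in> null_sets circle"
proof -
  have "A \<inter> {-pi..pi} \<in> null_sets lborel"
    using assms by (intro countable_imp_null_set_lborel) (auto intro: countable_finite)
  thus ?thesis unfolding circle_def by (subst null_sets_restrict_space) auto
qed

lemma integrable_circle_bounded:
  fixes h :: "real \<Rightarrow> 'b::{banach, second_countable_topology}"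
  assumes "h \<in> borel_measurable circle" "bounded (h ` {-pi..pi})"
  shows "integrable circle h"
proof -
  from assms(2) obtain B where "\<forall>x\<in>{-pi..pi}. norm (h x) \<le> B" by (auto simp: bounded_iff)
  thus ?thesis using assms(1)
    by (intro circle.integrable_const_bound[of _ B]) (auto intro!: AE_I2)
qed

lemma integrable_circle_continuous:
  fixes h :: "real \<Rightarrow> 'b::{banach, second_countable_topology}"
  assumes "continuous_on UNIV h"
  shows "integrable circle h"
proof (rule integrable_circle_bounded)
  show "h \<in> borel_measurable circle"
    by (intro measurable_circle_borel borel_measurable_continuous_onI assms)
  show "bounded (h ` {-pi..pi})"
    by (intro compact_imp_bounded compact_continuous_image continuous_on_subset[OF assms]) auto
qed

lemma integral_cis:
  "(\<integral>\<theta>. cis (of_int k * \<theta>) \<partial>circle) = (if k = 0 then 2 * of_real pi else 0)"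
proof (cases "k = 0")
  case True
  have "measure circle {-pi..pi} = 2 * pi" by (subst measure_circle) auto
  thus ?thesis using True by (simp add: scaleR_conv_of_real)
next
  case False
  define F where "F \<theta> = cis (of_int k * \<theta>) / (\<i> * of_int k)" for \<theta>
  have "(\<integral>\<theta>. cis (of_int k * \<theta>) \<partial>circle) = (\<integral>\<theta>. indicator {-pi..pi} \<theta> *\<^sub>R cis (of_int k * \<theta>) \<partial>lborel)"
    unfolding circle_def by (subst integral_restrict_space) auto
  also have "\<dots> = F pi - F (-pi)"
  proof (rule integral_FTC_Icc)
    fix x :: real
    show "(F has_vector_derivative cis (of_int k * x)) (at x within {-pi..pi})"
      unfolding F_def cis_conv_exp using False
      by (auto intro!: derivative_eq_intros has_vector_derivative_real_field simp: field_simps)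
  qed (auto intro!: continuous_intros)
  also have "\<dots> = 0"
  proof -
    have "cis (of_int k * pi) = cis (of_int k * (-pi) + of_int k * (2 * pi))" by (simp add: algebra_simps)
    also have "\<dots> = cis (of_int k * (-pi)) * cis (2 * pi * of_int k)"
      unfolding cis_mult[symmetric] by (simp add: mult_ac)
    also have "cis (2 * pi * of_int k) = 1" by simp
    finally show ?thesis by (simp add: F_def)
  qed
  finally show ?thesis using False by simp
qed

definition trig_sum :: "nat \<Rightarrow> (nat \<Rightarrow> complex) \<Rightarrow> real \<Rightarrow> complex" where
  "trig_sum n v \<theta> = (\<Sum>k<n. v k * cis (real k * \<theta>))"

lemma continuous_trig_sum [continuous_intros]: "continuous_on A (trig_sum n v)"
  unfolding trig_sum_def by (intro continuous_intros)

lemma bounded_trig_sum: "bounded (trig_sum n v ` A)"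
proof (rule boundedI)
  fix z assume "z \<in> trig_sum n v ` A"
  then obtain \<theta> where "z = trig_sum n v \<theta>" by blast
  thus "norm z \<le> (\<Sum>k<n. norm (v k))"
    unfolding trig_sum_def by (auto intro!: sum_norm_le simp: norm_mult)
qed

lemma integral_trig_sum_cis:
  assumes "j < n"
  shows "(\<integral>\<theta>. trig_sum n v \<theta> * cis (- (real j * \<theta>)) \<partial>circle) = 2 * of_real pi * v j"
proof -
  have "(\<integral>\<theta>. trig_sum n v \<theta> * cis (- (real j * \<theta>)) \<partial>circle)
      = (\<integral>\<theta>. (\<Sum>k<n. v k * cis (of_int (int k - int j) * \<theta>)) \<partial>circle)"
    unfolding trig_sum_def sum_distrib_right
    by (intro Bochner_Integration.integral_cong refl sum.cong) (simp add: cis_mult algebra_simps)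
  also have "\<dots> = (\<Sum>k<n. v k * (\<integral>\<theta>. cis (of_int (int k - int j) * \<theta>) \<partial>circle))"
    by (subst Bochner_Integration.integral_sum)
      (auto intro!: integrable_circle_continuous continuous_intros)
  also have "\<dots> = (\<Sum>k<n. if k = j then 2 * of_real pi * v j else 0)"
    by (intro sum.cong refl) (simp only: integral_cis, simp)
  also have "\<dots> = 2 * of_real pi * v j" using assms by (simp add: sum.delta)
  finally show ?thesis .
qed

lemma integral_mult_cnj_trig_sum:
  assumes [measurable]: "h \<in> borel_measurable circle" and b: "bounded (h ` {-pi..pi})"
  shows "(\<integral>\<theta>. h \<theta> * cnj (trig_sum n w \<theta>) \<partial>circle)
       = (\<Sum>j<n. cnj (w j) * (\<integral>\<theta>. h \<theta> * cis (- (real j * \<theta>)) \<partial>circle))"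
proof -
  have int: "integrable circle (\<lambda>\<theta>. h \<theta> * cis (- (real j * \<theta>)))" for j
  proof (rule integrable_circle_bounded)
    show "(\<lambda>\<theta>. h \<theta> * cis (- (real j * \<theta>))) \<in> borel_measurable circle"
      by (intro borel_measurable_times assms measurable_circle_borel borel_measurable_continuous_onI)
        (auto intro!: continuous_intros)
    show "bounded ((\<lambda>\<theta>. h \<theta> * cis (- (real j * \<theta>))) ` {-pi..pi})"
      using b by (auto simp: bounded_iff norm_mult)
  qed
  have "(\<integral>\<theta>. h \<theta> * cnj (trig_sum n w \<theta>) \<partial>circle)
      = (\<integral>\<theta>. (\<Sum>j<n. cnj (w j) * (h \<theta> * cis (- (real j * \<theta>)))) \<partial>circle)"
    by (intro Bochner_Integration.integral_cong refl)
      (simp add: trig_sum_def sum_distrib_left cis_cnj algebra_simps)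
  also have "\<dots> = (\<Sum>j<n. cnj (w j) * (\<integral>\<theta>. h \<theta> * cis (- (real j * \<theta>)) \<partial>circle))"
    by (subst Bochner_Integration.integral_sum) (auto intro!: int)
  finally show ?thesis .
qed

lemma integral_trig_sum_norm:
  "(\<integral>\<theta>. (cmod (trig_sum n v \<theta>))\<^sup>2 \<partial>circle) = 2 * pi * (\<Sum>k<n. (cmod (v k))\<^sup>2)"
proof -
  have "complex_of_real (\<integral>\<theta>. (cmod (trig_sum n v \<theta>))\<^sup>2 \<partial>circle)
      = (\<integral>\<theta>. trig_sum n v \<theta> * cnj (trig_sum n v \<theta>) \<partial>circle)"
    unfolding integral_complex_of_real[symmetric]
    by (intro Bochner_Integration.integral_cong refl complex_norm_square)
  also have "\<dots> = (\<Sum>j<n. cnj (v j) * (2 * of_real pi * v j))"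
    by (subst integral_mult_cnj_trig_sum)
      (auto intro!: bounded_trig_sum measurable_circle_borel borel_measurable_continuous_onI
        continuous_intros sum.cong simp: integral_trig_sum_cis)
  also have "\<dots> = complex_of_real (2 * pi * (\<Sum>k<n. (cmod (v k))\<^sup>2))"
    by (simp add: sum_distrib_left complex_norm_square mult_ac del: of_real_power)
  finally show ?thesis unfolding of_real_eq_iff .
qed

text \<open>For fixed \<theta> the values are, up to conjugation, the coordinates of one vector with
  entries of modulus \<open>cmod (c k)\<close>, so Parseval applies pointwise. The weights may
  therefore depend on \<theta>; \<open>c = 1\<close> gives the constant \<open>n\<close>.\<close>

lemma trig_sum_family_norm:
  assumes "orthonormal_family n U"
  shows "(\<Sum>i<n. (cmod (trig_sum n (\<lambda>k. U i k * c k) \<theta>))\<^sup>2) = (\<Sum>k<n. (cmod (c k))\<^sup>2)"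
proof -
  have eq: "trig_sum n (\<lambda>k. U i k * c k) \<theta> = cnj (\<Sum>k<n. cnj (U i k) * cnj (c k * cis (real k * \<theta>)))" for i
    by (simp add: trig_sum_def mult_ac)
  have "complex_of_real (\<Sum>i<n. (cmod (trig_sum n (\<lambda>k. U i k * c k) \<theta>))\<^sup>2)
      = (\<Sum>i<n. (\<Sum>k<n. cnj (U i k) * cnj (c k * cis (real k * \<theta>))) *
           cnj (\<Sum>k<n. cnj (U i k) * cnj (c k * cis (real k * \<theta>))))"
    unfolding of_real_sum eq complex_mod_cnj by (intro sum.cong refl complex_norm_square)
  also have "\<dots> = (\<Sum>k<n. cnj (c k * cis (real k * \<theta>)) * cnj (cnj (c k * cis (real k * \<theta>))))"
    by (rule orthonormal_family_contract[OF assms])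
  also have "\<dots> = of_real (\<Sum>k<n. (cmod (c k))\<^sup>2)"
    unfolding of_real_sum by (intro sum.cong refl)
      (simp only: complex_norm_square[symmetric] complex_mod_cnj norm_mult norm_cis mult_1_right)
  finally show ?thesis unfolding of_real_eq_iff .
qed

section \<open>Eigenvectors as trigonometric sums\<close>

lemma bounded_imageE:
  fixes h :: "'a \<Rightarrow> 'b::real_normed_vector"
  assumes "bounded (h ` S)"
  obtains B where "\<And>x. x \<in> S \<Longrightarrow> norm (h x) \<le> B"
proof -
  from assms obtain B where "\<forall>x\<in>S. norm (h x) \<le> B" by (auto simp: bounded_iff)
  thus thesis by (intro that) blast
qed

locale even_symbol =
  fixes f :: "real \<Rightarrow> real"
  assumes even: "\<And>x. x \<in> {-pi..pi} \<Longrightarrow> f (- x) = f x"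
    and bounded: "bounded (f ` {-pi..pi})"
    and discontinuities: "finite (discontinuity_points f {-pi..pi})"
begin

lemma measurable_symbol [measurable]: "f \<in> borel_measurable circle"
proof -
  define D where "D = discontinuity_points f {-pi..pi}"
  have "continuous_on ({-pi..pi} - D) f" unfolding continuous_on_eq_continuous_within
  proof
    fix x assume "x \<in> {-pi..pi} - D"
    hence "continuous (at x within {-pi..pi}) f" by (auto simp: D_def discontinuity_points_def)
    thus "continuous (at x within {-pi..pi} - D) f" by (rule continuous_within_subset) auto
  qed
  hence m: "f \<in> borel_measurable (restrict_space borel ({-pi..pi} - D))"
    by (rule borel_measurable_continuous_on_restrict)
  show ?thesis
  proof (rule measurable_restrict_countable[of D])
    show "countable D" using discontinuities by (simp add: D_def countable_finite)
    show "f x \<in> space borel" for x by simp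
    have "D \<subseteq> {-pi..pi}" by (auto simp: D_def discontinuity_points_def)
    hence "{x} = {x} \<inter> {-pi..pi}" if "x \<in> D" for x using that by auto
    thus "{x} \<in> sets circle" if "x \<in> D" for x
      using that sets_circle_borel[of "{x}"] by (metis borel_singleton sets.empty_sets)
    have "sets (restrict_space circle (- D)) = sets (restrict_space borel ({-pi..pi} - D))"
      unfolding circle_def
      by (subst sets_restrict_restrict_space)
        (auto simp: Diff_eq intro!: sets_restrict_space_cong)
    with m show "f \<in> borel_measurable (restrict_space circle (- D))"
      by (simp cong: measurable_cong_sets)
  qed
qed

definition coeff :: "int \<Rightarrow> complex" where
  "coeff k = fourier_coeff (\<lambda>x. complex_of_real (f x)) k"

lemma coeff_circle:
  "2 * of_real pi * coeff k = (\<integral>\<theta>. complex_of_real (f \<theta>) * cis (- (of_int k * \<theta>)) \<partial>circle)"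
proof -
  let ?F = "\<lambda>\<theta>. complex_of_real (f \<theta>) * cis (- (of_int k * \<theta>))"
  have [measurable]: "(\<lambda>\<theta>. cis (- (of_int k * \<theta>))) \<in> borel_measurable circle"
    by (intro measurable_circle_borel borel_measurable_continuous_onI continuous_intros)
  have "?F \<in> borel_measurable circle" by measurable
  hence m: "(\<lambda>\<theta>. indicator {-pi..pi} \<theta> *\<^sub>R ?F \<theta>) \<in> borel_measurable lborel"
    unfolding circle_def by (subst (asm) borel_measurable_restrict_space_iff) auto
  have "2 * of_real pi * coeff k = (\<integral>\<theta>. indicator {-pi..pi} \<theta> *\<^sub>R ?F \<theta> \<partial>lebesgue)"
    by (simp add: coeff_def fourier_coeff_def set_lebesgue_integral_def cis_conv_exp mult_ac)
  also have "\<dots> = (\<integral>\<theta>. indicator {-pi..pi} \<theta> *\<^sub>R ?F \<theta> \<partial>lborel)"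
    using m by (rule integral_completion)
  also have "\<dots> = (\<integral>\<theta>. ?F \<theta> \<partial>circle)"
    unfolding circle_def by (subst integral_restrict_space) auto
  finally show ?thesis .
qed

lemma coeff_cnj: "cnj (coeff k) = coeff (- k)"
proof -
  have "2 * of_real pi * cnj (coeff k) = cnj (2 * of_real pi * coeff k)" by simp
  also have "\<dots> = (\<integral>\<theta>. cnj (complex_of_real (f \<theta>) * cis (- (of_int k * \<theta>))) \<partial>circle)"
    unfolding coeff_circle by (rule Bochner_Integration.integral_cnj[symmetric])
  also have "\<dots> = 2 * of_real pi * coeff (- k)"
    unfolding coeff_circle by (simp add: cis_cnj)
  finally show ?thesis by simp
qed

text \<open>Substitution of \<open>- \<theta>\<close>. With \<open>coeff_cnj\<close> this makes the
  Toeplitz matrix real symmetric and invariant under reversal of both indices.\<close>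

lemma coeff_even: "coeff (- k) = coeff k"
proof -
  let ?F = "\<lambda>k \<theta>. indicator {-pi..pi} \<theta> *\<^sub>R (complex_of_real (f \<theta>) * cis (- (of_int k * \<theta>)))"
  have circ: "2 * of_real pi * coeff k = (\<integral>\<theta>. ?F k \<theta> \<partial>lborel)" for k
    unfolding coeff_circle circle_def by (subst integral_restrict_space) auto
  have "(\<integral>\<theta>. ?F k \<theta> \<partial>lborel) = (\<integral>\<theta>. ?F k (- \<theta>) \<partial>lborel)"
    using lborel_integral_real_affine[of "-1" "?F k" 0] by simp
  also have "\<dots> = (\<integral>\<theta>. ?F (- k) \<theta> \<partial>lborel)"
    by (intro Bochner_Integration.integral_cong refl) (auto simp: indicator_def even)
  finally have "2 * of_real pi * coeff k = 2 * of_real pi * coeff (- k)" unfolding circ .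
  thus ?thesis by simp
qed

definition eigenpair :: "nat \<Rightarrow> (nat \<Rightarrow> complex) \<Rightarrow> real \<Rightarrow> bool" where
  "eigenpair n v a \<longleftrightarrow> (\<Sum>k<n. (cmod (v k))\<^sup>2) = 1 \<and>
     (\<forall>j<n. (\<Sum>k<n. coeff (int j - int k) * v k) = of_real a * v j)"

lemma integrable_symbol_times:
  fixes h :: "real \<Rightarrow> 'b::{banach, second_countable_topology}" and G :: "real \<Rightarrow> real"
  assumes "continuous_on UNIV G" "continuous_on UNIV h"
  shows "integrable circle (\<lambda>\<theta>. G (f \<theta>) *\<^sub>R h \<theta>)"
proof (rule integrable_circle_bounded)
  show "(\<lambda>\<theta>. G (f \<theta>) *\<^sub>R h \<theta>) \<in> borel_measurable circle"
    by (intro borel_measurable_scaleR borel_measurable_continuous_on[OF assms(1)] measurable_symbol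
        measurable_circle_borel borel_measurable_continuous_onI assms)
  have "bounded (h ` {-pi..pi})"
    by (intro compact_imp_bounded compact_continuous_image continuous_on_subset[OF assms(2)]) auto
  then obtain B where B: "\<forall>x\<in>{-pi..pi}. norm (h x) \<le> B" by (auto simp: bounded_iff)
  have "compact (closure (f ` {-pi..pi}))" using bounded by (simp add: compact_closure)
  hence "bounded (G ` closure (f ` {-pi..pi}))"
    by (intro compact_imp_bounded compact_continuous_image continuous_on_subset[OF assms(1)]) auto
  then obtain C where C: "\<forall>y\<in>closure (f ` {-pi..pi}). norm (G y) \<le> C" by (auto simp: bounded_iff)
  have "norm (G (f x) *\<^sub>R h x) \<le> C * B" if x: "x \<in> {-pi..pi}" for x
  proof -
    have "f x \<in> closure (f ` {-pi..pi})" by (rule subsetD[OF closure_subset imageI[OF x]])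
    with C have "norm (G (f x)) \<le> C" by (rule bspec)
    moreover have "norm (h x) \<le> B" using B x by blast
    ultimately show ?thesis unfolding norm_scaleR real_norm_def by (intro mult_mono') auto
  qed
  thus "bounded ((\<lambda>\<theta>. G (f \<theta>) *\<^sub>R h \<theta>) ` {-pi..pi})"
    by (intro boundedI[of _ "C * B"]) (auto simp del: norm_scaleR)
qed

text \<open>With \<open>V\<close> for \<open>trig_sum n v\<close>, the eigenvector equation says
  that the Fourier coefficients of \<open>(f - a) V\<close> with indices \<open>0\<close> to
  \<open>n - 1\<close> vanish; trigonometric sums of length \<open>n\<close> test exactly
  these.\<close>

lemma galerkin_orthogonality:
  assumes "eigenpair n v a"
  shows "(\<integral>\<theta>. of_real (f \<theta> - a) * trig_sum n v \<theta> * cnj (trig_sum n w \<theta>) \<partial>circle) = 0"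
proof -
  let ?h = "\<lambda>\<theta>. of_real (f \<theta> - a) * trig_sum n v \<theta>"
  have int_f: "integrable circle (\<lambda>\<theta>. complex_of_real (f \<theta>) * (c * cis (r * \<theta>)))" for c r
    using integrable_symbol_times[of "\<lambda>x. x" "\<lambda>\<theta>. c * cis (r * \<theta>)"]
    by (simp add: scaleR_conv_of_real continuous_intros)
  have "(\<integral>\<theta>. ?h \<theta> * cis (- (real j * \<theta>)) \<partial>circle) = 0" if j: "j < n" for j
  proof -
    have 1: "of_real (f \<theta>) * trig_sum n v \<theta> * cis (- (real j * \<theta>))
        = (\<Sum>k<n. of_real (f \<theta>) * (v k * cis ((real k - real j) * \<theta>)))" for \<theta>
      unfolding trig_sum_def sum_distrib_left sum_distrib_right
      by (intro sum.cong refl) (simp add: mult.assoc cis_mult algebra_simps)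
    have "(\<integral>\<theta>. of_real (f \<theta>) * trig_sum n v \<theta> * cis (- (real j * \<theta>)) \<partial>circle)
      = (\<Sum>k<n. (\<integral>\<theta>. of_real (f \<theta>) * (v k * cis ((real k - real j) * \<theta>)) \<partial>circle))"
      unfolding 1 by (rule Bochner_Integration.integral_sum) (rule int_f)
    also have "\<dots> = (\<Sum>k<n. v k * (\<integral>\<theta>. of_real (f \<theta>) * cis (- (of_int (int j - int k) * \<theta>)) \<partial>circle))"
      by (intro sum.cong refl, subst integral_mult_right_zero[symmetric])
        (simp add: algebra_simps)
    also have "\<dots> = 2 * of_real pi * (\<Sum>k<n. coeff (int j - int k) * v k)"
      unfolding coeff_circle[symmetric] sum_distrib_left by (simp add: mult_ac)
    also have "\<dots> = of_real a * (2 * of_real pi * v j)"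
      using assms j by (simp add: eigenpair_def)
    also have "\<dots> = (\<integral>\<theta>. of_real a * (trig_sum n v \<theta> * cis (- (real j * \<theta>))) \<partial>circle)"
      by (subst integral_mult_right_zero) (simp add: integral_trig_sum_cis[OF j])
    finally have eq: "(\<integral>\<theta>. of_real (f \<theta>) * trig_sum n v \<theta> * cis (- (real j * \<theta>)) \<partial>circle)
      = (\<integral>\<theta>. of_real a * (trig_sum n v \<theta> * cis (- (real j * \<theta>))) \<partial>circle)" .
    have "(\<integral>\<theta>. ?h \<theta> * cis (- (real j * \<theta>)) \<partial>circle)
      = (\<integral>\<theta>. of_real (f \<theta>) * trig_sum n v \<theta> * cis (- (real j * \<theta>))
          - of_real a * (trig_sum n v \<theta> * cis (- (real j * \<theta>))) \<partial>circle)"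
      by (intro Bochner_Integration.integral_cong refl) (simp add: algebra_simps)
    also have "\<dots> = 0"
    proof (subst Bochner_Integration.integral_diff)
      show "integrable circle (\<lambda>\<theta>. of_real (f \<theta>) * trig_sum n v \<theta> * cis (- (real j * \<theta>)))"
        unfolding 1 by (intro Bochner_Integration.integrable_sum int_f)
      show "integrable circle (\<lambda>\<theta>. of_real a * (trig_sum n v \<theta> * cis (- (real j * \<theta>))))"
        by (intro integrable_circle_continuous continuous_intros)
    qed (simp only: eq diff_self)
    finally show ?thesis .
  qed
  moreover have "?h \<in> borel_measurable circle"
  proof -
    have [measurable]: "trig_sum n v \<in> borel_measurable circle"
      by (intro measurable_circle_borel borel_measurable_continuous_onI continuous_intros)
    show ?thesis by measurable
  qed
  moreover have "bounded (?h ` {-pi..pi})"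
  proof -
    obtain B where B: "\<And>x. x \<in> {-pi..pi} \<Longrightarrow> \<bar>f x\<bar> \<le> B"
      using bounded_imageE[OF bounded] unfolding real_norm_def by blast
    obtain C where C: "\<And>x. x \<in> {-pi..pi} \<Longrightarrow> norm (trig_sum n v x) \<le> C"
      using bounded_imageE[OF bounded_trig_sum] by blast
    have "norm (?h x) \<le> (B + \<bar>a\<bar>) * C" if x: "x \<in> {-pi..pi}" for x
    proof -
      have "\<bar>f x - a\<bar> \<le> B + \<bar>a\<bar>" using B[OF x] by linarith
      hence "\<bar>f x - a\<bar> * norm (trig_sum n v x) \<le> (B + \<bar>a\<bar>) * C"
        using C[OF x] by (intro mult_mono') auto
      thus ?thesis by (simp add: norm_mult flip: of_real_diff)
    qed
    thus ?thesis unfolding bounded_iff by blast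
  qed
  ultimately show ?thesis by (subst integral_mult_cnj_trig_sum) auto
qed

text \<open>If \<open>a\<close> missed the connected range, \<open>f - a\<close> would have one
  strict sign; its vanishing weighted mean would force the weight to be zero almost everywhere,
  against its mass \<open>2 * pi\<close>.\<close>

lemma eigenvalue_in_range:
  assumes ev: "eigenpair n v a" and conn: "connected (f ` {-pi..pi})"
  shows "a \<in> f ` {-pi..pi}"
proof (rule ccontr)
  assume out: "a \<notin> f ` {-pi..pi}"
  let ?w = "\<lambda>\<theta>. (cmod (trig_sum n v \<theta>))\<^sup>2"
  have zero: "(\<integral>\<theta>. (f \<theta> - a) * ?w \<theta> \<partial>circle) = 0"
  proof -
    have "complex_of_real (\<integral>\<theta>. (f \<theta> - a) * ?w \<theta> \<partial>circle) =
      (\<integral>\<theta>. of_real (f \<theta> - a) * trig_sum n v \<theta> * cnj (trig_sum n v \<theta>) \<partial>circle)"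
      unfolding integral_complex_of_real[symmetric]
      by (intro Bochner_Integration.integral_cong refl)
        (simp only: of_real_mult complex_norm_square mult.assoc)
    thus ?thesis using galerkin_orthogonality[OF ev, of v] by simp
  qed
  have int: "integrable circle (\<lambda>\<theta>. (f \<theta> - a) * ?w \<theta>)"
    using integrable_symbol_times[of "\<lambda>x. x - a" ?w] by (simp add: continuous_intros)
  have total: "(\<integral>\<theta>. ?w \<theta> \<partial>circle) = 2 * pi"
    using ev by (simp add: integral_trig_sum_norm eigenpair_def)
  have contra: False if "\<And>\<theta>. \<theta> \<in> {-pi..pi} \<Longrightarrow> \<sigma> * (f \<theta> - a) > 0" for \<sigma> :: real
  proof -
    have "(\<integral>\<theta>. \<sigma> * ((f \<theta> - a) * ?w \<theta>) \<partial>circle) = 0" using zero by simp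
    hence "AE \<theta> in circle. \<sigma> * ((f \<theta> - a) * ?w \<theta>) = 0"
    proof (subst (asm) integral_nonneg_eq_0_iff_AE)
      show "AE \<theta> in circle. 0 \<le> \<sigma> * ((f \<theta> - a) * ?w \<theta>)"
        using that by (intro AE_I2) (simp add: mult.assoc[symmetric] less_imp_le)
    qed (use int in auto)
    hence "AE \<theta> in circle. ?w \<theta> = 0"
      using AE_space by eventually_elim (use that in fastforce)
    hence "(\<integral>\<theta>. ?w \<theta> \<partial>circle) = (\<integral>\<theta>. 0 \<partial>circle)"
      by (intro integral_cong_AE)
        (auto intro!: measurable_circle_borel borel_measurable_continuous_onI continuous_intros)
    thus False using total by simp
  qed
  have "(\<forall>y\<in>f ` {-pi..pi}. y < a) \<or> (\<forall>y\<in>f ` {-pi..pi}. a < y)"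
  proof (rule ccontr)
    assume "\<not> ?thesis"
    then obtain y z where "y \<in> f ` {-pi..pi}" "z \<in> f ` {-pi..pi}" "y \<le> a" "a \<le> z"
      by (meson linorder_not_less)
    hence "a \<in> f ` {-pi..pi}" by (rule connectedD_interval[OF conn])
    thus False using out by contradiction
  qed
  thus False using contra[of 1] contra[of "-1"] by auto
qed

text \<open>By orthogonality, \<open>(f - a) V\<close> is the shortest vector in \<open>f V\<close> plus trigonometric sums.\<close>

lemma residual_minimal:
  assumes ev: "eigenpair n v a"
  shows "(\<integral>\<theta>. (f \<theta> - a)\<^sup>2 * (cmod (trig_sum n v \<theta>))\<^sup>2 \<partial>circle)
       \<le> (\<integral>\<theta>. (cmod (of_real (f \<theta>) * trig_sum n v \<theta> - trig_sum n w \<theta>))\<^sup>2 \<partial>circle)"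
proof -
  \<comment> \<open>With \<open>V\<close> and \<open>W\<close> the sums of \<open>v\<close> and
    \<open>w\<close>, \<open>f V - W\<close> is \<open>(f - a) V\<close> plus the sum of
    \<open>u\<close>; the mixed term drops out by orthogonality, which leaves Pythagoras.\<close>
  define u where "u k = of_real a * v k - w k" for k
  have u: "trig_sum n u \<theta> = of_real a * trig_sum n v \<theta> - trig_sum n w \<theta>" for \<theta>
    by (simp add: trig_sum_def u_def sum_subtractf sum_distrib_left algebra_simps)
  let ?X = "\<lambda>\<theta>. of_real (f \<theta> - a) * trig_sum n v \<theta>"
  have "(cmod (of_real (f \<theta>) * trig_sum n v \<theta> - trig_sum n w \<theta>))\<^sup>2
      = (f \<theta> - a)\<^sup>2 * (cmod (trig_sum n v \<theta>))\<^sup>2 + 2 * Re (?X \<theta> * cnj (trig_sum n u \<theta>)) + (cmod (trig_sum n u \<theta>))\<^sup>2" for \<theta>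
  proof -
    have "of_real (f \<theta>) * trig_sum n v \<theta> - trig_sum n w \<theta> = ?X \<theta> + trig_sum n u \<theta>"
      by (simp add: u algebra_simps)
    moreover have "(cmod (x + y))\<^sup>2 = (cmod x)\<^sup>2 + 2 * Re (x * cnj y) + (cmod y)\<^sup>2" for x y
      unfolding cmod_power2 by (simp add: power2_eq_square algebra_simps)
    moreover have "(cmod (?X \<theta>))\<^sup>2 = (f \<theta> - a)\<^sup>2 * (cmod (trig_sum n v \<theta>))\<^sup>2"
      by (simp add: norm_mult power_mult_distrib flip: of_real_diff)
    ultimately show ?thesis by simp
  qed
  note expand = this
  have i1: "integrable circle (\<lambda>\<theta>. (f \<theta> - a)\<^sup>2 * (cmod (trig_sum n v \<theta>))\<^sup>2)"
    using integrable_symbol_times[of "\<lambda>x. (x - a)\<^sup>2" "\<lambda>\<theta>. (cmod (trig_sum n v \<theta>))\<^sup>2"]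
    by (simp add: continuous_intros)
  have i2: "integrable circle (\<lambda>\<theta>. ?X \<theta> * cnj (trig_sum n u \<theta>))"
    using integrable_symbol_times[of "\<lambda>x. x - a" "\<lambda>\<theta>. trig_sum n v \<theta> * cnj (trig_sum n u \<theta>)"]
    by (simp add: continuous_intros scaleR_conv_of_real mult.assoc)
  have i3: "integrable circle (\<lambda>\<theta>. (cmod (trig_sum n u \<theta>))\<^sup>2)"
    by (intro integrable_circle_continuous continuous_intros)
  have i2': "integrable circle (\<lambda>\<theta>. 2 * Re (?X \<theta> * cnj (trig_sum n u \<theta>)))"
    by (intro integrable_mult_right integrable_Re i2)
  have "(\<integral>\<theta>. 2 * Re (?X \<theta> * cnj (trig_sum n u \<theta>)) \<partial>circle) = 0"
    unfolding integral_mult_right_zero integral_Re[OF i2] galerkin_orthogonality[OF ev] by simp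
  hence "(\<integral>\<theta>. (cmod (of_real (f \<theta>) * trig_sum n v \<theta> - trig_sum n w \<theta>))\<^sup>2 \<partial>circle)
      = (\<integral>\<theta>. (f \<theta> - a)\<^sup>2 * (cmod (trig_sum n v \<theta>))\<^sup>2 \<partial>circle) + (\<integral>\<theta>. (cmod (trig_sum n u \<theta>))\<^sup>2 \<partial>circle)"
    unfolding expand using i1 i2' i3 by simp
  moreover have "(\<integral>\<theta>. (cmod (trig_sum n u \<theta>))\<^sup>2 \<partial>circle) \<ge> 0" by simp
  ultimately show ?thesis by linarith
qed

end

section \<open>Approximation of the symbol by cosine polynomials\<close>

lemma trig_sum_spanned:
  assumes "\<And>j. j \<in> J \<Longrightarrow> \<exists>w. \<forall>\<theta>. g j \<theta> = trig_sum n w \<theta>" "finite J"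
  shows "\<exists>w. \<forall>\<theta>. (\<Sum>j\<in>J. c j * g j \<theta>) = trig_sum n w \<theta>"
proof -
  from assms(1) obtain w where w: "\<And>j \<theta>. j \<in> J \<Longrightarrow> g j \<theta> = trig_sum n (w j) \<theta>" by metis
  have "(\<Sum>j\<in>J. c j * g j \<theta>) = trig_sum n (\<lambda>k. \<Sum>j\<in>J. c j * w j k) \<theta>" for \<theta>
  proof -
    have "(\<Sum>j\<in>J. c j * g j \<theta>) = (\<Sum>j\<in>J. \<Sum>k<n. c j * w j k * cis (real k * \<theta>))"
      by (intro sum.cong refl) (simp add: w trig_sum_def sum_distrib_left mult.assoc)
    also have "\<dots> = trig_sum n (\<lambda>k. \<Sum>j\<in>J. c j * w j k) \<theta>"
      unfolding trig_sum_def sum_distrib_right by (rule sum.swap)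
    finally show ?thesis .
  qed
  thus ?thesis by blast
qed

lemma cis_spanned:
  assumes "k < n" shows "\<exists>w. \<forall>\<theta>. cis (real k * \<theta>) = trig_sum n w \<theta>"
proof (intro exI allI)
  fix \<theta>
  have "trig_sum n (\<lambda>j. if j = k then 1 else 0) \<theta> = (\<Sum>j<n. if j = k then cis (real k * \<theta>) else 0)"
    unfolding trig_sum_def by (intro sum.cong) auto
  thus "cis (real k * \<theta>) = trig_sum n (\<lambda>j. if j = k then 1 else 0) \<theta>"
    using assms by (simp add: sum.delta)
qed

text \<open>Each factor \<open>cos \<theta>\<close> shifts frequencies by one up and down; the
  hypotheses keep the frequencies \<open>k - i\<close> to \<open>k + i\<close> within
  \<open>0\<close> to \<open>n - 1\<close>.\<close>

lemma cos_power_spanned: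
  assumes "i \<le> k" "k + i < n"
  shows "\<exists>w. \<forall>\<theta>. of_real (cos \<theta> ^ i) * cis (real k * \<theta>) = trig_sum n w \<theta>"
  using assms
proof (induction i arbitrary: k)
  case 0
  thus ?case using cis_spanned[of k n] by simp
next
  case (Suc i)
  define g where "g j \<theta> = of_real (cos \<theta> ^ i) * cis (real j * \<theta>)" for j :: nat and \<theta>
  have "\<exists>w. \<forall>\<theta>. (\<Sum>j\<in>{k - 1, k + 1}. (1 / 2) * g j \<theta>) = trig_sum n w \<theta>"
  proof (rule trig_sum_spanned)
    show "\<exists>w. \<forall>\<theta>. g j \<theta> = trig_sum n w \<theta>" if "j \<in> {k - 1, k + 1}" for j
      unfolding g_def using that Suc.prems by (intro Suc.IH) auto
  qed simp
  moreover have "(\<Sum>j\<in>{k - 1, k + 1}. (1 / 2) * g j \<theta>) = of_real (cos \<theta> ^ Suc i) * cis (real k * \<theta>)" for \<theta>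
  proof -
    have k: "real (k - 1) * \<theta> = real k * \<theta> - \<theta>" "real (k + 1) * \<theta> = real k * \<theta> + \<theta>"
      using Suc.prems by (auto simp: of_nat_diff algebra_simps)
    have c: "of_real (cos \<theta>) = (cis \<theta> + cis (- \<theta>)) / 2" by (simp add: complex_eq_iff)
    have shift: "cis (real k * \<theta> - \<theta>) = cis (real k * \<theta>) * cis (- \<theta>)"
      "cis (real k * \<theta> + \<theta>) = cis (real k * \<theta>) * cis \<theta>" by (simp_all add: cis_mult)
    have "(\<Sum>j\<in>{k - 1, k + 1}. (1 / 2) * g j \<theta>) = (g (k - 1) \<theta> + g (k + 1) \<theta>) / 2"
      by (subst sum.insert) auto
    also have "\<dots> = of_real (cos \<theta> ^ i) * (of_real (cos \<theta>) * cis (real k * \<theta>))"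
      unfolding g_def k c shift by (simp add: algebra_simps add_divide_distrib del: cis_mult)
    finally show ?thesis by (simp add: mult_ac)
  qed
  ultimately show ?case by simp
qed

context even_symbol
begin

text \<open>Evenness makes \<open>f\<close> a function of the cosine. A cutoff damps it near its
  finitely many discontinuities at small cost in mean square, and Weierstrass approximates the
  continuous product uniformly.\<close>

lemma cosine_approximation:
  assumes "\<eta> > 0"
  obtains d and c :: "nat \<Rightarrow> real" where "(\<integral>\<theta>. (f \<theta> - (\<Sum>i\<le>d. c i * cos \<theta> ^ i))\<^sup>2 \<partial>circle) < \<eta>"
proof -
  define D where "D = discontinuity_points f {-pi..pi}"
  \<comment> \<open>The extra point \<open>0\<close> keeps \<open>Z\<close> nonempty:
    \<open>infdist\<close> to the empty set is 0, and the cutoff would vanish identically.\<close>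
  define Z where "Z = insert 0 (cos ` D)"
  have Z: "finite Z" "Z \<noteq> {}" "closed Z"
    using discontinuities by (auto simp: Z_def D_def finite_imp_closed)
  obtain B where B: "\<And>x. x \<in> {-pi..pi} \<Longrightarrow> \<bar>f x\<bar> \<le> B"
    using bounded_imageE[OF bounded] unfolding real_norm_def by blast
  \<comment> \<open>Zero on \<open>Z\<close> and, for positive \<open>m\<close>, one from distance
    \<open>1 / m\<close> on.\<close>
  define cut where "cut m x = min 1 (real m * infdist x Z)" for m :: nat and x :: real
  have cut01: "0 \<le> cut m x" "cut m x \<le> 1" for m x by (auto simp: cut_def infdist_nonneg)
  have cut_cont: "continuous_on UNIV (cut m)" for m
    unfolding cut_def by (intro continuous_intros)
  have arccos_cos: "f (arccos (cos \<theta>)) = f \<theta>" if "\<theta> \<in> {-pi..pi}" for \<theta>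
    using arccos_cos_eq_abs[of \<theta>] even[OF that] that by (auto simp: abs_if)
  define F where "F x = f (arccos x)" for x
  have FB: "\<bar>F x\<bar> \<le> B" if "x \<in> {-1..1}" for x
    unfolding F_def using that arccos_lbound[of x] arccos_ubound[of x] by (intro B) auto
  have cont: "continuous_on {-1..1} (\<lambda>x. F x * cut m x)" for m
    unfolding continuous_on_eq_continuous_within
  proof
    fix x :: real assume x: "x \<in> {-1..1}"
    have cut_lim: "(cut m \<longlongrightarrow> cut m x) (at x within {-1..1})"
      using cut_cont[of m] by (meson UNIV_I continuous_on_def tendsto_within_subset subset_UNIV)
    show "continuous (at x within {-1..1}) (\<lambda>x. F x * cut m x)"
    proof (cases "x \<in> Z")
      case True
      hence 0: "cut m x = 0" using Z by (simp add: cut_def)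
      \<comment> \<open>\<open>F\<close> may jump at \<open>x\<close>, but it is bounded and the
        cutoff tends to 0 there.\<close>
      have "((\<lambda>x. F x * cut m x) \<longlongrightarrow> 0) (at x within {-1..1})"
      proof (rule Lim_null_comparison)
        show "\<forall>\<^sub>F y in at x within {-1..1}. norm (F y * cut m y) \<le> B * cut m y"
          unfolding eventually_at_filter
          by (rule always_eventually) (use FB cut01 in \<open>auto simp: abs_mult intro!: mult_right_mono\<close>)
        show "((\<lambda>y. B * cut m y) \<longlongrightarrow> 0) (at x within {-1..1})"
          using tendsto_mult_left[OF cut_lim, of B] 0 by simp
      qed
      thus ?thesis by (simp add: continuous_within 0)
    next
      case False
      have ax: "arccos x \<in> {-pi..pi}" using x arccos_lbound[of x] arccos_ubound[of x] by auto
      have "arccos x \<notin> D" using False x by (auto simp: Z_def image_iff)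
      hence "continuous (at (arccos x) within {-pi..pi}) f"
        using ax by (auto simp: D_def discontinuity_points_def)
      hence "continuous (at (arccos x) within arccos ` {-1..1}) f"
        by (rule continuous_within_subset) (use arccos_lbound arccos_ubound in force)
      moreover have "continuous (at x within {-1..1}) arccos"
        using continuous_on_arccos' x by (auto simp: continuous_on_eq_continuous_within)
      ultimately have "continuous (at x within {-1..1}) F"
        unfolding F_def by (rule continuous_within_compose2[rotated])
      moreover have "continuous (at x within {-1..1}) (cut m)"
        using cut_lim by (simp add: continuous_within)
      ultimately show ?thesis by (rule continuous_mult)
    qed
  qed
  have lim: "(\<lambda>m. \<integral>\<theta>. (f \<theta> - f \<theta> * cut m (cos \<theta>))\<^sup>2 \<partial>circle) \<longlonglongrightarrow> (\<integral>\<theta>. 0 \<partial>circle)"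
  proof (rule integral_dominated_convergence)
    have "finite (arccos ` Z \<union> uminus ` arccos ` Z)" using Z by simp
    hence "AE \<theta> in circle. \<theta> \<notin> (arccos ` Z \<union> uminus ` arccos ` Z) \<inter> {-pi..pi}"
      by (intro AE_not_in null_sets_circle_finite)
    thus "AE \<theta> in circle. (\<lambda>m. (f \<theta> - f \<theta> * cut m (cos \<theta>))\<^sup>2) \<longlonglongrightarrow> 0"
      using AE_space
    proof eventually_elim
      case (elim \<theta>)
      hence "\<bar>\<theta>\<bar> \<notin> arccos ` Z" by (auto simp: abs_if image_iff split: if_splits)
      moreover have "\<bar>\<theta>\<bar> = arccos (cos \<theta>)" using elim by (simp add: arccos_cos_eq_abs abs_le_iff)
      ultimately have "cos \<theta> \<notin> Z" by auto
      hence pos: "infdist (cos \<theta>) Z > 0" using Z infdist_nonneg[of "cos \<theta>" Z]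
        by (simp add: in_closed_iff_infdist_zero less_le)
      obtain m0 :: nat where m0: "1 / infdist (cos \<theta>) Z < real m0" using reals_Archimedean2 by blast
      have "cut m (cos \<theta>) = 1" if "m \<ge> m0" for m
      proof -
        have "1 / infdist (cos \<theta>) Z < real m" using m0 that by (meson less_le_trans of_nat_le_iff)
        thus ?thesis using pos by (simp add: cut_def field_simps)
      qed
      hence "eventually (\<lambda>m. (f \<theta> - f \<theta> * cut m (cos \<theta>))\<^sup>2 = 0) sequentially"
        unfolding eventually_sequentially by (intro exI[of _ m0]) simp
      thus ?case by (rule tendsto_eventually)
    qed
    show "AE \<theta> in circle. norm ((f \<theta> - f \<theta> * cut m (cos \<theta>))\<^sup>2) \<le> B\<^sup>2" for m
    proof (intro AE_I2)
      fix \<theta> assume t: "\<theta> \<in> space circle"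
      have "\<bar>f \<theta> - f \<theta> * cut m (cos \<theta>)\<bar> = \<bar>f \<theta>\<bar> * (1 - cut m (cos \<theta>))"
      proof -
        have "f \<theta> - f \<theta> * cut m (cos \<theta>) = f \<theta> * (1 - cut m (cos \<theta>))" by (simp add: algebra_simps)
        thus ?thesis using cut01[of m "cos \<theta>"] by (simp only: abs_mult)
      qed
      also have "\<dots> \<le> B * 1" using B[of \<theta>] t cut01[of m "cos \<theta>"] by (intro mult_mono) auto
      finally show "norm ((f \<theta> - f \<theta> * cut m (cos \<theta>))\<^sup>2) \<le> B\<^sup>2"
        using power_mono[of "\<bar>f \<theta> - f \<theta> * cut m (cos \<theta>)\<bar>" B 2] by simp
    qed
    show "(\<lambda>\<theta>. (f \<theta> - f \<theta> * cut m (cos \<theta>))\<^sup>2) \<in> borel_measurable circle" for m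
      by (intro borel_measurable_power borel_measurable_diff borel_measurable_times measurable_symbol
          measurable_circle_borel borel_measurable_continuous_onI continuous_intros
          continuous_on_compose2[OF cut_cont]) auto
  qed auto
  have "eventually (\<lambda>m. (\<integral>\<theta>. (f \<theta> - f \<theta> * cut m (cos \<theta>))\<^sup>2 \<partial>circle) < \<eta> / 4) sequentially"
    using order_tendstoD(2)[OF lim, of "\<eta> / 4"] assms by simp
  then obtain m where m: "(\<integral>\<theta>. (f \<theta> - f \<theta> * cut m (cos \<theta>))\<^sup>2 \<partial>circle) < \<eta> / 4"
    by (auto simp: eventually_sequentially)
  \<comment> \<open>Half of the budget: \<open>2 * \<delta>\<^sup>2 * (2 * pi) = \<eta> / 2\<close>.
    Twice the cutoff error stays below the other half.\<close>
  define \<delta> where "\<delta> = sqrt (\<eta> / (8 * pi))"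
  have \<delta>: "\<delta> > 0" "\<delta>\<^sup>2 = \<eta> / (8 * pi)" using assms by (auto simp: \<delta>_def)
  obtain p where p: "real_polynomial_function p" "\<And>x. x \<in> {-1..1} \<Longrightarrow> \<bar>F x * cut m x - p x\<bar> < \<delta>"
    using Stone_Weierstrass_real_polynomial_function[OF compact_Icc cont \<delta>(1)] by blast
  obtain c d where pc: "p = (\<lambda>x. \<Sum>i\<le>d. c i * x ^ i)"
    using p(1) unfolding real_polynomial_function_iff_sum by blast
  have pcont: "continuous_on UNIV (\<lambda>\<theta>. p (cos \<theta>))" unfolding pc by (intro continuous_intros)
  have meas: "(\<lambda>\<theta>. cut m (cos \<theta>)) \<in> borel_measurable circle" "(\<lambda>\<theta>. p (cos \<theta>)) \<in> borel_measurable circle"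
    by (intro measurable_circle_borel borel_measurable_continuous_onI pcont
          continuous_on_compose2[OF cut_cont] continuous_intros; simp)+
  have bd1: "\<bar>f \<theta> - f \<theta> * cut m (cos \<theta>)\<bar> \<le> 2 * B" if "\<theta> \<in> {-pi..pi}" for \<theta>
  proof -
    have "\<bar>f \<theta> * cut m (cos \<theta>)\<bar> \<le> B * 1"
      unfolding abs_mult using B[OF that] cut01[of m "cos \<theta>"] by (intro mult_mono') auto
    thus ?thesis using B[OF that] by linarith
  qed
  have split: "(f \<theta> - p (cos \<theta>))\<^sup>2 \<le> 2 * (f \<theta> - f \<theta> * cut m (cos \<theta>))\<^sup>2 + 2 * \<delta>\<^sup>2"
    if t: "\<theta> \<in> {-pi..pi}" for \<theta>
  proof -
    have "\<bar>f \<theta> * cut m (cos \<theta>) - p (cos \<theta>)\<bar> \<le> \<delta>"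
      using p(2)[of "cos \<theta>"] arccos_cos[OF t] by (simp add: F_def)
    hence "(f \<theta> * cut m (cos \<theta>) - p (cos \<theta>))\<^sup>2 \<le> \<delta>\<^sup>2" using abs_le_square_iff \<delta>(1) by fastforce
    moreover have "(x + y)\<^sup>2 \<le> 2 * x\<^sup>2 + 2 * y\<^sup>2" for x y :: real
      using zero_le_power2[of "x - y"] by (simp add: power2_eq_square algebra_simps)
    from this[of "f \<theta> - f \<theta> * cut m (cos \<theta>)" "f \<theta> * cut m (cos \<theta>) - p (cos \<theta>)"]
    have "(f \<theta> - p (cos \<theta>))\<^sup>2 \<le> 2 * (f \<theta> - f \<theta> * cut m (cos \<theta>))\<^sup>2
        + 2 * (f \<theta> * cut m (cos \<theta>) - p (cos \<theta>))\<^sup>2" by simp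
    ultimately show ?thesis by linarith
  qed
  have i1: "integrable circle (\<lambda>\<theta>. (f \<theta> - f \<theta> * cut m (cos \<theta>))\<^sup>2)"
  proof (rule circle.integrable_const_bound[of _ "(2 * B)\<^sup>2"])
    show "AE \<theta> in circle. norm ((f \<theta> - f \<theta> * cut m (cos \<theta>))\<^sup>2) \<le> (2 * B)\<^sup>2"
      using bd1 by (intro AE_I2) (metis norm_power power_mono real_norm_def norm_ge_zero space_circle)
  qed (intro borel_measurable_power borel_measurable_diff borel_measurable_times measurable_symbol meas)
  have i2: "integrable circle (\<lambda>\<theta>. 2 * (f \<theta> - f \<theta> * cut m (cos \<theta>))\<^sup>2 + 2 * \<delta>\<^sup>2)"
    using i1 by auto
  have "(\<integral>\<theta>. (f \<theta> - p (cos \<theta>))\<^sup>2 \<partial>circle) \<le> (\<integral>\<theta>. 2 * (f \<theta> - f \<theta> * cut m (cos \<theta>))\<^sup>2 + 2 * \<delta>\<^sup>2 \<partial>circle)"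
    by (rule integral_mono'[OF i2]) (use split in auto)
  also have "\<dots> = 2 * (\<integral>\<theta>. (f \<theta> - f \<theta> * cut m (cos \<theta>))\<^sup>2 \<partial>circle) + 2 * \<delta>\<^sup>2 * (2 * pi)"
    using i1 by (subst Bochner_Integration.integral_add) (auto simp: measure_circle)
  also have "\<dots> < \<eta>" using m \<delta>(2) by (simp add: field_simps)
  finally show ?thesis using that unfolding pc by blast
qed

end

text \<open>The Dirichlet kernel \<open>sin (n \<theta>) / sin \<theta>\<close>, with frequencies
  \<open>2 k - n + 1\<close>, in the product form in which it arises from reversed indices.\<close>

definition dirichlet :: "nat \<Rightarrow> real \<Rightarrow> complex" where
  "dirichlet n \<theta> = (\<Sum>k<n. cis (real k * \<theta>) * cnj (cis (real (n - 1 - k) * \<theta>)))"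

text \<open>Parseval for \<open>n\<close> pairwise distinct frequencies.\<close>

lemma integral_dirichlet_norm: "(\<integral>\<theta>. (cmod (dirichlet n \<theta>))\<^sup>2 \<partial>circle) = 2 * pi * real n"
proof -
  define e where "e k \<theta> = cis (real k * \<theta>) * cnj (cis (real (n - 1 - k) * \<theta>))" for k \<theta>
  have prod: "e k \<theta> * cnj (e l \<theta>) = cis (of_int (2 * (int k - int l)) * \<theta>)" if "k < n" "l < n" for k l \<theta>
    using that by (simp add: e_def cis_cnj cis_mult of_nat_diff algebra_simps)
  have "complex_of_real (\<integral>\<theta>. (cmod (dirichlet n \<theta>))\<^sup>2 \<partial>circle)
      = (\<integral>\<theta>. dirichlet n \<theta> * cnj (dirichlet n \<theta>) \<partial>circle)"
    unfolding integral_complex_of_real[symmetric]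
    by (intro Bochner_Integration.integral_cong refl complex_norm_square)
  also have "\<dots> = (\<integral>\<theta>. (\<Sum>k<n. \<Sum>l<n. cis (of_int (2 * (int k - int l)) * \<theta>)) \<partial>circle)"
  proof (intro Bochner_Integration.integral_cong refl)
    fix \<theta>
    have "dirichlet n \<theta> * cnj (dirichlet n \<theta>) = (\<Sum>k<n. \<Sum>l<n. e k \<theta> * cnj (e l \<theta>))"
      unfolding dirichlet_def e_def[symmetric] cnj_sum by (rule sum_product)
    thus "dirichlet n \<theta> * cnj (dirichlet n \<theta>) = (\<Sum>k<n. \<Sum>l<n. cis (of_int (2 * (int k - int l)) * \<theta>))"
      by (simp add: prod)
  qed
  also have "\<dots> = (\<Sum>k<n. \<Sum>l<n. (\<integral>\<theta>. cis (of_int (2 * (int k - int l)) * \<theta>) \<partial>circle))"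
  proof -
    have int: "integrable circle (\<lambda>\<theta>. cis (of_int m * \<theta>))" for m
      by (intro integrable_circle_continuous continuous_intros)
    show ?thesis
      by (subst Bochner_Integration.integral_sum, intro Bochner_Integration.integrable_sum int)
        (intro sum.cong refl Bochner_Integration.integral_sum int)
  qed
  also have "\<dots> = (\<Sum>k<n. \<Sum>l<n. if l = k then 2 * of_real pi else 0)"
    by (intro sum.cong refl) (simp only: integral_cis, auto)
  also have "\<dots> = of_real (2 * pi * real n)" by (simp add: sum.delta)
  finally show ?thesis unfolding of_real_eq_iff .
qed

lemma continuous_dirichlet: "continuous_on A (dirichlet n)"
  unfolding dirichlet_def by (intro continuous_intros)

section \<open>Residuals and means over one symmetry class\<close>

context even_symbol
begin

definition eigensystem :: "nat \<Rightarrow> (nat \<Rightarrow> nat \<Rightarrow> complex) \<Rightarrow> (nat \<Rightarrow> real) \<Rightarrow> (nat \<Rightarrow> real) \<Rightarrow> bool" where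
  "eigensystem n U a s \<longleftrightarrow> orthonormal_family n U \<and> (\<forall>i<n. eigenpair n (U i) (a i)) \<and>
     (\<forall>i<n. \<forall>k<n. U i (n - 1 - k) = of_real (s i) * U i k) \<and> (\<forall>i<n. s i = 1 \<or> s i = - 1)"

text \<open>Frequencies at least \<open>d\<close> away from both ends stay in range when multiplied
  by the polynomial \<open>q\<close>, so \<open>q\<close> times the central part of each
  trigonometric sum is a competitor in \<open>residual_minimal\<close>. Summed over the family,
  \<open>trig_sum_family_norm\<close> leaves one integral per frequency: that of
  \<open>(f - q)^2\<close> in the centre, that of \<open>f^2\<close> at no more than
  \<open>2 * d\<close> boundary frequencies.\<close>

lemma residual_sum:
  assumes es: "eigensystem n U a s"
  shows "(\<Sum>i<n. \<integral>\<theta>. (f \<theta> - a i)\<^sup>2 * (cmod (trig_sum n (U i) \<theta>))\<^sup>2 \<partial>circle)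
    \<le> real n * (\<integral>\<theta>. (f \<theta> - (\<Sum>i\<le>d. c i * cos \<theta> ^ i))\<^sup>2 \<partial>circle) + 2 * real d * (\<integral>\<theta>. (f \<theta>)\<^sup>2 \<partial>circle)"
proof -
  have U: "orthonormal_family n U" and ep: "\<And>i. i < n \<Longrightarrow> eigenpair n (U i) (a i)"
    using es by (auto simp: eigensystem_def)
  define q where "q \<theta> = (\<Sum>i\<le>d. c i * cos \<theta> ^ i)" for \<theta>
  have q_cont: "continuous_on UNIV q" unfolding q_def by (intro continuous_intros)
  define K where "K = {k. d \<le> k \<and> k + d < n}"
  have K: "K \<subseteq> {..<n}" "finite K" by (auto simp: K_def intro: finite_subset[of _ "{..<n}"])
  have "\<exists>w. \<forall>\<theta>. of_real (q \<theta>) * cis (real k * \<theta>) = trig_sum n w \<theta>" if "k \<in> K" for k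
  proof -
    have "\<exists>w. \<forall>\<theta>. (\<Sum>i\<in>{..d}. of_real (c i) * (of_real (cos \<theta> ^ i) * cis (real k * \<theta>))) = trig_sum n w \<theta>"
      by (rule trig_sum_spanned) (use that in \<open>auto simp: K_def simp del: of_real_power intro!: cos_power_spanned\<close>)
    thus ?thesis unfolding q_def of_real_sum of_real_mult sum_distrib_right mult.assoc .
  qed
  then obtain C where C: "\<And>k \<theta>. k \<in> K \<Longrightarrow> of_real (q \<theta>) * cis (real k * \<theta>) = trig_sum n (C k) \<theta>" by metis
  define w where "w i l = (\<Sum>k\<in>K. U i k * C k l)" for i l
  have w: "trig_sum n (w i) \<theta> = (\<Sum>k\<in>K. U i k * (of_real (q \<theta>) * cis (real k * \<theta>)))" for i \<theta>
  proof -
    have "trig_sum n (w i) \<theta> = (\<Sum>l<n. \<Sum>k\<in>K. U i k * (C k l * cis (real l * \<theta>)))"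
      by (simp add: trig_sum_def w_def sum_distrib_right mult.assoc)
    also have "\<dots> = (\<Sum>k\<in>K. U i k * trig_sum n (C k) \<theta>)"
      unfolding trig_sum_def sum_distrib_left by (rule sum.swap)
    finally show ?thesis using C by simp
  qed
  \<comment> \<open>The multiplier left at frequency \<open>k\<close>: \<open>f - q\<close> in the
    window \<open>K\<close>, all of \<open>f\<close> outside.\<close>
  define g where "g k \<theta> = f \<theta> - (if k \<in> K then q \<theta> else 0)" for k \<theta>
  have diff: "of_real (f \<theta>) * trig_sum n (U i) \<theta> - trig_sum n (w i) \<theta>
      = trig_sum n (\<lambda>k. U i k * of_real (g k \<theta>)) \<theta>" for i \<theta>
  proof -
    have "trig_sum n (w i) \<theta> = (\<Sum>k<n. if k \<in> K then U i k * (of_real (q \<theta>) * cis (real k * \<theta>)) else 0)"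
      unfolding w using K by (simp add: sum.inter_restrict[symmetric] Int_absorb1)
    thus ?thesis
      by (simp add: trig_sum_def sum_distrib_left sum_subtractf[symmetric] g_def algebra_simps)
        (intro sum.cong refl, auto simp: algebra_simps)
  qed
  have sq: "integrable circle (\<lambda>\<theta>. (f \<theta>)\<^sup>2)"
    using integrable_symbol_times[of "\<lambda>x. x\<^sup>2" "\<lambda>_. 1::real"] by (simp add: continuous_intros)
  have fq: "integrable circle (\<lambda>\<theta>. (f \<theta> - q \<theta>)\<^sup>2)"
  proof -
    have "integrable circle (\<lambda>\<theta>. f \<theta> * (2 * q \<theta>))"
      using integrable_symbol_times[of "\<lambda>x. x" "\<lambda>\<theta>. 2 * q \<theta>"] q_cont by (simp add: continuous_intros)
    moreover have "integrable circle (\<lambda>\<theta>. (q \<theta>)\<^sup>2)"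
      using q_cont by (intro integrable_circle_continuous continuous_intros)
    ultimately have "integrable circle (\<lambda>\<theta>. (f \<theta>)\<^sup>2 - f \<theta> * (2 * q \<theta>) + (q \<theta>)\<^sup>2)" using sq by auto
    thus ?thesis by (simp add: power2_diff algebra_simps)
  qed
  have ig: "integrable circle (\<lambda>\<theta>. (g k \<theta>)\<^sup>2)" for k
    using sq fq by (cases "k \<in> K") (simp_all add: g_def)
  have fam: "(\<Sum>i<n. (cmod (of_real (f \<theta>) * trig_sum n (U i) \<theta> - trig_sum n (w i) \<theta>))\<^sup>2) = (\<Sum>k<n. (g k \<theta>)\<^sup>2)" for \<theta>
    unfolding diff trig_sum_family_norm[OF U] by simp
  have int: "integrable circle (\<lambda>\<theta>. (cmod (of_real (f \<theta>) * trig_sum n (U i) \<theta> - trig_sum n (w i) \<theta>))\<^sup>2)"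
    if i: "i < n" for i
  proof (rule Bochner_Integration.integrable_bound)
    show "integrable circle (\<lambda>\<theta>. \<Sum>k<n. (g k \<theta>)\<^sup>2)" by (intro Bochner_Integration.integrable_sum ig)
    have [measurable]: "trig_sum n v \<in> borel_measurable circle" for v
      by (intro measurable_circle_borel borel_measurable_continuous_onI continuous_intros)
    show "(\<lambda>\<theta>. (cmod (of_real (f \<theta>) * trig_sum n (U i) \<theta> - trig_sum n (w i) \<theta>))\<^sup>2) \<in> borel_measurable circle"
      by measurable
    show "AE \<theta> in circle. norm ((cmod (of_real (f \<theta>) * trig_sum n (U i) \<theta> - trig_sum n (w i) \<theta>))\<^sup>2)
        \<le> norm (\<Sum>k<n. (g k \<theta>)\<^sup>2)"
    proof (rule AE_I2)
      fix \<theta>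
      have "(cmod (of_real (f \<theta>) * trig_sum n (U i) \<theta> - trig_sum n (w i) \<theta>))\<^sup>2 \<le> (\<Sum>k<n. (g k \<theta>)\<^sup>2)"
        unfolding fam[symmetric] using i by (intro member_le_sum) auto
      thus "norm ((cmod (of_real (f \<theta>) * trig_sum n (U i) \<theta> - trig_sum n (w i) \<theta>))\<^sup>2)
        \<le> norm (\<Sum>k<n. (g k \<theta>)\<^sup>2)" by simp
    qed
  qed
  have "(\<Sum>i<n. \<integral>\<theta>. (f \<theta> - a i)\<^sup>2 * (cmod (trig_sum n (U i) \<theta>))\<^sup>2 \<partial>circle)
      \<le> (\<Sum>i<n. \<integral>\<theta>. (cmod (of_real (f \<theta>) * trig_sum n (U i) \<theta> - trig_sum n (w i) \<theta>))\<^sup>2 \<partial>circle)"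
    using ep by (intro sum_mono residual_minimal) auto
  also have "\<dots> = (\<Sum>k<n. \<integral>\<theta>. (g k \<theta>)\<^sup>2 \<partial>circle)"
    using fam by (subst (1 2) Bochner_Integration.integral_sum[symmetric]) (auto simp: int ig)
  also have "\<dots> = (\<Sum>k\<in>K. \<integral>\<theta>. (g k \<theta>)\<^sup>2 \<partial>circle) + (\<Sum>k\<in>{..<n} - K. \<integral>\<theta>. (g k \<theta>)\<^sup>2 \<partial>circle)"
    using K by (subst sum.subset_diff[of K]) auto
  also have "\<dots> = real (card K) * (\<integral>\<theta>. (f \<theta> - q \<theta>)\<^sup>2 \<partial>circle) + real (card ({..<n} - K)) * (\<integral>\<theta>. (f \<theta>)\<^sup>2 \<partial>circle)"
    by (simp add: g_def)
  also have "\<dots> \<le> real n * (\<integral>\<theta>. (f \<theta> - q \<theta>)\<^sup>2 \<partial>circle) + (2 * real d) * (\<integral>\<theta>. (f \<theta>)\<^sup>2 \<partial>circle)"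
  proof (intro add_mono mult_right_mono)
    show "real (card K) \<le> real n" using card_mono[OF _ K(1)] by simp
    have "{..<n} - K \<subseteq> {..<d} \<union> {n - d..<n}" by (auto simp: K_def)
    hence "card ({..<n} - K) \<le> card ({..<d} \<union> {n - d..<n})" by (intro card_mono) auto
    also have "\<dots> \<le> card {..<d} + card {n - d..<n}" by (rule card_Un_le)
    also have "\<dots> \<le> 2 * d" by simp
    finally have "real (card ({..<n} - K)) \<le> real (2 * d)" by (simp only: of_nat_le_iff)
    thus "real (card ({..<n} - K)) \<le> 2 * real d" by simp
  qed (auto)
  finally show ?thesis by (simp add: q_def)
qed
text \<open>Reversal of coordinates multiplies the vector by its sign, so the sign can be moved into
  the index of one factor; completeness then retains only the pairs with
  \<open>l = n - 1 - k\<close>.\<close>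

lemma signed_kernel:
  assumes es: "eigensystem n U a s"
  shows "of_real (\<Sum>i<n. s i * (cmod (trig_sum n (U i) \<theta>))\<^sup>2) = dirichlet n \<theta>"
proof -
  have U: "orthonormal_family n U" and flip: "\<And>i k. i < n \<Longrightarrow> k < n \<Longrightarrow> U i (n - 1 - k) = of_real (s i) * U i k"
    using es by (auto simp: eigensystem_def)
  define e where "e k = cis (real k * \<theta>)" for k
  have "of_real (\<Sum>i<n. s i * (cmod (trig_sum n (U i) \<theta>))\<^sup>2)
      = (\<Sum>i<n. trig_sum n (U i) \<theta> * cnj (of_real (s i) * trig_sum n (U i) \<theta>))"
    by (simp add: complex_norm_square mult_ac del: of_real_power)
  also have "\<dots> = (\<Sum>i<n. (\<Sum>k<n. U i k * e k) * cnj (\<Sum>l<n. U i (n - 1 - l) * e l))"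
  proof (intro sum.cong refl)
    fix i assume "i \<in> {..<n}"
    hence i: "i < n" by simp
    have "of_real (s i) * trig_sum n (U i) \<theta> = (\<Sum>l<n. U i (n - 1 - l) * e l)"
      unfolding trig_sum_def sum_distrib_left e_def by (intro sum.cong refl) (simp only: flip[OF i] lessThan_iff mult.assoc)
    thus "trig_sum n (U i) \<theta> * cnj (of_real (s i) * trig_sum n (U i) \<theta>)
        = (\<Sum>k<n. U i k * e k) * cnj (\<Sum>l<n. U i (n - 1 - l) * e l)"
      by (simp only: trig_sum_def e_def)
  qed
  also have "\<dots> = (\<Sum>i<n. \<Sum>k<n. \<Sum>l<n. e k * cnj (e l) * (U i k * cnj (U i (n - 1 - l))))"
    unfolding cnj_sum sum_product by (simp add: mult_ac)
  also have "\<dots> = (\<Sum>k<n. \<Sum>l<n. \<Sum>i<n. e k * cnj (e l) * (U i k * cnj (U i (n - 1 - l))))"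
    by (rule sum_rotate)
  also have "\<dots> = (\<Sum>k<n. \<Sum>l<n. if l = n - 1 - k then e k * cnj (e (n - 1 - k)) else 0)"
    by (intro sum.cong refl) (auto simp: sum_distrib_left[symmetric] orthonormal_family_rows[OF U])
  also have "\<dots> = dirichlet n \<theta>"
    unfolding dirichlet_def e_def by (intro sum.cong refl) (simp add: sum.delta)
  finally show ?thesis .
qed

text \<open>Cauchy-Schwarz against the mean square \<open>2 * pi * n\<close>, carried out pointwise
  as an arithmetic-geometric mean with \<open>sqrt n\<close>.\<close>

lemma integral_dirichlet_abs: "(\<integral>\<theta>. cmod (dirichlet n \<theta>) \<partial>circle) \<le> 2 * pi * sqrt (real n)"
proof (cases "n = 0")
  case True
  thus ?thesis by (simp add: dirichlet_def)
next
  case False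
  hence r: "sqrt (real n) > 0" by simp
  have i2: "integrable circle (\<lambda>\<theta>. (cmod (dirichlet n \<theta>))\<^sup>2)"
    by (intro integrable_circle_continuous continuous_intros continuous_dirichlet)
  have "cmod (dirichlet n \<theta>) \<le> (sqrt (real n) + (cmod (dirichlet n \<theta>))\<^sup>2 / sqrt (real n)) / 2" for \<theta>
  proof -
    have "0 \<le> (cmod (dirichlet n \<theta>) - sqrt (real n))\<^sup>2" by simp
    hence "2 * cmod (dirichlet n \<theta>) * sqrt (real n) \<le> (cmod (dirichlet n \<theta>))\<^sup>2 + sqrt (real n) * sqrt (real n)"
      by (simp add: power2_eq_square algebra_simps)
    thus ?thesis using r by (simp add: field_simps)
  qed
  hence "(\<integral>\<theta>. cmod (dirichlet n \<theta>) \<partial>circle)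
      \<le> (\<integral>\<theta>. (sqrt (real n) + (cmod (dirichlet n \<theta>))\<^sup>2 / sqrt (real n)) / 2 \<partial>circle)"
    using i2 by (intro integral_mono' integrable_divide Bochner_Integration.integrable_add) auto
  also have "\<dots> = (2 * pi * sqrt (real n) + 2 * pi * real n / sqrt (real n)) / 2"
    using i2 by (simp add: integral_dirichlet_norm measure_circle)
  also have "\<dots> = 2 * pi * sqrt (real n)" using r by (simp add: field_simps)
  finally show ?thesis .
qed

text \<open>Two errors add up. Replacing \<open>2 * pi * G (a i)\<close> by the integral of
  \<open>G (f \<theta>)\<close> against the weight of eigenvector \<open>i\<close> costs the
  residual terms; replacing the summed weights of the class by \<open>n / 2\<close> costs a
  Dirichlet kernel. The free \<delta> trades the deviation of \<open>f\<close> from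
  \<open>a i\<close> against its square.\<close>

lemma mean_estimate:
  fixes G :: "real \<Rightarrow> real"
  assumes es: "eigensystem n U a s" and \<sigma>: "\<sigma> = 1 \<or> \<sigma> = - 1"
    and lip: "\<And>x y. \<bar>G x - G y\<bar> \<le> L * \<bar>x - y\<bar>" and L: "L \<ge> 0" and \<delta>: "\<delta> > 0"
    and C: "\<And>\<theta>. \<theta> \<in> {-pi..pi} \<Longrightarrow> \<bar>G (f \<theta>)\<bar> \<le> C"
  shows "\<bar>2 * pi * (\<Sum>i | i < n \<and> s i = \<sigma>. G (a i)) - real n / 2 * (\<integral>\<theta>. G (f \<theta>) \<partial>circle)\<bar>
    \<le> L * (pi * \<delta> * real n + (\<Sum>i<n. \<integral>\<theta>. (f \<theta> - a i)\<^sup>2 * (cmod (trig_sum n (U i) \<theta>))\<^sup>2 \<partial>circle) / (2 * \<delta>))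
      + pi * C * sqrt (real n)"
proof -
  define W where "W i \<theta> = (cmod (trig_sum n (U i) \<theta>))\<^sup>2" for i \<theta>
  define I where "I = {i. i < n \<and> s i = \<sigma>}"
  have I: "I \<subseteq> {..<n}" "finite I" by (auto simp: I_def intro: finite_subset[of _ "{..<n}"])
  have s: "\<And>i. i < n \<Longrightarrow> s i = 1 \<or> s i = - 1" and U: "orthonormal_family n U"
    and ep: "\<And>i. i < n \<Longrightarrow> eigenpair n (U i) (a i)" using es by (auto simp: eigensystem_def)
  have W_cont: "continuous_on UNIV (W i)" for i unfolding W_def by (intro continuous_intros)
  have W_nonneg: "W i \<theta> \<ge> 0" for i \<theta> by (simp add: W_def)
  have W_total: "(\<integral>\<theta>. W i \<theta> \<partial>circle) = 2 * pi" if "i < n" for i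
    using ep[OF that] by (simp add: W_def integral_trig_sum_norm eigenpair_def)
  have "L-lipschitz_on UNIV G" using lip L by (auto simp: lipschitz_on_def dist_real_def)
  hence G_cont: "continuous_on UNIV G" by (rule lipschitz_on_continuous_on)
  have iG: "integrable circle (\<lambda>\<theta>. G (f \<theta>) * h \<theta>)" if "continuous_on UNIV h" for h :: "real \<Rightarrow> real"
    using integrable_symbol_times[OF G_cont that] by simp
  have iG1: "integrable circle (\<lambda>\<theta>. G (f \<theta>))" using iG[of "\<lambda>_. 1"] by simp
  have W_sum: "(\<Sum>i<n. W i \<theta>) = real n" for \<theta>
    using trig_sum_family_norm[OF U, of "\<lambda>_. 1" \<theta>] by (simp add: W_def)
  \<comment> \<open>The indicator of \<open>s i = \<sigma>\<close> is
    \<open>(1 + \<sigma> * s i) / 2\<close>.\<close>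
  have half: "(\<Sum>i\<in>I. W i \<theta>) = (real n + \<sigma> * (\<Sum>i<n. s i * W i \<theta>)) / 2" for \<theta>
  proof -
    have "(\<Sum>i\<in>I. W i \<theta>) = (\<Sum>i<n. if i \<in> I then W i \<theta> else 0)"
      using I by (simp add: sum.inter_restrict[symmetric] Int_absorb1)
    also have "\<dots> = (\<Sum>i<n. (W i \<theta> + \<sigma> * (s i * W i \<theta>)) / 2)"
      using s \<sigma> by (intro sum.cong refl) (force simp: I_def)
    finally show ?thesis
      by (simp add: sum.distrib sum_divide_distrib[symmetric] sum_distrib_left[symmetric] W_sum)
  qed
  define D where "D \<theta> = (\<Sum>i<n. s i * W i \<theta>)" for \<theta>
  have absD: "\<bar>D \<theta>\<bar> = cmod (dirichlet n \<theta>)" for \<theta>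
    unfolding D_def W_def signed_kernel[OF es, symmetric] norm_of_real ..
  have D_cont: "continuous_on UNIV D" unfolding D_def by (intro continuous_intros W_cont)
  have "(\<Sum>i\<in>I. \<integral>\<theta>. G (f \<theta>) * W i \<theta> \<partial>circle) = (\<integral>\<theta>. G (f \<theta>) * (\<Sum>i\<in>I. W i \<theta>) \<partial>circle)"
    unfolding sum_distrib_left
    by (rule Bochner_Integration.integral_sum[symmetric]) (intro iG W_cont)
  also have "\<dots> = (\<integral>\<theta>. real n / 2 * G (f \<theta>) + \<sigma> / 2 * (G (f \<theta>) * D \<theta>) \<partial>circle)"
    by (intro Bochner_Integration.integral_cong refl) (simp add: half D_def field_simps)
  also have "\<dots> = real n / 2 * (\<integral>\<theta>. G (f \<theta>) \<partial>circle) + \<sigma> / 2 * (\<integral>\<theta>. G (f \<theta>) * D \<theta> \<partial>circle)"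
    using iG1 iG[OF D_cont] by simp
  finally have eq: "(\<Sum>i\<in>I. \<integral>\<theta>. G (f \<theta>) * W i \<theta> \<partial>circle) - real n / 2 * (\<integral>\<theta>. G (f \<theta>) \<partial>circle)
      = \<sigma> / 2 * (\<integral>\<theta>. G (f \<theta>) * D \<theta> \<partial>circle)" by simp
  have "\<bar>\<integral>\<theta>. G (f \<theta>) * D \<theta> \<partial>circle\<bar> \<le> (\<integral>\<theta>. \<bar>G (f \<theta>) * D \<theta>\<bar> \<partial>circle)"
    by (rule integral_abs_bound)
  also have "\<dots> \<le> (\<integral>\<theta>. C * \<bar>D \<theta>\<bar> \<partial>circle)"
  proof (rule integral_mono)
    show "integrable circle (\<lambda>\<theta>. \<bar>G (f \<theta>) * D \<theta>\<bar>)" by (intro integrable_abs iG D_cont)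
    show "integrable circle (\<lambda>\<theta>. C * \<bar>D \<theta>\<bar>)"
      by (intro integrable_circle_continuous continuous_intros D_cont)
    show "\<bar>G (f \<theta>) * D \<theta>\<bar> \<le> C * \<bar>D \<theta>\<bar>" if "\<theta> \<in> space circle" for \<theta>
      using C[of \<theta>] that by (simp add: abs_mult mult_right_mono)
  qed
  also have "\<dots> = C * (\<integral>\<theta>. cmod (dirichlet n \<theta>) \<partial>circle)" by (simp add: absD)
  also have "\<dots> \<le> C * (2 * pi * sqrt (real n))"
  proof (rule mult_left_mono[OF integral_dirichlet_abs])
    show "0 \<le> C" using order_trans[OF abs_ge_zero C[of 0]] by simp
  qed
  finally have kernel: "\<bar>(\<Sum>i\<in>I. \<integral>\<theta>. G (f \<theta>) * W i \<theta> \<partial>circle) - real n / 2 * (\<integral>\<theta>. G (f \<theta>) \<partial>circle)\<bar>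
      \<le> pi * C * sqrt (real n)"
    unfolding eq using \<sigma> by (auto simp: abs_mult mult_ac)
  have iR: "integrable circle (\<lambda>\<theta>. (f \<theta> - a i)\<^sup>2 * W i \<theta>)" for i
    using integrable_symbol_times[of "\<lambda>x. (x - a i)\<^sup>2" "W i"] W_cont by (simp add: continuous_intros)
  have iW: "integrable circle (W i)" for i by (intro integrable_circle_continuous W_cont)
  have single: "\<bar>2 * pi * G (a i) - (\<integral>\<theta>. G (f \<theta>) * W i \<theta> \<partial>circle)\<bar>
      \<le> L * (pi * \<delta> + (\<integral>\<theta>. (f \<theta> - a i)\<^sup>2 * W i \<theta> \<partial>circle) / (2 * \<delta>))" if i: "i < n" for i
  proof -
    have "2 * pi * G (a i) - (\<integral>\<theta>. G (f \<theta>) * W i \<theta> \<partial>circle)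
        = (\<integral>\<theta>. G (a i) * W i \<theta> - G (f \<theta>) * W i \<theta> \<partial>circle)"
      using iW iG[OF W_cont] by (simp add: W_total[OF i])
    also have "\<bar>\<dots>\<bar> \<le> (\<integral>\<theta>. \<bar>G (a i) * W i \<theta> - G (f \<theta>) * W i \<theta>\<bar> \<partial>circle)" by (rule integral_abs_bound)
    also have "\<dots> \<le> (\<integral>\<theta>. L * (\<delta> / 2 * W i \<theta> + (f \<theta> - a i)\<^sup>2 * W i \<theta> / (2 * \<delta>)) \<partial>circle)"
    proof (rule integral_mono)
      show "integrable circle (\<lambda>\<theta>. \<bar>G (a i) * W i \<theta> - G (f \<theta>) * W i \<theta>\<bar>)"
        using iW iG[OF W_cont] by (intro integrable_abs Bochner_Integration.integrable_diff) auto
      show "integrable circle (\<lambda>\<theta>. L * (\<delta> / 2 * W i \<theta> + (f \<theta> - a i)\<^sup>2 * W i \<theta> / (2 * \<delta>)))"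
        using iW iR by auto
      fix \<theta>
      have "0 \<le> (\<bar>f \<theta> - a i\<bar> - \<delta>)\<^sup>2" by simp
      hence "2 * \<bar>f \<theta> - a i\<bar> * \<delta> \<le> \<delta> * \<delta> + (f \<theta> - a i)\<^sup>2"
        by (simp add: power2_diff power2_eq_square[of \<delta>])
      hence "\<bar>f \<theta> - a i\<bar> \<le> \<delta> / 2 + (f \<theta> - a i)\<^sup>2 / (2 * \<delta>)" using \<delta> by (simp add: field_simps)
      hence "L * \<bar>a i - f \<theta>\<bar> \<le> L * (\<delta> / 2 + (f \<theta> - a i)\<^sup>2 / (2 * \<delta>))"
        using L by (intro mult_left_mono) (simp_all add: abs_minus_commute)
      hence "\<bar>G (a i) - G (f \<theta>)\<bar> \<le> L * (\<delta> / 2 + (f \<theta> - a i)\<^sup>2 / (2 * \<delta>))"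
        using lip[of "a i" "f \<theta>"] by linarith
      hence "\<bar>G (a i) - G (f \<theta>)\<bar> * W i \<theta> \<le> L * (\<delta> / 2 + (f \<theta> - a i)\<^sup>2 / (2 * \<delta>)) * W i \<theta>"
        by (intro mult_right_mono W_nonneg)
      moreover have "\<bar>G (a i) * W i \<theta> - G (f \<theta>) * W i \<theta>\<bar> = \<bar>G (a i) - G (f \<theta>)\<bar> * W i \<theta>"
        using W_nonneg[of i \<theta>] by (metis abs_mult abs_of_nonneg left_diff_distrib)
      ultimately show "\<bar>G (a i) * W i \<theta> - G (f \<theta>) * W i \<theta>\<bar>
          \<le> L * (\<delta> / 2 * W i \<theta> + (f \<theta> - a i)\<^sup>2 * W i \<theta> / (2 * \<delta>))"
        by (simp add: algebra_simps)
    qed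
    also have "\<dots> = L * (pi * \<delta> + (\<integral>\<theta>. (f \<theta> - a i)\<^sup>2 * W i \<theta> \<partial>circle) / (2 * \<delta>))"
      using iW iR by (simp add: W_total[OF i])
    finally show ?thesis .
  qed
  have "\<bar>2 * pi * (\<Sum>i\<in>I. G (a i)) - (\<Sum>i\<in>I. \<integral>\<theta>. G (f \<theta>) * W i \<theta> \<partial>circle)\<bar>
      \<le> (\<Sum>i\<in>I. \<bar>2 * pi * G (a i) - (\<integral>\<theta>. G (f \<theta>) * W i \<theta> \<partial>circle)\<bar>)"
    unfolding sum_distrib_left sum_subtractf[symmetric] by (rule sum_abs)
  also have "\<dots> \<le> (\<Sum>i<n. \<bar>2 * pi * G (a i) - (\<integral>\<theta>. G (f \<theta>) * W i \<theta> \<partial>circle)\<bar>)"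
    using I by (intro sum_mono2) auto
  also have "\<dots> \<le> (\<Sum>i<n. L * (pi * \<delta> + (\<integral>\<theta>. (f \<theta> - a i)\<^sup>2 * W i \<theta> \<partial>circle) / (2 * \<delta>)))"
    by (intro sum_mono single) simp
  also have "\<dots> = L * (pi * \<delta> * real n + (\<Sum>i<n. \<integral>\<theta>. (f \<theta> - a i)\<^sup>2 * W i \<theta> \<partial>circle) / (2 * \<delta>))"
    unfolding sum_distrib_left[symmetric] sum.distrib sum_divide_distrib[symmetric] by (simp add: mult_ac)
  finally show ?thesis using kernel unfolding I_def[symmetric] W_def[symmetric] by linarith
qed

text \<open>The limit carries \<open>4 * pi\<close> because a class has about half of the total
  weight and the circle has mass \<open>2 * pi\<close>. With the polynomial fixed, its boundary
  terms and the Dirichlet kernel vanish relative to \<open>n\<close>.\<close>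

lemma eigenvalue_means:
  fixes G :: "real \<Rightarrow> real"
  assumes es: "\<And>n. n \<ge> 1 \<Longrightarrow> eigensystem n (U n) (a n) (s n)" and \<sigma>: "\<sigma> = 1 \<or> \<sigma> = - 1"
    and lip: "\<And>x y. \<bar>G x - G y\<bar> \<le> L * \<bar>x - y\<bar>"
  shows "(\<lambda>n. (\<Sum>i | i < n \<and> s n i = \<sigma>. G (a n i)) / real n) \<longlonglongrightarrow> (\<integral>\<theta>. G (f \<theta>) \<partial>circle) / (4 * pi)"
proof (rule LIMSEQ_I)
  fix \<epsilon> :: real assume \<epsilon>: "\<epsilon> > 0"
  have L: "L \<ge> 0" using lip[of 1 0] abs_ge_zero[of "G 1 - G 0"] by simp
  have "L-lipschitz_on UNIV G" using lip L by (auto simp: lipschitz_on_def dist_real_def)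
  hence "continuous_on UNIV G" by (rule lipschitz_on_continuous_on)
  obtain B where B: "\<And>\<theta>. \<theta> \<in> {-pi..pi} \<Longrightarrow> \<bar>f \<theta>\<bar> \<le> B"
    using bounded_imageE[OF bounded] unfolding real_norm_def by blast
  define C where "C = \<bar>G 0\<bar> + L * B"
  have C: "\<bar>G (f \<theta>)\<bar> \<le> C" if "\<theta> \<in> {-pi..pi}" for \<theta>
  proof -
    have "\<bar>G (f \<theta>) - G 0\<bar> \<le> L * \<bar>f \<theta>\<bar>" using lip[of "f \<theta>" 0] by simp
    also have "\<dots> \<le> L * B" using B[OF that] L by (rule mult_left_mono)
    finally show ?thesis unfolding C_def by linarith
  qed
  \<comment> \<open>Chosen for the final bound \<open>(5 * L + 1) * \<delta>\<close>: 5 exceeds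
    \<open>pi + 1 / 2\<close>, and the last \<delta> absorbs the terms that vanish as
    \<open>n\<close> grows.\<close>
  define \<delta> where "\<delta> = \<epsilon> / (5 * L + 1)"
  have \<delta>: "\<delta> > 0" "(5 * L + 1) * \<delta> = \<epsilon>" using L \<epsilon> by (auto simp: \<delta>_def)
  define E where "E = (\<integral>\<theta>. (f \<theta>)\<^sup>2 \<partial>circle)"
  \<comment> \<open>A mean square below \<open>\<delta>\<^sup>2\<close> is required because
    \<open>mean_estimate\<close> divides the residuals by \<open>2 * \<delta>\<close>.\<close>
  obtain d c where dc: "(\<integral>\<theta>. (f \<theta> - (\<Sum>i\<le>d. c i * cos \<theta> ^ i))\<^sup>2 \<partial>circle) < \<delta>\<^sup>2"
    using cosine_approximation[OF zero_less_power[OF \<delta>(1)], of 2] by blast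
  have "(\<lambda>n. L * real d * E / \<delta> / real n + pi * C / sqrt (real n)) \<longlonglongrightarrow> 0"
    by real_asymp
  from order_tendstoD(2)[OF this \<delta>(1)] obtain N where N: "\<And>n. n \<ge> N \<Longrightarrow>
      L * real d * E / \<delta> / real n + pi * C / sqrt (real n) < \<delta>"
    by (auto simp: eventually_sequentially)
  show "\<exists>N. \<forall>n\<ge>N. norm ((\<Sum>i | i < n \<and> s n i = \<sigma>. G (a n i)) / real n - (\<integral>\<theta>. G (f \<theta>) \<partial>circle) / (4 * pi)) < \<epsilon>"
  proof (intro exI allI impI)
    fix n assume n: "n \<ge> max N 1"
    hence n1: "n \<ge> 1" "real n > 0" by auto
    define S where "S = (\<Sum>i | i < n \<and> s n i = \<sigma>. G (a n i))"
    define J where "J = (\<integral>\<theta>. G (f \<theta>) \<partial>circle)"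
    define R where "R = (\<Sum>i<n. \<integral>\<theta>. (f \<theta> - a n i)\<^sup>2 * (cmod (trig_sum n (U n i) \<theta>))\<^sup>2 \<partial>circle)"
    have "R \<le> real n * \<delta>\<^sup>2 + 2 * real d * E"
      using residual_sum[OF es[OF n1(1)], of c d] mult_left_mono[OF less_imp_le[OF dc], of "real n"]
      unfolding R_def E_def by simp
    hence "R / (2 * \<delta>) \<le> (real n * \<delta>\<^sup>2 + 2 * real d * E) / (2 * \<delta>)"
      using \<delta>(1) by (intro divide_right_mono) auto
    also have "\<dots> = real n * (\<delta> / 2) + real d * E / \<delta>"
      using \<delta>(1) by (simp add: field_simps power2_eq_square)
    finally have R: "L * (pi * \<delta> * real n + R / (2 * \<delta>)) \<le> L * (pi * \<delta> * real n + (real n * (\<delta> / 2) + real d * E / \<delta>))"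
      using L by (intro mult_left_mono add_left_mono)
    have "\<bar>2 * pi * S - real n / 2 * J\<bar> \<le> L * (pi * \<delta> * real n + R / (2 * \<delta>)) + pi * C * sqrt (real n)"
      unfolding S_def J_def R_def by (rule mean_estimate[OF es[OF n1(1)] \<sigma> lip L \<delta>(1) C])
    hence "\<bar>2 * pi * S - real n / 2 * J\<bar> \<le>
        L * (pi * \<delta> * real n + (real n * (\<delta> / 2) + real d * E / \<delta>)) + pi * C * sqrt (real n)"
      using R by linarith
    also have "\<dots> = real n * (L * (pi + 1 / 2) * \<delta> + (L * real d * E / \<delta> / real n + pi * C / sqrt (real n)))"
      using n1 by (simp add: field_simps real_div_sqrt)
    also have "\<dots> < real n * (L * 5 * \<delta> + \<delta>)"
    proof (rule mult_strict_left_mono[OF _ n1(2)])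
      have "L * (pi + 1 / 2) * \<delta> \<le> L * 5 * \<delta>"
        using L \<delta>(1) pi_less_4 by (intro mult_right_mono mult_left_mono) auto
      thus "L * (pi + 1 / 2) * \<delta> + (L * real d * E / \<delta> / real n + pi * C / sqrt (real n)) < L * 5 * \<delta> + \<delta>"
        using N[of n] n by simp
    qed
    also have "L * 5 * \<delta> + \<delta> = \<epsilon>" using \<delta>(2) by (simp add: algebra_simps)
    finally have main: "\<bar>2 * pi * S - real n / 2 * J\<bar> < real n * \<epsilon>" .
    have "S / real n - J / (4 * pi) = (2 * pi * S - real n / 2 * J) / (2 * pi * real n)"
      using n1 by (simp add: field_simps)
    hence "\<bar>S / real n - J / (4 * pi)\<bar> = \<bar>2 * pi * S - real n / 2 * J\<bar> / (2 * pi * real n)"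
      using n1 by (simp add: abs_mult)
    also have "\<dots> < real n * \<epsilon> / (2 * pi * real n)"
      using main n1 by (intro divide_strict_right_mono) auto
    also have "\<dots> = \<epsilon> / (2 * pi)" using n1 by simp
    also have "\<dots> \<le> \<epsilon>" using \<epsilon> pi_gt3 by (simp add: field_simps)
    finally show "norm ((\<Sum>i | i < n \<and> s n i = \<sigma>. G (a n i)) / real n - (\<integral>\<theta>. G (f \<theta>) \<partial>circle) / (4 * pi)) < \<epsilon>"
      unfolding S_def J_def by simp
  qed
qed

end

section \<open>Equidistribution of the eigenvalues\<close>

locale level_symbol = even_symbol +
  assumes levels: "\<And>t. finite {x \<in> {-pi..pi}. f x = t}"
begin

definition level_measure :: "real set \<Rightarrow> real" where
  "level_measure B = measure circle {\<theta> \<in> {-pi..pi}. f \<theta> \<in> B}"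

lemma finite_frontier_borel:
  fixes B :: "real set"
  assumes "finite (frontier B)" shows "B \<in> sets borel"
proof -
  have "B = interior B \<union> (B \<inter> frontier B)"
    using interior_subset closure_subset by (auto simp: frontier_def)
  moreover have "B \<inter> frontier B \<in> sets borel" using assms by (intro borel_closed finite_imp_closed) auto
  ultimately show ?thesis by (metis borel_open open_interior sets.Un)
qed

lemma level_set_measurable:
  assumes "B \<in> sets borel" shows "{\<theta> \<in> {-pi..pi}. f \<theta> \<in> B} \<in> sets circle"
  using measurable_sets[OF measurable_symbol assms] by (simp add: vimage_def Int_def conj_commute)

text \<open>The closure adds frontier points only, finitely many, and each is attained at finitely
  many \<theta>: the image measure has no atoms.\<close>

lemma level_measure_closure:
  assumes "finite (frontier B)"
  shows "level_measure (closure B) = level_measure B"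
  unfolding level_measure_def
proof (rule measure_eq_AE)
  have "finite (\<Union>t\<in>frontier B. {x \<in> {-pi..pi}. f x = t})" using assms levels by blast
  hence "AE \<theta> in circle. \<theta> \<notin> (\<Union>t\<in>frontier B. {x \<in> {-pi..pi}. f x = t}) \<inter> {-pi..pi}"
    by (intro AE_not_in null_sets_circle_finite)
  thus "AE \<theta> in circle. \<theta> \<in> {\<theta> \<in> {-pi..pi}. f \<theta> \<in> closure B} \<longleftrightarrow> \<theta> \<in> {\<theta> \<in> {-pi..pi}. f \<theta> \<in> B}"
  proof eventually_elim
    case (elim \<theta>)
    thus ?case using closure_subset[of B] interior_subset[of B] by (auto simp: frontier_def)
  qed
qed (intro level_set_measurable finite_frontier_borel[OF assms] borel_closed closed_closure)+

text \<open>Weak convergence along the index sets \<open>I n\<close>. Lipschitz test functions are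
  what \<open>eigenvalue_means\<close> covers, and they still approximate indicators of closed sets
  from above.\<close>

definition equidistributed :: "(nat \<Rightarrow> nat set) \<Rightarrow> (nat \<Rightarrow> nat \<Rightarrow> real) \<Rightarrow> bool" where
  "equidistributed I a \<longleftrightarrow> (\<forall>n. finite (I n)) \<and> filterlim (\<lambda>n. card (I n)) at_top sequentially \<and>
     (\<forall>n. \<forall>i\<in>I n. a n i \<in> f ` {0..pi}) \<and>
     (\<forall>G L. (\<forall>x y. \<bar>G x - G y\<bar> \<le> L * \<bar>x - y\<bar>) \<longrightarrow>
       (\<lambda>n. (\<Sum>i\<in>I n. G (a n i)) / real (card (I n))) \<longlonglongrightarrow> (\<integral>\<theta>. G (f \<theta>) \<partial>circle) / (2 * pi))"

text \<open>Upper half of the portmanteau theorem: the indicator of the closure is bounded by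
  Lipschitz functions \<open>G k\<close> decreasing to it, and passing to the closure costs no
  measure.\<close>

lemma count_limsup:
  assumes eq: "equidistributed I a" and B: "finite (frontier B)" and \<epsilon>: "\<epsilon> > 0"
  shows "eventually (\<lambda>n. real (card {i \<in> I n. a n i \<in> B}) / real (card (I n)) < level_measure B / (2 * pi) + \<epsilon>) sequentially"
\<comment> \<open>Separate because \<open>infdist\<close> to the empty set is 0, so that
  \<open>G k\<close> would be 1 everywhere.\<close>
proof (cases "B = {}")
  case True
  thus ?thesis using \<epsilon> by (simp add: level_measure_def)
next
  case False
  hence ne: "closure B \<noteq> {}" by simp
  define G where "G k x = max 0 (1 - real k * infdist x (closure B))" for k x
  have G_cont: "continuous_on UNIV (G k)" for k unfolding G_def by (intro continuous_intros)
  have G01: "0 \<le> G k x" "G k x \<le> 1" for k x by (auto simp: G_def infdist_nonneg)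
  have G_B: "G k x = 1" if "x \<in> closure B" for k x using that by (simp add: G_def)
  have lip: "\<bar>G k x - G k y\<bar> \<le> real k * \<bar>x - y\<bar>" for k x y
  proof -
    have "\<bar>G k x - G k y\<bar> \<le> \<bar>real k * infdist x (closure B) - real k * infdist y (closure B)\<bar>"
      unfolding G_def by linarith
    also have "\<dots> = real k * \<bar>infdist x (closure B) - infdist y (closure B)\<bar>"
      by (simp add: abs_mult flip: right_diff_distrib)
    also have "\<dots> \<le> real k * \<bar>x - y\<bar>"
      using infdist_triangle_abs[of x "closure B" y] by (intro mult_left_mono) (auto simp: dist_real_def)
    finally show ?thesis .
  qed
  have B_meas: "{\<theta> \<in> {-pi..pi}. f \<theta> \<in> closure B} \<in> sets circle"
    by (intro level_set_measurable borel_closed closed_closure)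
  have "(\<lambda>k. \<integral>\<theta>. G k (f \<theta>) \<partial>circle) \<longlonglongrightarrow> (\<integral>\<theta>. indicator {\<theta> \<in> {-pi..pi}. f \<theta> \<in> closure B} \<theta> \<partial>circle)"
  proof (rule integral_dominated_convergence[where w = "\<lambda>_. 1"])
    show "AE \<theta> in circle. (\<lambda>k. G k (f \<theta>)) \<longlonglongrightarrow> indicator {\<theta> \<in> {-pi..pi}. f \<theta> \<in> closure B} \<theta>"
    proof (rule AE_I2)
      fix \<theta> assume t: "\<theta> \<in> space circle"
      show "(\<lambda>k. G k (f \<theta>)) \<longlonglongrightarrow> indicator {\<theta> \<in> {-pi..pi}. f \<theta> \<in> closure B} \<theta>"
      proof (cases "f \<theta> \<in> closure B")
        case True
        thus ?thesis using t G_B by simp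
      next
        case False
        hence pos: "infdist (f \<theta>) (closure B) > 0" using ne infdist_nonneg[of "f \<theta>" "closure B"]
          by (simp add: in_closed_iff_infdist_zero less_le)
        obtain k0 :: nat where k0: "1 / infdist (f \<theta>) (closure B) < real k0" using reals_Archimedean2 by blast
        have "G k (f \<theta>) = 0" if "k \<ge> k0" for k
        proof -
          have "1 / infdist (f \<theta>) (closure B) < real k" using k0 that by (meson less_le_trans of_nat_le_iff)
          thus ?thesis using pos by (simp add: G_def field_simps)
        qed
        hence "eventually (\<lambda>k. G k (f \<theta>) = 0) sequentially"
          unfolding eventually_sequentially by (intro exI[of _ k0]) simp
        thus ?thesis using False by (simp add: tendsto_eventually)
      qed
    qed
    show "(\<lambda>\<theta>. G k (f \<theta>)) \<in> borel_measurable circle" for k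
      by (rule borel_measurable_continuous_on[OF G_cont measurable_symbol])
    show "AE \<theta> in circle. norm (G k (f \<theta>)) \<le> 1" for k using G01 by (intro AE_I2) simp
  qed (use B_meas in auto)
  also have "(\<integral>\<theta>. indicator {\<theta> \<in> {-pi..pi}. f \<theta> \<in> closure B} \<theta> \<partial>circle) = level_measure B"
    using B_meas unfolding level_measure_closure[OF B, symmetric] unfolding level_measure_def
    by (simp, intro arg_cong[where f = "measure circle"]) auto
  finally have "(\<lambda>k. (\<integral>\<theta>. G k (f \<theta>) \<partial>circle) / (2 * pi)) \<longlonglongrightarrow> level_measure B / (2 * pi)"
    by (intro tendsto_divide) auto
  from order_tendstoD(2)[OF this, of "level_measure B / (2 * pi) + \<epsilon>"] \<epsilon> obtain k where
    k: "(\<integral>\<theta>. G k (f \<theta>) \<partial>circle) / (2 * pi) < level_measure B / (2 * pi) + \<epsilon>"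
    by (auto simp: eventually_sequentially)
  have "(\<lambda>n. (\<Sum>i\<in>I n. G k (a n i)) / real (card (I n))) \<longlonglongrightarrow> (\<integral>\<theta>. G k (f \<theta>) \<partial>circle) / (2 * pi)"
    using eq lip unfolding equidistributed_def by blast
  from order_tendstoD(2)[OF this k] show ?thesis
  proof eventually_elim
    case (elim n)
    have fin: "finite (I n)" using eq by (simp add: equidistributed_def)
    have "real (card {i \<in> I n. a n i \<in> B}) = (\<Sum>i\<in>I n. if a n i \<in> B then 1 else 0)"
      using fin by (simp add: sum.If_cases Int_def)
    also have "\<dots> \<le> (\<Sum>i\<in>I n. G k (a n i))"
      using G01 G_B closure_subset[of B] by (intro sum_mono) auto
    finally have "real (card {i \<in> I n. a n i \<in> B}) / real (card (I n)) \<le> (\<Sum>i\<in>I n. G k (a n i)) / real (card (I n))"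
      by (intro divide_right_mono) auto
    thus ?case using elim by linarith
  qed
qed

text \<open>The lower bound is \<open>count_limsup\<close> for the complement, which has the same
  frontier.\<close>

lemma count_limit:
  assumes eq: "equidistributed I a" and B: "finite (frontier B)"
  shows "(\<lambda>n. real (card {i \<in> I n. a n i \<in> B}) / real (card (I n))) \<longlonglongrightarrow> level_measure B / (2 * pi)"
proof (rule order_tendstoI)
  let ?c = "\<lambda>B n. real (card {i \<in> I n. a n i \<in> B}) / real (card (I n))"
  show "eventually (\<lambda>n. ?c B n < u) sequentially" if "level_measure B / (2 * pi) < u" for u
    using count_limsup[OF eq B, of "u - level_measure B / (2 * pi)"] that by simp
  have compl: "level_measure (- B) = 2 * pi - level_measure B"
  proof -
    have "{\<theta> \<in> {-pi..pi}. f \<theta> \<in> - B} = space circle - {\<theta> \<in> {-pi..pi}. f \<theta> \<in> B}" by auto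
    moreover have "measure circle (space circle) = 2 * pi" by (simp add: measure_circle)
    ultimately show ?thesis
      unfolding level_measure_def
      using circle.finite_measure_compl[OF level_set_measurable[OF finite_frontier_borel[OF B]]] by simp
  qed
  show "eventually (\<lambda>n. l < ?c B n) sequentially" if l: "l < level_measure B / (2 * pi)" for l
  proof -
    have fr: "finite (frontier (- B))" using B by (simp add: frontier_complement)
    have "eventually (\<lambda>n. card (I n) \<ge> 1) sequentially"
      using eq unfolding equidistributed_def filterlim_at_top by blast
    with count_limsup[OF eq fr, of "level_measure B / (2 * pi) - l"] l
    have "eventually (\<lambda>n. ?c (- B) n < level_measure (- B) / (2 * pi) + (level_measure B / (2 * pi) - l) \<and> card (I n) \<ge> 1) sequentially"
      by (simp add: eventually_conj)
    thus ?thesis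
    proof eventually_elim
      case (elim n)
      have fin: "finite (I n)" using eq by (simp add: equidistributed_def)
      have "{i \<in> I n. a n i \<in> - B} = I n - {i \<in> I n. a n i \<in> B}" by auto
      hence "real (card {i \<in> I n. a n i \<in> - B}) = real (card (I n)) - real (card {i \<in> I n. a n i \<in> B})"
        using fin by (simp add: card_Diff_subset card_mono of_nat_diff)
      hence "?c (- B) n = 1 - ?c B n" using elim by (simp add: field_simps)
      moreover have "level_measure (- B) / (2 * pi) = 1 - level_measure B / (2 * pi)"
        unfolding compl by (simp add: field_simps)
      ultimately show ?case using elim by linarith
    qed
  qed
qed

end

section \<open>Lifting eigenvalues to a uniform grid\<close>

text \<open>Greedy: label \<open>b\<close> takes the integer part of its quota, or everything if
  that is less; the last label takes the rest. Each step raises the gap between items and quotas by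
  at most 1, so the initial gap plus one per label bounds every error.\<close>

lemma quota_assignment:
  fixes p :: "'b \<Rightarrow> real"
  assumes "finite S" "S \<noteq> {}" "finite J" "\<And>b. b \<in> S \<Longrightarrow> p b \<ge> 0"
  shows "\<exists>\<kappa>. (\<forall>i\<in>J. \<kappa> i \<in> S) \<and>
    (\<forall>b\<in>S. \<bar>real (card {i \<in> J. \<kappa> i = b}) - p b\<bar> \<le> \<bar>real (card J) - sum p S\<bar> + real (card S))"
  using assms
proof (induction S arbitrary: J rule: finite_ne_induct)
  case (singleton b)
  have "{i \<in> J. b = b} = J" by auto
  thus ?case by (intro exI[of _ "\<lambda>_. b"]) auto
next
  case (insert b S)
  define k where "k = min (card J) (nat \<lfloor>p b\<rfloor>)"
  obtain K where K: "K \<subseteq> J" "card K = k"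
    using obtain_subset_with_card_n[of k J] unfolding k_def by (metis min.cobounded1)
  have fin: "finite K" "finite (J - K)"
    using finite_subset[OF K(1) insert.prems(1)] insert.prems(1) by simp_all
  have pb: "p b \<ge> 0" and pS: "sum p S \<ge> 0" using insert.prems by (auto intro: sum_nonneg)
  have cardJK: "real (card (J - K)) = real (card J) - real k"
    using K fin insert.prems by (simp add: card_Diff_subset card_mono of_nat_diff k_def)
  have errors: "\<bar>real k - p b\<bar> \<le> \<bar>real (card J) - (p b + sum p S)\<bar> + 1 \<and>
      \<bar>real (card J) - real k - sum p S\<bar> \<le> \<bar>real (card J) - (p b + sum p S)\<bar> + 1"
  proof (cases "nat \<lfloor>p b\<rfloor> \<le> card J")
    case True
    hence "real k \<le> p b" "p b < real k + 1" using pb by (auto simp: k_def)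
    thus ?thesis by linarith
  next
    \<comment> \<open>Too few items are left; the shortfall is already part of the gap.\<close>
    case False
    hence "k = card J" by (simp add: k_def)
    moreover have "real (card J) \<le> p b" using False pb by linarith
    ultimately show ?thesis using pS by auto
  qed
  obtain \<kappa> where \<kappa>: "\<And>i. i \<in> J - K \<Longrightarrow> \<kappa> i \<in> S"
    "\<And>c. c \<in> S \<Longrightarrow> \<bar>real (card {i \<in> J - K. \<kappa> i = c}) - p c\<bar> \<le> \<bar>real (card (J - K)) - sum p S\<bar> + real (card S)"
    using insert.IH[OF fin(2)] insert.prems by auto
  define \<kappa>' where "\<kappa>' i = (if i \<in> K then b else \<kappa> i)" for i
  have total: "sum p (insert b S) = p b + sum p S" "real (card (insert b S)) = real (card S) + 1"
    using insert.hyps by auto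
  show ?case
  proof (intro exI[of _ \<kappa>'] conjI ballI)
    show "\<kappa>' i \<in> insert b S" if "i \<in> J" for i using that \<kappa>(1) by (auto simp: \<kappa>'_def)
    fix c assume c: "c \<in> insert b S"
    show "\<bar>real (card {i \<in> J. \<kappa>' i = c}) - p c\<bar>
        \<le> \<bar>real (card J) - sum p (insert b S)\<bar> + real (card (insert b S))"
    proof (cases "c = b")
      case True
      have "{i \<in> J. \<kappa>' i = c} = K"
        using True K insert.hyps \<kappa>(1) by (auto simp: \<kappa>'_def)
      thus ?thesis unfolding total using errors K True by simp
    next
      case False
      hence "{i \<in> J. \<kappa>' i = c} = {i \<in> J - K. \<kappa> i = c}" by (auto simp: \<kappa>'_def)
      thus ?thesis unfolding total using errors \<kappa>(2)[of c] c False cardJK by auto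
    qed
  qed
qed

lemma sorted_enumeration:
  fixes x :: "nat \<Rightarrow> real"
  assumes "finite I"
  obtains \<tau> where "bij_betw \<tau> {1..card I} I"
    "\<And>i j. 1 \<le> i \<Longrightarrow> i \<le> j \<Longrightarrow> j \<le> card I \<Longrightarrow> x (\<tau> i) \<le> x (\<tau> j)"
proof -
  define xs where "xs = sort_key x (sorted_list_of_set I)"
  have xs: "distinct xs" "set xs = I" "sorted (map x xs)" using assms by (auto simp: xs_def)
  hence len: "length xs = card I" using distinct_card by fastforce
  have "bij_betw ((!) xs) {..<card I} I" using bij_betw_nth[OF xs(1)] len xs(2) by simp
  moreover have "bij_betw (\<lambda>i. i - 1) {1..card I} {..<card I}"
    by (rule bij_betw_byWitness[where f' = Suc]) auto
  ultimately have "bij_betw ((!) xs \<circ> (\<lambda>i. i - 1)) {1..card I} I" by (rule bij_betw_trans[rotated])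
  moreover have "x ((xs ! (i - 1))) \<le> x (xs ! (j - 1))" if "1 \<le> i" "i \<le> j" "j \<le> card I" for i j
    using sorted_nth_mono[OF xs(3), of "i - 1" "j - 1"] that len by auto
  ultimately show thesis by (intro that) auto
qed

text \<open>One choice must serve every \<epsilon> at once: take an error within
  \<open>1 / (n + 1)\<close> of its infimum over the admissible \<open>x\<close>; the infimum tends
  to 0.\<close>

lemma diagonal_choice:
  fixes err :: "nat \<Rightarrow> 'a \<Rightarrow> real"
  assumes ex: "\<And>n. \<exists>x. Q n x" and nonneg: "\<And>n x. err n x \<ge> 0"
    and small: "\<And>\<epsilon>. \<epsilon> > 0 \<Longrightarrow> eventually (\<lambda>n. \<exists>x. Q n x \<and> err n x < \<epsilon>) sequentially"
  obtains X where "\<And>n. Q n (X n)" "(\<lambda>n. err n (X n)) \<longlonglongrightarrow> 0"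
proof -
  define e where "e n = Inf (err n ` {x. Q n x})" for n
  have bdd: "bdd_below (err n ` {x. Q n x})" for n using nonneg by (auto intro!: bdd_belowI[of _ 0])
  have "\<exists>x. Q n x \<and> err n x < e n + 1 / (real n + 1)" for n
  proof -
    have "Inf (err n ` {x. Q n x}) < e n + 1 / (real n + 1)" by (simp add: e_def)
    from cInf_lessD[OF _ this] show ?thesis using ex[of n] by auto
  qed
  then obtain X where X: "\<And>n. Q n (X n)" "\<And>n. err n (X n) < e n + 1 / (real n + 1)" by metis
  have "(\<lambda>n. err n (X n)) \<longlonglongrightarrow> 0"
  proof (rule order_tendstoI)
    show "eventually (\<lambda>n. l < err n (X n)) sequentially" if "l < 0" for l
      using nonneg that by (intro always_eventually) (auto intro: less_le_trans)
    show "eventually (\<lambda>n. err n (X n) < u) sequentially" if u: "u > 0" for u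
    proof -
      have "(\<lambda>n. 1 / (real n + 1)) \<longlonglongrightarrow> 0" by real_asymp
      from order_tendstoD(2)[OF this, of "u / 2"] u
      have "eventually (\<lambda>n. 1 / (real n + 1) < u / 2) sequentially" by simp
      moreover have "eventually (\<lambda>n. \<exists>x. Q n x \<and> err n x < u / 2) sequentially" using u by (intro small) simp
      ultimately show ?thesis
      proof eventually_elim
        case (elim n)
        then obtain x where "Q n x" "err n x < u / 2" by blast
        hence "e n < u / 2" unfolding e_def using cInf_lower[OF _ bdd, of "err n x" n] by force
        thus ?case using X(2)[of n] elim by linarith
      qed
    qed
  qed
  with X(1) show thesis by (rule that)
qed

lemma finite_frontier_Int:
  assumes "finite (frontier A)" "finite (frontier B)" shows "finite (frontier (A \<inter> B))"
  by (rule finite_subset[OF frontier_Int_subset]) (use assms in simp)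

lemma finite_frontier_INT:
  assumes "finite K" "\<And>k. k \<in> K \<Longrightarrow> finite (frontier (A k))"
  shows "finite (frontier (\<Inter>k\<in>K. A k))"
  using assms by (induction K rule: finite_induct) (auto intro: finite_frontier_Int)

section \<open>Cells, patterns and their shares\<close>

context level_symbol
begin

text \<open>For \<open>N > 0\<close> this cuts \<open>[0, pi]\<close> into equal pieces, folded by
  the modulus because \<open>f\<close> is even. The endpoint \<open>pi\<close> is a cell of its own
  with index \<open>N\<close>, so indices run over \<open>{..N}\<close>.\<close>

definition cell :: "nat \<Rightarrow> real \<Rightarrow> nat" where
  "cell N \<theta> = nat \<lfloor>\<bar>\<theta>\<bar> * real N / pi\<rfloor>"

definition pattern :: "nat \<Rightarrow> real \<Rightarrow> nat set" where
  "pattern N t = {b. \<exists>\<theta>\<in>{0..pi}. cell N \<theta> = b \<and> f \<theta> = t}"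

lemma cell_less_iff: "cell N \<theta> < b \<longleftrightarrow> \<bar>\<theta>\<bar> * real N < real b * pi" if "N > 0"
proof -
  have "cell N \<theta> < b \<longleftrightarrow> \<bar>\<theta>\<bar> * real N / pi < real b"
  proof -
    have "\<lfloor>\<bar>\<theta>\<bar> * real N / pi\<rfloor> \<ge> 0" by simp
    hence "cell N \<theta> < b \<longleftrightarrow> \<lfloor>\<bar>\<theta>\<bar> * real N / pi\<rfloor> < int b" unfolding cell_def by linarith
    also have "\<dots> \<longleftrightarrow> \<bar>\<theta>\<bar> * real N / pi < of_int (int b)" by (rule floor_less_iff)
    finally show ?thesis by simp
  qed
  thus ?thesis by (simp add: pos_divide_less_eq)
qed

lemma cell_eq_iff:
  "cell N \<theta> = b \<longleftrightarrow> \<bar>\<theta>\<bar> * real N < real (Suc b) * pi \<and> \<not> \<bar>\<theta>\<bar> * real N < real b * pi" if "N > 0"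
  unfolding cell_less_iff[OF that, symmetric] by linarith

lemma cell_le: "cell N \<theta> \<le> N" if "N > 0" "\<theta> \<in> {-pi..pi}"
proof -
  have "\<bar>\<theta>\<bar> * real N \<le> pi * real N" using that by (intro mult_right_mono) auto
  also have "\<dots> < real (Suc N) * pi" by (simp add: algebra_simps)
  finally have "cell N \<theta> < Suc N" unfolding cell_less_iff[OF that(1)] .
  thus ?thesis by simp
qed

lemma pattern_subset: "pattern N t \<subseteq> {..N}" if "N > 0"
  using cell_le[OF that] by (fastforce simp: pattern_def)

lemma cell_in_pattern: "cell N \<theta> \<in> pattern N (f \<theta>)" if "\<theta> \<in> {-pi..pi}"
proof -
  have "f \<bar>\<theta>\<bar> = f \<theta>" using even[OF that] by (auto simp: abs_if)
  thus ?thesis using that unfolding pattern_def cell_def by (auto intro!: bexI[of _ "\<bar>\<theta>\<bar>"])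
qed

text \<open>The pieces \<open>A b\<close> are intervals, so their images have finite frontiers, and
  fixing the pattern is a finite intersection of such images and of complements. Thus
  \<open>count_limit\<close> applies to every pattern.\<close>

lemma finite_frontier_pattern:
  assumes N: "N > 0" and S: "S \<subseteq> {..N}"
  shows "finite (frontier {t. pattern N t = S})"
proof -
  define A where "A b = {\<theta> \<in> {0..pi}. cell N \<theta> = b}" for b
  define P where "P b = (if b \<in> S then f ` A b else - (f ` A b))" for b
  have "finite (frontier (f ` A b))" for b
  proof (rule finite_frontier_image[OF discontinuities])
    have "A b = {0..pi} \<inter> ({\<theta>. \<theta> * real N < real (Suc b) * pi} - {\<theta>. \<theta> * real N < real b * pi})"
      unfolding A_def cell_eq_iff[OF N] by auto
    moreover have "is_interval ({0..pi} \<inter> ({\<theta>. \<theta> * real N < real (Suc b) * pi} - {\<theta>. \<theta> * real N < real b * pi}))"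
      unfolding is_interval_1
    proof (intro ballI allI impI)
      fix x y z
      let ?T = "{0..pi} \<inter> ({\<theta>. \<theta> * real N < real (Suc b) * pi} - {\<theta>. \<theta> * real N < real b * pi})"
      assume "x \<in> ?T" "y \<in> ?T" and z: "x \<le> z \<and> z \<le> y"
      moreover have "x * real N \<le> z * real N" "z * real N \<le> y * real N"
        using z by (auto intro: mult_right_mono)
      ultimately show "z \<in> ?T" by auto
    qed
    ultimately show "connected (A b)" by (simp add: is_interval_connected_1[symmetric])
    show "continuous_on (A b - discontinuity_points f {-pi..pi}) f"
      unfolding continuous_on_eq_continuous_within
    proof
      fix x assume x: "x \<in> A b - discontinuity_points f {-pi..pi}"
      hence "continuous (at x within {-pi..pi}) f" by (auto simp: A_def discontinuity_points_def)
      thus "continuous (at x within A b - discontinuity_points f {-pi..pi}) f"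
        by (rule continuous_within_subset) (auto simp: A_def)
    qed
  qed
  hence "finite (frontier (\<Inter>b\<in>{..N}. P b))"
    by (intro finite_frontier_INT) (auto simp: P_def frontier_complement)
  moreover have "{t. pattern N t = S} = (\<Inter>b\<in>{..N}. P b)"
  proof -
    have "pattern N t = {b. t \<in> f ` A b}" for t by (auto simp: pattern_def A_def)
    moreover have "t \<in> P b \<longleftrightarrow> (b \<in> S \<longleftrightarrow> t \<in> f ` A b)" for t b by (simp add: P_def)
    ultimately have P: "t \<in> P b \<longleftrightarrow> (b \<in> S \<longleftrightarrow> b \<in> pattern N t)" for t b by simp
    have "pattern N t = S \<longleftrightarrow> t \<in> (\<Inter>b\<in>{..N}. P b)" for t
    proof
      assume "t \<in> (\<Inter>b\<in>{..N}. P b)"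
      hence "b \<in> S \<longleftrightarrow> b \<in> pattern N t" if "b \<in> {..N}" for b using P that by blast
      thus "pattern N t = S" using S pattern_subset[OF N, of t] by (intro equalityI subsetI) blast+
    qed (simp add: P)
    thus ?thesis by blast
  qed
  ultimately show ?thesis by simp
qed

text \<open>The quota: the proportion of eigenvalues that are to have pattern \<open>S\<close> and
  be lifted into cell \<open>b\<close>, namely the one that a uniform \<theta> would
  produce.\<close>

definition share :: "nat \<Rightarrow> nat set \<Rightarrow> nat \<Rightarrow> real" where
  "share N S b = measure circle {\<theta> \<in> {-pi..pi}. pattern N (f \<theta>) = S \<and> cell N \<theta> = b} / (2 * pi)"

lemma measurable_cell: "{\<theta> \<in> {-pi..pi}. pattern N (f \<theta>) = S \<and> cell N \<theta> = b} \<in> sets circle"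
  if "N > 0" "S \<subseteq> {..N}"
proof -
  have "{\<theta> \<in> {-pi..pi}. f \<theta> \<in> {t. pattern N t = S}} \<in> sets circle"
    by (intro level_set_measurable finite_frontier_borel finite_frontier_pattern that)
  moreover have "{\<theta>. cell N \<theta> = b} \<inter> {-pi..pi} \<in> sets circle"
  proof (rule sets_circle_borel)
    have "{\<theta>. cell N \<theta> = b} = {\<theta>. \<bar>\<theta>\<bar> * real N < real (Suc b) * pi} - {\<theta>. \<bar>\<theta>\<bar> * real N < real b * pi}"
      unfolding cell_eq_iff[OF that(1)] by auto
    also have "\<dots> \<in> sets borel"
      by (intro sets.Diff borel_open open_Collect_less continuous_intros)
    finally show "{\<theta>. cell N \<theta> = b} \<in> sets borel" .
  qed
  moreover have "{\<theta> \<in> {-pi..pi}. pattern N (f \<theta>) = S \<and> cell N \<theta> = b}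
      = {\<theta> \<in> {-pi..pi}. f \<theta> \<in> {t. pattern N t = S}} \<inter> ({\<theta>. cell N \<theta> = b} \<inter> {-pi..pi})" by auto
  ultimately show ?thesis by (simp only: sets.Int)
qed

text \<open>A point whose value has pattern \<open>S\<close> lies in a cell belonging to
  \<open>S\<close>, so the quotas exhaust the class and add up to its expected size.\<close>

lemma share_sum_cells:
  assumes N: "N > 0" and S: "S \<subseteq> {..N}"
  shows "sum (share N S) S = level_measure {t. pattern N t = S} / (2 * pi)"
proof -
  define X where "X b = {\<theta> \<in> {-pi..pi}. pattern N (f \<theta>) = S \<and> cell N \<theta> = b}" for b
  have "measure circle (\<Union>b\<in>S. X b) = (\<Sum>b\<in>S. measure circle (X b))"
  proof (rule circle.finite_measure_finite_Union)
    show "finite S" using S by (rule finite_subset) simp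
    show "X ` S \<subseteq> sets circle" using measurable_cell[OF N S] unfolding X_def by blast
    show "disjoint_family_on X S" by (auto simp: disjoint_family_on_def X_def)
  qed
  moreover have "(\<Union>b\<in>S. X b) = {\<theta> \<in> {-pi..pi}. f \<theta> \<in> {t. pattern N t = S}}"
    using cell_in_pattern by (auto simp: X_def)
  ultimately show ?thesis
    by (simp add: share_def level_measure_def X_def sum_divide_distrib)
qed

text \<open>Over all patterns the dependence on \<open>f\<close> disappears: the cells below
  \<open>B\<close> form the arc of modulus less than \<open>B * pi / N\<close>. Here the uniformity
  of the grid originates.\<close>

lemma share_sum_patterns:
  assumes N: "N > 0" and B: "B \<le> N"
  shows "(\<Sum>S\<in>Pow {..N}. \<Sum>b\<in>S \<inter> {..<B}. share N S b) = real B / real N"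
proof -
  define X where "X z = {\<theta> \<in> {-pi..pi}. pattern N (f \<theta>) = fst z \<and> cell N \<theta> = snd z}" for z
  define Z where "Z = Sigma (Pow {..N}) (\<lambda>S. S \<inter> {..<B})"
  have Z: "finite Z" unfolding Z_def by auto
  have "(\<Sum>S\<in>Pow {..N}. \<Sum>b\<in>S \<inter> {..<B}. share N S b) = (\<Sum>z\<in>Z. measure circle (X z)) / (2 * pi)"
    unfolding Z_def by (subst sum.Sigma) (auto simp: share_def X_def sum_divide_distrib split_def)
  also have "(\<Sum>z\<in>Z. measure circle (X z)) = measure circle (\<Union>z\<in>Z. X z)"
  proof (rule circle.finite_measure_finite_Union[symmetric])
    show "disjoint_family_on X Z" by (auto simp: disjoint_family_on_def X_def)
    show "X ` Z \<subseteq> sets circle" using measurable_cell[OF N] by (auto simp: X_def Z_def)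
  qed (rule Z)
  also have "(\<Union>z\<in>Z. X z) = {\<theta> \<in> {-pi..pi}. cell N \<theta> < B}"
  proof (intro equalityI subsetI)
    fix \<theta> assume t: "\<theta> \<in> {\<theta> \<in> {-pi..pi}. cell N \<theta> < B}"
    hence "(pattern N (f \<theta>), cell N \<theta>) \<in> Z"
      using cell_in_pattern[of \<theta> N] pattern_subset[OF N] by (auto simp: Z_def)
    moreover have "\<theta> \<in> X (pattern N (f \<theta>), cell N \<theta>)" using t by (simp add: X_def)
    ultimately show "\<theta> \<in> (\<Union>z\<in>Z. X z)" by blast
  qed (auto simp: X_def Z_def)
  also have "\<dots> = {- (real B * pi / real N)<..<real B * pi / real N}"
  proof -
    have "real B * pi / real N \<le> pi" using N B by (simp add: field_simps)
    moreover have "cell N \<theta> < B \<longleftrightarrow> \<bar>\<theta>\<bar> < real B * pi / real N" for \<theta>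
      using N by (simp add: cell_less_iff pos_less_divide_eq)
    ultimately show ?thesis
      by (intro equalityI subsetI; simp only: mem_Collect_eq atLeastAtMost_iff greaterThanLessThan_iff) linarith+
  qed
  also have "measure circle \<dots> = 2 * (real B * pi / real N)"
  proof (subst measure_circle)
    have "real B * pi / real N \<le> pi" using N B by (simp add: field_simps)
    thus "{- (real B * pi / real N)<..<real B * pi / real N} \<subseteq> {-pi..pi}" by auto
  qed auto
  finally show ?thesis by simp
qed
text \<open>Each pattern class is distributed by \<open>quota_assignment\<close>: the gap in class
  size is at most \<gamma> and a pattern has at most \<open>N + 1\<close> cells, whence
  \<open>\<gamma> + N + 1\<close> per cell. The factor in front bounds the number of pairs of a
  pattern, one of \<open>2 ^ (N + 1)\<close> sets, and a cell.\<close>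

lemma lift_to_cells:
  fixes I :: "'b set"
  assumes I: "finite I" and range: "\<And>i. i \<in> I \<Longrightarrow> a i \<in> f ` {0..pi}" and N: "N > 0"
    and counts: "\<And>S. S \<subseteq> {..N} \<Longrightarrow>
      \<bar>real (card {i \<in> I. pattern N (a i) = S}) - real (card I) * (level_measure {t. pattern N t = S} / (2 * pi))\<bar> \<le> \<gamma>"
  shows "\<exists>\<xi>. (\<forall>i\<in>I. \<xi> i \<in> {0..pi} \<and> f (\<xi> i) = a i) \<and>
    (\<forall>B\<le>N. \<bar>real (card {i \<in> I. cell N (\<xi> i) < B}) - real (card I) * (real B / real N)\<bar>
        \<le> 2 ^ (N + 1) * (real N + 1) * (\<gamma> + real N + 1))"
proof -
  define J where "J S = {i \<in> I. pattern N (a i) = S}" for S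
  define m where "m = real (card I)"
  have J: "finite (J S)" for S using I by (simp add: J_def)
  have share_nonneg: "share N S b \<ge> 0" for S b by (simp add: share_def)
  have \<gamma>: "\<gamma> \<ge> 0" using order_trans[OF abs_ge_zero counts[of "{}"]] by simp
  define fair where "fair S \<kappa> \<longleftrightarrow> (\<forall>i\<in>J S. \<kappa> i \<in> S) \<and>
      (\<forall>b\<in>S. \<bar>real (card {i \<in> J S. \<kappa> i = b}) - m * share N S b\<bar> \<le> \<gamma> + real N + 1)"
    for S and \<kappa> :: "'b \<Rightarrow> nat"
  have "\<exists>\<kappa>. fair S \<kappa>"
    if S: "S \<subseteq> {..N}" for S
  \<comment> \<open>The assignment needs a nonempty set of labels; the empty pattern is not met,
    since every \<open>a i\<close> is a value of \<open>f\<close>.\<close>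
  proof (cases "S = {}")
    case True
    have "pattern N (a i) \<noteq> {}" if "i \<in> I" for i
    proof -
      obtain \<theta> where "\<theta> \<in> {0..pi}" "a i = f \<theta>" using range[OF \<open>i \<in> I\<close>] by blast
      thus ?thesis using cell_in_pattern[of \<theta> N] by auto
    qed
    hence "J S = {}" using True by (auto simp: J_def)
    thus ?thesis using True by (simp add: fair_def)
  next
    case False
    have fin: "finite S" using S by (rule finite_subset) simp
    have "m \<ge> 0" by (simp add: m_def)
    hence "\<exists>\<kappa>. (\<forall>i\<in>J S. \<kappa> i \<in> S) \<and> (\<forall>b\<in>S. \<bar>real (card {i \<in> J S. \<kappa> i = b}) - m * share N S b\<bar>
          \<le> \<bar>real (card (J S)) - (\<Sum>b\<in>S. m * share N S b)\<bar> + real (card S))"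
      by (intro quota_assignment[OF fin False J] mult_nonneg_nonneg share_nonneg)
    then obtain \<kappa> where \<kappa>: "\<forall>i\<in>J S. \<kappa> i \<in> S"
      "\<forall>b\<in>S. \<bar>real (card {i \<in> J S. \<kappa> i = b}) - m * share N S b\<bar>
          \<le> \<bar>real (card (J S)) - (\<Sum>b\<in>S. m * share N S b)\<bar> + real (card S)" by (elim exE conjE)
    have "(\<Sum>b\<in>S. m * share N S b) = m * (level_measure {t. pattern N t = S} / (2 * pi))"
      unfolding sum_distrib_left[symmetric] share_sum_cells[OF N S] ..
    hence "\<bar>real (card (J S)) - (\<Sum>b\<in>S. m * share N S b)\<bar> \<le> \<gamma>"
      using counts[OF S] by (simp add: J_def m_def)
    moreover have "real (card S) \<le> real N + 1"
      using card_mono[OF finite_atMost S] by simp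
    ultimately have le: "\<bar>real (card (J S)) - (\<Sum>b\<in>S. m * share N S b)\<bar> + real (card S) \<le> \<gamma> + real N + 1"
      by linarith
    show ?thesis unfolding fair_def
    proof (intro exI[of _ \<kappa>] conjI ballI)
      show "\<kappa> i \<in> S" if "i \<in> J S" for i using \<kappa>(1) that by (rule bspec)
      show "\<bar>real (card {i \<in> J S. \<kappa> i = b}) - m * share N S b\<bar> \<le> \<gamma> + real N + 1" if "b \<in> S" for b
        by (rule order_trans[OF bspec[OF \<kappa>(2) that] le])
    qed
  qed
  then obtain \<kappa> where fair: "\<And>S. S \<subseteq> {..N} \<Longrightarrow> fair S (\<kappa> S)" by metis
  have \<kappa>: "\<kappa> S i \<in> S" if "S \<subseteq> {..N}" "i \<in> J S" for S i
    by (rule bspec[OF conjunct1[OF fair[OF that(1), unfolded fair_def]] that(2)])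
  have \<kappa>_count: "\<bar>real (card {i \<in> J S. \<kappa> S i = b}) - m * share N S b\<bar> \<le> \<gamma> + real N + 1"
    if "S \<subseteq> {..N}" "b \<in> S" for S b
    by (rule bspec[OF conjunct2[OF fair[OF that(1), unfolded fair_def]] that(2)])
  define k where "k i = \<kappa> (pattern N (a i)) i" for i
  have "k i \<in> pattern N (a i)" if "i \<in> I" for i
    using \<kappa>[OF pattern_subset[OF N], of i] that by (simp add: J_def k_def)
  \<comment> \<open>Membership of the assigned cell in the pattern is exactly the existence of a
    preimage there.\<close>
  hence "\<exists>x\<in>{0..pi}. cell N x = k i \<and> f x = a i" if "i \<in> I" for i
    using that unfolding pattern_def by blast
  then obtain \<xi> where \<xi>: "\<And>i. i \<in> I \<Longrightarrow> \<xi> i \<in> {0..pi}" "\<And>i. i \<in> I \<Longrightarrow> cell N (\<xi> i) = k i"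
    "\<And>i. i \<in> I \<Longrightarrow> f (\<xi> i) = a i" by metis
  show ?thesis
  proof (intro exI[of _ \<xi>] conjI ballI allI impI)
    show "\<xi> i \<in> {0..pi}" "f (\<xi> i) = a i" if "i \<in> I" for i using \<xi>[OF that] by auto
    fix B assume B: "B \<le> N"
    define Z where "Z = Sigma (Pow {..N}) (\<lambda>S. S \<inter> {..<B})"
    define Y where "Y z = {i \<in> J (fst z). \<kappa> (fst z) i = snd z}" for z
    have Z: "finite Z" "card Z \<le> 2 ^ (N + 1) * (N + 1)"
    proof -
      have "Z \<subseteq> Pow {..N} \<times> {..N}" by (auto simp: Z_def)
      hence "card Z \<le> card (Pow {..N} \<times> {..N})" by (intro card_mono) auto
      thus "card Z \<le> 2 ^ (N + 1) * (N + 1)" by (simp add: card_cartesian_product card_Pow)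
      show "finite Z" unfolding Z_def by auto
    qed
    have "{i \<in> I. cell N (\<xi> i) < B} = (\<Union>z\<in>Z. Y z)"
    proof (intro equalityI subsetI)
      fix i assume i: "i \<in> {i \<in> I. cell N (\<xi> i) < B}"
      hence "i \<in> J (pattern N (a i))" "k i < B" using \<xi>(2) by (auto simp: J_def)
      hence "(pattern N (a i), k i) \<in> Z" "i \<in> Y (pattern N (a i), k i)"
        using \<kappa>[OF pattern_subset[OF N], of i] pattern_subset[OF N] by (auto simp: Z_def Y_def k_def)
      thus "i \<in> (\<Union>z\<in>Z. Y z)" by blast
    next
      fix i assume "i \<in> (\<Union>z\<in>Z. Y z)"
      then obtain S b where "i \<in> I" "pattern N (a i) = S" "\<kappa> S i = b" "b < B"
        by (auto simp: Z_def Y_def J_def)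
      thus "i \<in> {i \<in> I. cell N (\<xi> i) < B}" using \<xi>(2)[of i] by (simp add: k_def)
    qed
    moreover have "card (\<Union>z\<in>Z. Y z) = (\<Sum>z\<in>Z. card (Y z))"
      by (rule card_UN_disjoint[OF Z(1)]) (auto simp: Y_def J_def I)
    ultimately have card: "real (card {i \<in> I. cell N (\<xi> i) < B}) = (\<Sum>z\<in>Z. real (card (Y z)))" by simp
    have "m * (real B / real N) = (\<Sum>z\<in>Z. m * share N (fst z) (snd z))"
      unfolding share_sum_patterns[OF N B, symmetric] Z_def sum_distrib_left
      by (subst sum.Sigma) (auto simp: split_def)
    hence "\<bar>real (card {i \<in> I. cell N (\<xi> i) < B}) - m * (real B / real N)\<bar>
        = \<bar>\<Sum>z\<in>Z. real (card (Y z)) - m * share N (fst z) (snd z)\<bar>"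
      unfolding card by (simp add: sum_subtractf)
    also have "\<dots> \<le> (\<Sum>z\<in>Z. \<bar>real (card (Y z)) - m * share N (fst z) (snd z)\<bar>)" by (rule sum_abs)
    also have "\<dots> \<le> (\<Sum>z\<in>Z. \<gamma> + real N + 1)"
      using \<kappa>_count by (intro sum_mono) (auto simp: Z_def Y_def)
    also have "\<dots> = real (card Z) * (\<gamma> + real N + 1)" by simp
    also have "\<dots> \<le> real (2 ^ (N + 1) * (N + 1)) * (\<gamma> + real N + 1)"
      using \<gamma> by (intro mult_right_mono of_nat_mono Z(2)) simp
    also have "\<dots> = 2 ^ (N + 1) * (real N + 1) * (\<gamma> + real N + 1)" by (simp add: algebra_simps)
    finally show "\<bar>real (card {i \<in> I. cell N (\<xi> i) < B}) - real (card I) * (real B / real N)\<bar>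
        \<le> 2 ^ (N + 1) * (real N + 1) * (\<gamma> + real N + 1)" by (simp add: m_def)
  qed
qed

text \<open>Let \<open>b\<close> be the cell of sorted point \<open>j\<close> and
  \<open>m = card I\<close>. Cells before \<open>b\<close> hold at most \<open>j\<close> points and
  cells up to \<open>b\<close> at least \<open>j\<close>, so the counts pin \<open>j / m\<close> to
  \<open>b / N\<close> up to \<open>1 / N\<close> and \<open>\<Delta> / m\<close>.\<close>

lemma sorted_lift_uniform:
  assumes N: "N > 0" and I: "finite I"
    and \<xi>: "\<And>i. i \<in> I \<Longrightarrow> \<xi> i \<in> {0..pi}"
    and counts: "\<And>B. B \<le> N \<Longrightarrow> \<bar>real (card {i \<in> I. cell N (\<xi> i) < B}) - real (card I) * (real B / real N)\<bar> \<le> \<Delta>"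
    and \<tau>: "bij_betw \<tau> {1..card I} I"
    and sorted: "\<And>i j. 1 \<le> i \<Longrightarrow> i \<le> j \<Longrightarrow> j \<le> card I \<Longrightarrow> \<xi> (\<tau> i) \<le> \<xi> (\<tau> j)"
    and j: "j \<in> {1..card I}"
  shows "\<bar>\<xi> (\<tau> j) - real j * pi / real (card I)\<bar> \<le> pi / real N + \<Delta> * pi / real (card I)"
proof -
  define m where "m = card I"
  have m: "m > 0" using j by (simp add: m_def)
  define x where "x = \<xi> (\<tau> j)"
  have in_I: "\<tau> i \<in> I" if "i \<in> {1..m}" for i using \<tau> that by (auto simp: bij_betw_def m_def)
  have x: "x \<in> {0..pi}" using \<xi>[OF in_I] j by (simp add: x_def m_def)
  define b where "b = cell N x"
  have bN: "b \<le> N" unfolding b_def by (rule cell_le[OF N]) (use x in auto)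
  have mono: "cell N y \<le> cell N z" if "0 \<le> y" "y \<le> z" for y z
    unfolding cell_def using that by (intro nat_mono floor_mono divide_right_mono mult_right_mono) auto
  have cell_x: "real b * pi \<le> x * real N" "x * real N < real (Suc b) * pi"
    using cell_eq_iff[OF N, of x b] x by (auto simp: b_def)
  have below: "real (card {i \<in> I. cell N (\<xi> i) < b}) \<le> real j"
  proof -
    have "{i \<in> I. cell N (\<xi> i) < b} \<subseteq> \<tau> ` {1..j}"
    proof
      fix i assume i: "i \<in> {i \<in> I. cell N (\<xi> i) < b}"
      hence "i \<in> \<tau> ` {1..m}" using bij_betw_imp_surj_on[OF \<tau>] by (simp add: m_def)
      then obtain l where l: "l \<in> {1..m}" "i = \<tau> l" by blast
      have "l \<le> j"
      proof (rule ccontr)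
        assume "\<not> l \<le> j"
        hence "x \<le> \<xi> (\<tau> l)" unfolding x_def using sorted[of j l] j l by (simp add: m_def)
        hence "b \<le> cell N (\<xi> i)" unfolding b_def l(2) using x by (intro mono) auto
        thus False using i by simp
      qed
      thus "i \<in> \<tau> ` {1..j}" using l by auto
    qed
    hence "card {i \<in> I. cell N (\<xi> i) < b} \<le> card (\<tau> ` {1..j})" by (intro card_mono) auto
    also have "\<dots> \<le> j" using card_image_le[of "{1..j}" \<tau>] by simp
    finally show ?thesis by simp
  qed
  have above: "real j \<le> real (card {i \<in> I. cell N (\<xi> i) < Suc b})"
  proof -
    have inj: "inj_on \<tau> {1..j}"
      by (rule inj_on_subset[OF bij_betw_imp_inj_on[OF \<tau>]]) (use j in auto)
    have "\<tau> ` {1..j} \<subseteq> {i \<in> I. cell N (\<xi> i) < Suc b}"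
    proof
      fix i assume "i \<in> \<tau> ` {1..j}"
      then obtain l where l: "l \<in> {1..j}" "i = \<tau> l" by auto
      hence lI: "i \<in> I" using in_I j by (simp add: m_def)
      have "\<xi> i \<le> x" unfolding x_def l(2) using sorted[of l j] j l by simp
      hence "cell N (\<xi> i) \<le> b" unfolding b_def using \<xi>[OF lI] by (intro mono) auto
      thus "i \<in> {i \<in> I. cell N (\<xi> i) < Suc b}" using lI by simp
    qed
    hence "card (\<tau> ` {1..j}) \<le> card {i \<in> I. cell N (\<xi> i) < Suc b}" using I by (intro card_mono) auto
    thus ?thesis using card_image[OF inj] by simp
  qed
  have \<Delta>: "\<Delta> \<ge> 0" using order_trans[OF abs_ge_zero counts[of 0]] by simp
  have lower: "real m * (real b / real N) - \<Delta> \<le> real j"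
    using counts[OF bN] below by (simp add: m_def)
  have upper: "real j \<le> real m * (real (Suc b) / real N) + \<Delta>"
  proof (cases "Suc b \<le> N")
    case True
    show ?thesis using counts[OF True] above by (simp add: m_def)
  next
    \<comment> \<open>The counts stop at \<open>B = N\<close>; beyond that, \<open>j \<le> m\<close>
      is bound enough.\<close>
    case False
    hence "real (Suc b) / real N \<ge> 1" using N by simp
    hence "real m * (real (Suc b) / real N) \<ge> real m * 1" by (intro mult_left_mono) auto
    moreover have "real j \<le> real m" using j by (simp add: m_def)
    ultimately show ?thesis using \<Delta> by linarith
  qed
  have "real j * pi / real m \<ge> (real m * (real b / real N) - \<Delta>) * pi / real m"
    using lower by (intro divide_right_mono mult_right_mono) auto
  hence 1: "real b * pi / real N - \<Delta> * pi / real m \<le> real j * pi / real m"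
    using m N by (simp add: field_simps)
  have "real j * pi / real m \<le> (real m * (real (Suc b) / real N) + \<Delta>) * pi / real m"
    using upper by (intro divide_right_mono mult_right_mono) auto
  hence 2: "real j * pi / real m \<le> real (Suc b) * pi / real N + \<Delta> * pi / real m"
    using m N by (simp add: field_simps)
  have 3: "real b * pi / real N \<le> x" "x \<le> real (Suc b) * pi / real N"
    using cell_x N by (simp_all add: field_simps)
  have 4: "real (Suc b) * pi / real N = real b * pi / real N + pi / real N"
    by (simp add: add_divide_distrib algebra_simps)
  show ?thesis using 1 2 3 4 unfolding x_def[symmetric] m_def[symmetric] by linarith
qed
text \<open>For fixed \<open>N\<close> the estimate leaves an error of order \<open>pi / N\<close>,
  so no single partition suffices; \<open>diagonal_choice\<close> refines it along \<open>n\<close>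
  without naming the dependence.\<close>

theorem uniform_lift:
  assumes eq: "equidistributed I a"
  obtains \<tau> :: "nat \<Rightarrow> nat \<Rightarrow> nat" and \<xi> :: "nat \<Rightarrow> nat \<Rightarrow> real" where
    "\<And>n. bij_betw (\<tau> n) {1..card (I n)} (I n)"
    "\<And>n j. j \<in> {1..card (I n)} \<Longrightarrow> \<xi> n j \<in> {0..pi} \<and> f (\<xi> n j) = a n (\<tau> n j)"
    "\<And>\<epsilon>. \<epsilon> > 0 \<Longrightarrow> eventually (\<lambda>n. \<forall>j\<in>{1..card (I n)}.
        \<bar>\<xi> n j - real j * pi / real (card (I n))\<bar> < \<epsilon>) sequentially"
proof -
  have fin: "finite (I n)" and range: "i \<in> I n \<Longrightarrow> a n i \<in> f ` {0..pi}" for n i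
    using eq by (auto simp: equidistributed_def)
  have large: "filterlim (\<lambda>n. card (I n)) at_top sequentially" using eq by (simp add: equidistributed_def)
  define lift where "lift n z \<longleftrightarrow> bij_betw (fst z) {1..card (I n)} (I n) \<and>
      (\<forall>j\<in>{1..card (I n)}. snd z j \<in> {0..pi} \<and> f (snd z j) = a n (fst z j))"
    for n and z :: "(nat \<Rightarrow> nat) \<times> (nat \<Rightarrow> real)"
  \<comment> \<open>The inserted 0 gives the maximum a meaning when the index set is empty.\<close>
  define err where "err n z = Max (insert 0 ((\<lambda>j. \<bar>snd z j - real j * pi / real (card (I n))\<bar>) ` {1..card (I n)}))"
    for n and z :: "(nat \<Rightarrow> nat) \<times> (nat \<Rightarrow> real)"
  have err_less: "err n z < \<epsilon> \<longleftrightarrow> (\<forall>j\<in>{1..card (I n)}. \<bar>snd z j - real j * pi / real (card (I n))\<bar> < \<epsilon>)"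
    if "\<epsilon> > 0" for n z \<epsilon>
    unfolding err_def using that by (subst Max_less_iff) auto
  have err_nonneg: "err n z \<ge> 0" for n z unfolding err_def by (rule Max_ge) auto
  have ex: "\<exists>z. lift n z" for n
  proof -
    obtain \<tau> where \<tau>: "bij_betw \<tau> {1..card (I n)} (I n)"
      using sorted_enumeration[OF fin, where x = "\<lambda>_. 0"] by blast
    hence "\<forall>j\<in>{1..card (I n)}. \<exists>x. x \<in> {0..pi} \<and> f x = a n (\<tau> j)"
      using range by (fastforce simp: bij_betw_def)
    from bchoice[OF this] obtain \<xi> where "\<forall>j\<in>{1..card (I n)}. \<xi> j \<in> {0..pi} \<and> f (\<xi> j) = a n (\<tau> j)" ..
    thus ?thesis using \<tau> by (intro exI[of _ "(\<tau>, \<xi>)"]) (simp add: lift_def)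
  qed
  have small: "eventually (\<lambda>n. \<exists>z. lift n z \<and> err n z < \<epsilon>) sequentially" if \<epsilon>: "\<epsilon> > 0" for \<epsilon>
  proof -
    \<comment> \<open>Error budget: \<open>\<epsilon> / 2\<close> for the width of a cell,
      \<open>\<epsilon> / 4\<close> through \<delta> for the deviation of the counts,
      \<open>\<epsilon> / 4\<close> for the rounding term that vanishes as \<open>card (I n)\<close>
      grows.\<close>
    obtain N :: nat where N: "2 * pi / \<epsilon> < real N" using reals_Archimedean2 by blast
    have "2 * pi / \<epsilon> > 0" using \<epsilon> by simp
    hence N0: "N > 0" using N by linarith
    have hN: "pi / real N < \<epsilon> / 2" using N N0 \<epsilon> by (simp add: field_simps)
    define K where "K = 2 ^ (N + 1) * (real N + 1)"
    have K: "K > 0" by (simp add: K_def)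
    define \<delta> where "\<delta> = \<epsilon> / (4 * pi * K)"
    have \<delta>: "\<delta> > 0" "K * \<delta> * pi = \<epsilon> / 4" using \<epsilon> K by (auto simp: \<delta>_def)
    have "eventually (\<lambda>n. \<forall>S\<in>Pow {..N}. \<bar>real (card {i \<in> I n. a n i \<in> {t. pattern N t = S}}) / real (card (I n))
        - level_measure {t. pattern N t = S} / (2 * pi)\<bar> < \<delta>) sequentially"
    proof (intro eventually_ball_finite ballI)
      fix S assume "S \<in> Pow {..N}"
      hence "finite (frontier {t. pattern N t = S})" by (intro finite_frontier_pattern[OF N0]) auto
      from tendstoD[OF count_limit[OF eq this] \<delta>(1)]
      show "eventually (\<lambda>n. \<bar>real (card {i \<in> I n. a n i \<in> {t. pattern N t = S}}) / real (card (I n))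
        - level_measure {t. pattern N t = S} / (2 * pi)\<bar> < \<delta>) sequentially" by (simp add: dist_real_def)
    qed simp
    moreover have "eventually (\<lambda>n. K * (real N + 1) * pi / real (card (I n)) < \<epsilon> / 4) sequentially"
    proof -
      have "((\<lambda>m. K * (real N + 1) * pi / real m) \<longlongrightarrow> 0) at_top" by real_asymp
      hence "(\<lambda>n. K * (real N + 1) * pi / real (card (I n))) \<longlonglongrightarrow> 0"
        by (rule filterlim_compose[OF _ large])
      from order_tendstoD(2)[OF this, of "\<epsilon> / 4"] \<epsilon> show ?thesis by simp
    qed
    moreover have "eventually (\<lambda>n. card (I n) \<ge> 1) sequentially"
      using large unfolding filterlim_at_top by blast
    ultimately show ?thesis
    proof eventually_elim
      case (elim n)
      define m where "m = card (I n)"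
      have m: "real m > 0" using elim by (simp add: m_def)
      have counts: "\<bar>real (card {i \<in> I n. pattern N (a n i) = S}) - real (card (I n)) * (level_measure {t. pattern N t = S} / (2 * pi))\<bar>
          \<le> \<delta> * real m" if S: "S \<subseteq> {..N}" for S
      proof -
        let ?c = "real (card {i \<in> I n. pattern N (a n i) = S})" and ?l = "level_measure {t. pattern N t = S} / (2 * pi)"
        have "\<bar>?c / real m - ?l\<bar> < \<delta>" using elim(1) S by (simp add: m_def)
        hence "\<bar>?c / real m - ?l\<bar> * real m \<le> \<delta> * real m" by (intro mult_right_mono) auto
        moreover have "\<bar>?c / real m - ?l\<bar> * real m = \<bar>(?c / real m - ?l) * real m\<bar>"
          by (simp add: abs_mult)
        moreover have "(?c / real m - ?l) * real m = ?c - real m * ?l" using m by (simp add: left_diff_distrib)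
        ultimately show ?thesis by (simp only: m_def)
      qed
      have "\<exists>\<xi>. (\<forall>i\<in>I n. \<xi> i \<in> {0..pi} \<and> f (\<xi> i) = a n i) \<and>
        (\<forall>B\<le>N. \<bar>real (card {i \<in> I n. cell N (\<xi> i) < B}) - real (card (I n)) * (real B / real N)\<bar>
            \<le> K * (\<delta> * real m + real N + 1))"
        unfolding K_def by (rule lift_to_cells[OF fin[of n] range N0 counts])
      then obtain \<xi> where "\<forall>i\<in>I n. \<xi> i \<in> {0..pi} \<and> f (\<xi> i) = a n i" and
        "\<forall>B\<le>N. \<bar>real (card {i \<in> I n. cell N (\<xi> i) < B}) - real (card (I n)) * (real B / real N)\<bar>
            \<le> K * (\<delta> * real m + real N + 1)" by (elim exE conjE)
      hence \<xi>: "\<And>i. i \<in> I n \<Longrightarrow> \<xi> i \<in> {0..pi}" "\<And>i. i \<in> I n \<Longrightarrow> f (\<xi> i) = a n i"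
        "\<And>B. B \<le> N \<Longrightarrow> \<bar>real (card {i \<in> I n. cell N (\<xi> i) < B}) - real (card (I n)) * (real B / real N)\<bar>
            \<le> K * (\<delta> * real m + real N + 1)" by blast+
      obtain \<tau> where \<tau>: "bij_betw \<tau> {1..card (I n)} (I n)"
        "\<And>i j. 1 \<le> i \<Longrightarrow> i \<le> j \<Longrightarrow> j \<le> card (I n) \<Longrightarrow> \<xi> (\<tau> i) \<le> \<xi> (\<tau> j)"
        using sorted_enumeration[OF fin, where x = \<xi>] by blast
      have mem: "\<tau> j \<in> I n" if "j \<in> {1..card (I n)}" for j
        using bij_betw_apply[OF \<tau>(1) that] .
      have "lift n (\<tau>, \<lambda>j. \<xi> (\<tau> j))"
        unfolding lift_def using \<tau>(1) \<xi>(1,2)[OF mem] by simp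
      moreover have "err n (\<tau>, \<lambda>j. \<xi> (\<tau> j)) < \<epsilon>"
        unfolding err_less[OF \<epsilon>]
      proof
        fix j assume j: "j \<in> {1..card (I n)}"
        have "\<bar>\<xi> (\<tau> j) - real j * pi / real (card (I n))\<bar>
            \<le> pi / real N + K * (\<delta> * real m + real N + 1) * pi / real (card (I n))"
          by (rule sorted_lift_uniform[OF N0 fin \<xi>(1,3) \<tau> j])
        also have "K * (\<delta> * real m + real N + 1) * pi / real (card (I n))
            = K * \<delta> * pi + K * (real N + 1) * pi / real (card (I n))"
          using m unfolding m_def by (simp add: field_simps)
        also have "pi / real N + (K * \<delta> * pi + K * (real N + 1) * pi / real (card (I n))) < \<epsilon>"
          using hN \<delta>(2) elim(2) by linarith
        finally show "\<bar>snd (\<tau>, \<lambda>j. \<xi> (\<tau> j)) j - real j * pi / real (card (I n))\<bar> < \<epsilon>" by simp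
      qed
      ultimately show ?case by blast
    qed
  qed
  obtain X where X: "\<And>n. lift n (X n)" "(\<lambda>n. err n (X n)) \<longlonglongrightarrow> 0"
    using diagonal_choice[of lift err, OF ex err_nonneg small] by blast
  show thesis
  proof (rule that[of "\<lambda>n. fst (X n)" "\<lambda>n. snd (X n)"])
    show "bij_betw (fst (X n)) {1..card (I n)} (I n)" for n using X(1)[of n] by (simp add: lift_def)
    show "snd (X n) j \<in> {0..pi} \<and> f (snd (X n) j) = a n (fst (X n) j)" if "j \<in> {1..card (I n)}" for n j
      using X(1)[of n] that unfolding lift_def by blast
    show "eventually (\<lambda>n. \<forall>j\<in>{1..card (I n)}. \<bar>snd (X n) j - real j * pi / real (card (I n))\<bar> < \<epsilon>) sequentially"
      if "\<epsilon> > 0" for \<epsilon>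
      using order_tendstoD(2)[OF X(2) that] unfolding err_less[OF that] .
  qed
qed

text \<open>Evenness moves preimages into \<open>{0..pi}\<close>, and the factor 2 in
  \<open>ratio\<close> turns averages over \<open>n\<close> into averages over one symmetry
  class.\<close>

lemma eigensystem_equidistributed:
  assumes es: "\<And>n. n \<ge> 1 \<Longrightarrow> eigensystem n (U n) (a n) (s n)"
    and conn: "connected (f ` {-pi..pi})"
    and \<sigma>: "\<sigma> = 1 \<or> \<sigma> = - 1"
    and ratio: "(\<lambda>n. real n / real (card {i. i < n \<and> s n i = \<sigma>})) \<longlonglongrightarrow> 2"
    and large: "filterlim (\<lambda>n. card {i. i < n \<and> s n i = \<sigma>}) at_top sequentially"
  shows "equidistributed (\<lambda>n. {i. i < n \<and> s n i = \<sigma>}) a"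
  unfolding equidistributed_def
proof (intro conjI allI impI ballI)
  fix n i assume "i \<in> {i. i < n \<and> s n i = \<sigma>}"
  hence i: "i < n" "n \<ge> 1" by auto
  have "eigenpair n (U n i) (a n i)" using es[OF i(2)] i(1) by (simp add: eigensystem_def)
  from eigenvalue_in_range[OF this conn] obtain x where x: "x \<in> {-pi..pi}" "a n i = f x" by blast
  hence "f \<bar>x\<bar> = a n i" using even[of x] by (auto simp: abs_if)
  thus "a n i \<in> f ` {0..pi}" using x by (intro image_eqI[of _ _ "\<bar>x\<bar>"]) auto
next
  fix G :: "real \<Rightarrow> real" and L assume lip: "\<forall>x y. \<bar>G x - G y\<bar> \<le> L * \<bar>x - y\<bar>"
  have "(\<lambda>n. (\<Sum>i | i < n \<and> s n i = \<sigma>. G (a n i)) / real n * (real n / real (card {i. i < n \<and> s n i = \<sigma>})))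
      \<longlonglongrightarrow> (\<integral>\<theta>. G (f \<theta>) \<partial>circle) / (4 * pi) * 2"
    using lip by (intro tendsto_mult ratio eigenvalue_means[OF es \<sigma>]) auto
  moreover have "eventually (\<lambda>n. (\<Sum>i | i < n \<and> s n i = \<sigma>. G (a n i)) / real n * (real n / real (card {i. i < n \<and> s n i = \<sigma>}))
      = (\<Sum>i | i < n \<and> s n i = \<sigma>. G (a n i)) / real (card {i. i < n \<and> s n i = \<sigma>})) sequentially"
    using eventually_gt_at_top[of 0] by eventually_elim simp
  ultimately have "(\<lambda>n. (\<Sum>i | i < n \<and> s n i = \<sigma>. G (a n i)) / real (card {i. i < n \<and> s n i = \<sigma>}))
      \<longlonglongrightarrow> (\<integral>\<theta>. G (f \<theta>) \<partial>circle) / (4 * pi) * 2"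
    by (rule Lim_transform_eventually)
  thus "(\<lambda>n. (\<Sum>i | i < n \<and> s n i = \<sigma>. G (a n i)) / real (card {i. i < n \<and> s n i = \<sigma>}))
      \<longlonglongrightarrow> (\<integral>\<theta>. G (f \<theta>) \<partial>circle) / (2 * pi)" by simp
qed (use large in auto)

end

section \<open>Interleaving the two grids\<close>

context even_symbol
begin

lemma toeplitz_entry:
  "j < n \<Longrightarrow> k < n \<Longrightarrow> toeplitz_mat n (\<lambda>x. complex_of_real (f x)) $$ (j, k) = coeff (int j - int k)"
  by (simp add: toeplitz_mat_def coeff_def)

lemma hankel_entry:
  assumes "j < n" "k < n"
  shows "hankel_mat n (\<lambda>x. complex_of_real (f x)) $$ (j, k) = coeff (int (n - 1 - j) - int k)"
proof -
  have "hankel_mat n (\<lambda>x. complex_of_real (f x)) $$ (j, k)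
      = (\<Sum>l = 0..<n. (if j + l + 1 = n then 1 else 0) * coeff (int l - int k))"
    using assms by (simp add: hankel_mat_def flip_mat_def toeplitz_mat_def coeff_def scalar_prod_def)
  also have "\<dots> = (\<Sum>l = 0..<n. if l = n - 1 - j then coeff (int (n - 1 - j) - int k) else 0)"
    using assms by (intro sum.cong refl) auto
  also have "\<dots> = coeff (int (n - 1 - j) - int k)" using assms by (subst sum.delta) auto
  finally show ?thesis .
qed

text \<open>Row \<open>j\<close> of the Hankel matrix is row \<open>n - 1 - j\<close> of the
  Toeplitz matrix. Reversing the index of an eigenvector pulls out its sign, so both matrices have
  spectral forms over the same vectors, with coefficients \<open>a i\<close> and
  \<open>s i * a i\<close>.\<close>

lemma eigensystem_exists:
  obtains U :: "nat \<Rightarrow> nat \<Rightarrow> complex" and a s :: "nat \<Rightarrow> real" where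
    "eigensystem n U a s"
    "\<And>j k. j < n \<Longrightarrow> k < n \<Longrightarrow> coeff (int j - int k) = (\<Sum>i<n. of_real (a i) * (U i j * cnj (U i k)))"
    "\<And>j k. j < n \<Longrightarrow> k < n \<Longrightarrow>
       coeff (int (n - 1 - j) - int k) = (\<Sum>i<n. of_real (s i * a i) * (U i j * cnj (U i k)))"
    "card {i. i < n \<and> s i = 1} = (n + 1) div 2" "card {i. i < n \<and> s i = - 1} = n div 2"
proof -
  have herm: "cnj (coeff (int k - int j)) = coeff (int j - int k)" for j k by (simp add: coeff_cnj)
  have cs: "coeff (int (n - 1 - j) - int (n - 1 - k)) = coeff (int j - int k)" if "j < n" "k < n" for j k
  proof -
    have "int (n - 1 - j) - int (n - 1 - k) = - (int j - int k)" using that by (simp add: of_nat_diff)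
    thus ?thesis by (simp only: coeff_even)
  qed
  obtain U a s where U: "orthonormal_family n U"
    and T: "\<And>j k. j < n \<Longrightarrow> k < n \<Longrightarrow> coeff (int j - int k) = (\<Sum>i<n. of_real (a i) * (U i j * cnj (U i k)))"
    and Y: "\<And>j k. j < n \<Longrightarrow> k < n \<Longrightarrow>
       (\<Sum>i<n. of_real (s i) * (U i j * cnj (U i k))) = (if j + k + 1 = n then 1 else 0)"
    and flip: "\<And>i k. i < n \<Longrightarrow> k < n \<Longrightarrow> U i (n - 1 - k) = of_real (s i) * U i k"
    and s: "\<And>i. i < n \<Longrightarrow> s i = (1::real) \<or> s i = - 1"
    using centrosymmetric_diagonalizable[of n "\<lambda>j k. coeff (int j - int k)", OF herm cs] by blast
  have "eigenpair n (U i) (a i)" if i: "i < n" for i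
    unfolding eigenpair_def
  proof (intro conjI allI impI)
    have "complex_of_real (\<Sum>k<n. (cmod (U i k))\<^sup>2) = (\<Sum>k<n. U i k * cnj (U i k))"
      by (simp add: complex_norm_square del: of_real_power)
    also have "\<dots> = of_real 1" using U i by (simp add: orthonormal_family_def)
    finally show "(\<Sum>k<n. (cmod (U i k))\<^sup>2) = 1" unfolding of_real_eq_iff .
    fix j assume j: "j < n"
    have "(\<Sum>k<n. coeff (int j - int k) * U i k)
        = (\<Sum>k<n. (\<Sum>l<n. of_real (a l) * (U l j * cnj (U l k))) * U i k)"
      using j by (intro sum.cong refl) (simp add: T)
    also have "\<dots> = of_real (a i) * U i j" by (rule spectral_form_eigen[OF U i])
    finally show "(\<Sum>k<n. coeff (int j - int k) * U i k) = of_real (a i) * U i j" .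
  qed
  hence es: "eigensystem n U a s" using U flip s unfolding eigensystem_def by blast
  have H: "coeff (int (n - 1 - j) - int k) = (\<Sum>i<n. of_real (s i * a i) * (U i j * cnj (U i k)))"
    if "j < n" "k < n" for j k
  proof -
    have "coeff (int (n - 1 - j) - int k) = (\<Sum>i<n. of_real (a i) * (U i (n - 1 - j) * cnj (U i k)))"
      using that by (intro T) auto
    also have "\<dots> = (\<Sum>i<n. of_real (s i * a i) * (U i j * cnj (U i k)))"
      using that by (intro sum.cong refl) (simp only: flip lessThan_iff of_real_mult mult_ac)
    finally show ?thesis .
  qed
  show thesis by (rule that[OF es T H sign_counts[OF U Y s]])
qed

end

text \<open>Points with odd index carry the symmetric eigenvectors, points with even index the
  antisymmetric ones.\<close>

lemma interleaved_bijection: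
  fixes n :: nat
  assumes \<tau>1: "bij_betw \<tau>1 {1..(n + 1) div 2} A" and \<tau>2: "bij_betw \<tau>2 {1..n div 2} B"
    and AB: "A \<inter> B = {}"
  shows "bij_betw (\<lambda>i. if odd i then \<tau>1 ((i + 1) div 2) else \<tau>2 (i div 2)) {1..n} (A \<union> B)"
proof -
  let ?\<sigma> = "\<lambda>i. if odd i then \<tau>1 ((i + 1) div 2) else \<tau>2 (i div 2)"
  have "bij_betw (\<lambda>i. (i + 1) div 2) {i \<in> {1..n}. odd i} {1..(n + 1) div 2}"
    by (rule bij_betw_byWitness[where f' = "\<lambda>j. 2 * j - 1"]) (auto elim!: oddE)
  from bij_betw_trans[OF this \<tau>1] have "bij_betw ?\<sigma> {i \<in> {1..n}. odd i} A"
    by (rule bij_betw_cong[THEN iffD1, rotated]) simp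
  moreover have "bij_betw (\<lambda>i. i div 2) {i \<in> {1..n}. even i} {1..n div 2}"
    by (rule bij_betw_byWitness[where f' = "\<lambda>j. 2 * j"]) (auto elim!: evenE)
  from bij_betw_trans[OF this \<tau>2] have "bij_betw ?\<sigma> {i \<in> {1..n}. even i} B"
    by (rule bij_betw_cong[THEN iffD1, rotated]) simp
  ultimately have "bij_betw ?\<sigma> ({i \<in> {1..n}. odd i} \<union> {i \<in> {1..n}. even i}) (A \<union> B)"
    using AB by (rule bij_betw_combine)
  moreover have "{i \<in> {1..n}. odd i} \<union> {i \<in> {1..n}. even i} = {1..n}" by auto
  ultimately show ?thesis by simp
qed

text \<open>For either parity the relative position differs from \<open>i / n\<close> by at most
  \<open>1 / n\<close>: for \<open>i = 2 k + 1\<close> and \<open>n = 2 m + 1\<close>, for instance,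
  \<open>n\<close> times the difference is \<open>(m - k) / (m + 1)\<close>.\<close>

lemma interleaved_grid_error:
  assumes i: "i \<in> {1..n}"
  shows "odd i \<Longrightarrow> \<bar>real ((i + 1) div 2) * pi / real ((n + 1) div 2) - real i * (pi / real n)\<bar> \<le> pi / real n"
    and "even i \<Longrightarrow> \<bar>real (i div 2) * pi / real (n div 2) - real i * (pi / real n)\<bar> \<le> pi / real n"
proof -
  have n: "real n > 0" "real i \<le> real n" "1 \<le> real i" using i by auto
  have scale: "\<bar>x * pi - real i * (pi / real n)\<bar> \<le> pi / real n" if "\<bar>x * real n - real i\<bar> \<le> 1" for x
  proof -
    have "x * pi - real i * (pi / real n) = (x * real n - real i) * (pi / real n)"
      using n by (simp add: field_simps)
    hence "\<bar>x * pi - real i * (pi / real n)\<bar> = \<bar>x * real n - real i\<bar> * (pi / real n)"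
      by (simp add: abs_mult)
    also have "\<dots> \<le> 1 * (pi / real n)" using that by (intro mult_right_mono) auto
    finally show ?thesis by simp
  qed
  {
    assume "odd i"
    then obtain k where k: "i = 2 * k + 1" by (elim oddE)
    have "\<bar>real ((i + 1) div 2) / real ((n + 1) div 2) * real n - real i\<bar> \<le> 1"
    proof (cases "even n")
      case True
      then obtain m where "n = 2 * m" by (elim evenE)
      thus ?thesis using k n by (simp add: field_simps)
    next
      case False
      then obtain m where m: "n = 2 * m + 1" by (elim oddE)
      hence "real k \<le> real m" using k i by simp
      thus ?thesis using k m n by (simp add: abs_le_iff field_simps)
    qed
    from scale[OF this]
    show "\<bar>real ((i + 1) div 2) * pi / real ((n + 1) div 2) - real i * (pi / real n)\<bar> \<le> pi / real n" by simp
  }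
  {
    assume "even i"
    then obtain k where k: "i = 2 * k" by (elim evenE)
    have "\<bar>real (i div 2) / real (n div 2) * real n - real i\<bar> \<le> 1"
    proof (cases "even n")
      case True
      then obtain m where "n = 2 * m" by (elim evenE)
      thus ?thesis using k n by (simp add: field_simps)
    next
      case False
      then obtain m where m: "n = 2 * m + 1" by (elim oddE)
      hence "real k \<le> real m" "real m > 0" using k i by auto
      thus ?thesis using k m n by (simp add: abs_le_iff field_simps)
    qed
    from scale[OF this]
    show "\<bar>real (i div 2) * pi / real (n div 2) - real i * (pi / real n)\<bar> \<le> pi / real n" by simp
  }
qed

theorem theorem8:
  fixes f :: "real \<Rightarrow> real"
  assumes even: "\<forall>x\<in>{-pi..pi}. f (- x) = f x"
    and integrable: "riemann_integrable_on f (-pi) pi"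
    and range: "connected (f ` {-pi..pi})"
    and maxima: "finite (local_max_points f {-pi..pi})"
    and minima: "finite (local_min_points f {-pi..pi})"
    and discontinuities: "finite (discontinuity_points f {-pi..pi})"
  shows "\<exists>(\<xi> :: nat \<Rightarrow> nat \<Rightarrow> real) (lT :: nat \<Rightarrow> nat \<Rightarrow> real) (lH :: nat \<Rightarrow> nat \<Rightarrow> real).
    asymptotically_uniform_grid 0 pi \<xi> \<and>
    (\<forall>n\<ge>1.
      eigenvalue_ordering (toeplitz_mat n (\<lambda>x. complex_of_real (f x)))
        (\<lambda>i. complex_of_real (lT n i)) \<and>
      eigenvalue_ordering (hankel_mat n (\<lambda>x. complex_of_real (f x)))
        (\<lambda>i. complex_of_real (lH n i)) \<and>
      (\<forall>i\<in>{1..n}. lT n i = f (\<xi> n i) \<and> lH n i = (- 1) ^ (i + 1) * lT n i))"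
proof -
  interpret level_symbol f
  proof
    show "f (- x) = f x" if "x \<in> {-pi..pi}" for x using even that by blast
    show "bounded (f ` {-pi..pi})" by (rule riemann_integrable_bounded[OF integrable])
    show "finite {x \<in> {-pi..pi}. f x = t}" for t
      by (rule finite_level_set[OF maxima minima discontinuities])
  qed (rule discontinuities)
  \<comment> \<open>One predicate, so that a single choice fixes \<open>U\<close>, \<open>a\<close>
    and \<open>s\<close> for every \<open>n\<close>: vectors, eigenvalues and signs must belong
    together.\<close>
  define spec where "spec n U a s \<longleftrightarrow> eigensystem n U a s \<and>
    (\<forall>j<n. \<forall>k<n. coeff (int j - int k) = (\<Sum>i<n. of_real (a i) * (U i j * cnj (U i k)))) \<and>
    (\<forall>j<n. \<forall>k<n. coeff (int (n - 1 - j) - int k) = (\<Sum>i<n. of_real (s i * a i) * (U i j * cnj (U i k)))) \<and>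
    card {i. i < n \<and> s i = 1} = (n + 1) div 2 \<and> card {i. i < n \<and> s i = - 1} = n div 2" for n U a s
  have "\<exists>U a s. spec n U a s" for n
  proof -
    obtain U a s where "spec n U a s"
      by (rule eigensystem_exists[of n]) (rule that, unfold spec_def, intro conjI allI impI)
    thus ?thesis by (intro exI)
  qed
  then obtain U a s where spec: "\<And>n. spec n (U n) (a n) (s n)" by metis
  have es: "eigensystem n (U n) (a n) (s n)" for n using spec[of n] by (simp add: spec_def)
  have U: "orthonormal_family n (U n)" and sgn: "\<And>i. i < n \<Longrightarrow> s n i = 1 \<or> s n i = - 1" for n
    using es[of n] by (auto simp: eigensystem_def)
  define A where "A n = {i. i < n \<and> s n i = 1}" for n
  define B where "B n = {i. i < n \<and> s n i = - 1}" for n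
  have cA: "card (A n) = (n + 1) div 2" and cB: "card (B n) = n div 2" for n
    using spec[of n] by (auto simp: spec_def A_def B_def)
  have "equidistributed A a" unfolding A_def
  proof (rule eigensystem_equidistributed[OF es range])
    show "(\<lambda>n. real n / real (card {i. i < n \<and> s n i = 1})) \<longlonglongrightarrow> 2"
      unfolding A_def[symmetric] cA by real_asymp
    show "filterlim (\<lambda>n. card {i. i < n \<and> s n i = 1}) at_top sequentially"
      unfolding A_def[symmetric] cA by real_asymp
  qed simp
  then obtain \<tau>A \<xi>A where A: "\<And>n. bij_betw (\<tau>A n) {1..(n + 1) div 2} (A n)"
    "\<And>n j. j \<in> {1..(n + 1) div 2} \<Longrightarrow> \<xi>A n j \<in> {0..pi} \<and> f (\<xi>A n j) = a n (\<tau>A n j)"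
    "\<And>\<epsilon>. \<epsilon> > 0 \<Longrightarrow> eventually (\<lambda>n. \<forall>j\<in>{1..(n + 1) div 2}.
        \<bar>\<xi>A n j - real j * pi / real ((n + 1) div 2)\<bar> < \<epsilon>) sequentially"
    by (rule uniform_lift[where I = A and a = a, unfolded cA]) (assumption | rule that)+
  have "equidistributed B a" unfolding B_def
  proof (rule eigensystem_equidistributed[OF es range])
    show "(\<lambda>n. real n / real (card {i. i < n \<and> s n i = - 1})) \<longlonglongrightarrow> 2"
      unfolding B_def[symmetric] cB by real_asymp
    show "filterlim (\<lambda>n. card {i. i < n \<and> s n i = - 1}) at_top sequentially"
      unfolding B_def[symmetric] cB by real_asymp
  qed simp
  then obtain \<tau>B \<xi>B where B: "\<And>n. bij_betw (\<tau>B n) {1..n div 2} (B n)"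
    "\<And>n j. j \<in> {1..n div 2} \<Longrightarrow> \<xi>B n j \<in> {0..pi} \<and> f (\<xi>B n j) = a n (\<tau>B n j)"
    "\<And>\<epsilon>. \<epsilon> > 0 \<Longrightarrow> eventually (\<lambda>n. \<forall>j\<in>{1..n div 2}.
        \<bar>\<xi>B n j - real j * pi / real (n div 2)\<bar> < \<epsilon>) sequentially"
    by (rule uniform_lift[where I = B and a = a, unfolded cB]) (assumption | rule that)+
  \<comment> \<open>\<tau> and \<xi> interleave in the same way, so that each position keeps its
    eigenvector and the preimage of its eigenvalue together.\<close>
  define \<tau> where "\<tau> n i = (if odd i then \<tau>A n ((i + 1) div 2) else \<tau>B n (i div 2))" for n i
  define \<xi> where "\<xi> n i = (if odd i then \<xi>A n ((i + 1) div 2) else \<xi>B n (i div 2))" for n i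
  have half: "odd i \<Longrightarrow> (i + 1) div 2 \<in> {1..(n + 1) div 2}" "even i \<Longrightarrow> i div 2 \<in> {1..n div 2}"
    if "i \<in> {1..n}" for i n :: nat
    using that by (auto intro: div_le_mono elim!: oddE evenE)
  have bij: "bij_betw (\<tau> n) {1..n} {..<n}" for n
  proof -
    have "A n \<union> B n = {..<n}" using sgn by (auto simp: A_def B_def)
    moreover have "A n \<inter> B n = {}" by (auto simp: A_def B_def)
    ultimately show ?thesis
      using interleaved_bijection[OF A(1)[of n] B(1)[of n]] by (simp add: \<tau>_def[abs_def])
  qed
  have \<xi>: "\<xi> n i \<in> {0..pi} \<and> f (\<xi> n i) = a n (\<tau> n i)" if "i \<in> {1..n}" for n i
    using A(2)[OF half(1)[OF that]] B(2)[OF half(2)[OF that]] by (simp add: \<xi>_def \<tau>_def)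
  have sign: "s n (\<tau> n i) = (- 1) ^ (i + 1)" if i: "i \<in> {1..n}" for n i
  proof (cases "odd i")
    case True
    have "\<tau> n i \<in> A n" using bij_betw_apply[OF A(1) half(1)[OF i True]] True by (simp add: \<tau>_def)
    thus ?thesis using True by (simp add: A_def)
  next
    case False
    have "\<tau> n i \<in> B n" using bij_betw_apply[OF B(1) half(2)[OF i]] False by (simp add: \<tau>_def)
    thus ?thesis using False by (simp add: B_def)
  qed
  define lT where "lT n i = a n (\<tau> n i)" for n i
  define lH where "lH n i = s n (\<tau> n i) * a n (\<tau> n i)" for n i
  have "asymptotically_uniform_grid 0 pi \<xi>"
    unfolding asymptotically_uniform_grid_def
  proof (intro conjI allI impI ballI)
    show "\<xi> n i \<in> {0..pi}" if "i \<in> {1..n}" for n i using \<xi>[OF that] by blast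
    show "(\<lambda>n. MAX i\<in>{1..n}. \<bar>\<xi> n i - (0 + real i * ((pi - 0) / real n))\<bar>) \<longlonglongrightarrow> 0"
    proof (rule tendstoI)
      \<comment> \<open>Half of \<open>e\<close> for the distance to the grid of the symmetry class,
        half for the interleaving error of at most \<open>pi / n\<close>.\<close>
      have close: "\<bar>x - z\<bar> < e" if "\<bar>x - y\<bar> < e / 2" "\<bar>y - z\<bar> \<le> d" "d < e / 2" for x y z d e :: real
        using that by linarith
      fix e :: real assume e: "e > 0"
      have "(\<lambda>n. pi / real n) \<longlonglongrightarrow> 0" by real_asymp
      from order_tendstoD(2)[OF this, of "e / 2"] e
      have "eventually (\<lambda>n. pi / real n < e / 2) sequentially" by simp
      moreover have "eventually (\<lambda>n. \<forall>j\<in>{1..(n + 1) div 2}.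
          \<bar>\<xi>A n j - real j * pi / real ((n + 1) div 2)\<bar> < e / 2) sequentially" using e by (intro A(3)) simp
      moreover have "eventually (\<lambda>n. \<forall>j\<in>{1..n div 2}.
          \<bar>\<xi>B n j - real j * pi / real (n div 2)\<bar> < e / 2) sequentially" using e by (intro B(3)) simp
      ultimately show "eventually (\<lambda>n. dist (MAX i\<in>{1..n}. \<bar>\<xi> n i - (0 + real i * ((pi - 0) / real n))\<bar>) 0 < e) sequentially"
        using eventually_ge_at_top[of 1]
      proof eventually_elim
        case (elim n)
        let ?E = "(\<lambda>i. \<bar>\<xi> n i - (0 + real i * ((pi - 0) / real n))\<bar>) ` {1..n}"
        have "\<bar>\<xi> n i - (0 + real i * ((pi - 0) / real n))\<bar> < e" if i: "i \<in> {1..n}" for i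
        proof (cases "odd i")
          case True
          have "\<bar>\<xi> n i - real ((i + 1) div 2) * pi / real ((n + 1) div 2)\<bar> < e / 2"
            using bspec[OF elim(2) half(1)[OF i True]] True by (simp add: \<xi>_def)
          thus ?thesis
            unfolding add_0 diff_0_right by (rule close[OF _ interleaved_grid_error(1)[OF i True] elim(1)])
        next
          case False
          hence ev: "even i" by simp
          have "\<bar>\<xi> n i - real (i div 2) * pi / real (n div 2)\<bar> < e / 2"
            using bspec[OF elim(3) half(2)[OF i ev]] ev by (simp add: \<xi>_def)
          thus ?thesis
            unfolding add_0 diff_0_right by (rule close[OF _ interleaved_grid_error(2)[OF i ev] elim(1)])
        qed
        moreover have "?E \<noteq> {}" "finite ?E" using elim(4) by auto
        ultimately have "Max ?E < e" by (subst Max_less_iff) auto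
        moreover have "0 \<le> Max ?E"
          by (rule order_trans[OF abs_ge_zero Max_ge[OF \<open>finite ?E\<close>]]) (use elim(4) in auto)
        ultimately show ?case by (simp add: dist_real_def)
      qed
    qed
  qed
  moreover have "eigenvalue_ordering (toeplitz_mat n (\<lambda>x. complex_of_real (f x))) (\<lambda>i. complex_of_real (lT n i))" for n
  proof (rule eigenvalue_ordering_spectral_form[OF U _ _ bij])
    show "toeplitz_mat n (\<lambda>x. complex_of_real (f x)) \<in> carrier_mat n n" by (simp add: toeplitz_mat_def)
    show "toeplitz_mat n (\<lambda>x. complex_of_real (f x)) $$ (j, k)
        = (\<Sum>i<n. complex_of_real (a n i) * (U n i j * cnj (U n i k)))" if "j < n" "k < n" for j k
      using spec[of n] that unfolding spec_def toeplitz_entry[OF that] by blast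
  qed (simp add: lT_def)
  \<comment> \<open>Both matrices are ordered by the same \<open>\<tau> n\<close>, which couples
    their eigenvalues index by index.\<close>
  moreover have "eigenvalue_ordering (hankel_mat n (\<lambda>x. complex_of_real (f x))) (\<lambda>i. complex_of_real (lH n i))" for n
  proof (rule eigenvalue_ordering_spectral_form[OF U _ _ bij])
    show "hankel_mat n (\<lambda>x. complex_of_real (f x)) \<in> carrier_mat n n"
      unfolding hankel_mat_def
      by (rule mult_carrier_mat[of _ n n]) (simp_all add: flip_mat_def toeplitz_mat_def)
    show "hankel_mat n (\<lambda>x. complex_of_real (f x)) $$ (j, k)
        = (\<Sum>i<n. complex_of_real (s n i * a n i) * (U n i j * cnj (U n i k)))" if "j < n" "k < n" for j k
      using spec[of n] that unfolding spec_def hankel_entry[OF that] by blast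
  qed (simp add: lH_def)
  moreover have "lT n i = f (\<xi> n i) \<and> lH n i = (- 1) ^ (i + 1) * lT n i" if "i \<in> {1..n}" for n i
    using \<xi>[OF that] sign[OF that] by (simp add: lT_def lH_def)
  ultimately show ?thesis by (intro exI[of _ \<xi>] exI[of _ lT] exI[of _ lH]) blast
qed

end
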